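(* Let $\mathcal Q$ be any acyclic connected quiver with two vertices $1,2$. Then $\{\beta(\eta) : \eta\in\bigcup_{\sigma\in P_{\mathcal Q}}\Gamma_\sigma\}$ is precisely the set of real Schur roots of $\mathcal Q$.
   Context: Let $\mathcal Q$ be an acyclic connected quiver with $N$ vertices labelled by $I=\{1,\dots,N\}$. A real Schur root of $\mathcal Q$ is the dimension vector of an indecomposable module $M$ over the path algebra of $\mathcal Q$ (over an algebraically closed field) with $\mathrm{Ext}^1(M,M)=0$; dimension vectors $(m_i)$ are identified with $\sum m_i\alpha_i$. **Weyl group.** The Cartan matrix of $\mathcal Q$ has $a_{ii}=2$ and $a_{ij}=-(\text{number of arrows between } i \text{ and } j)$ for $i\neq j$. Let $\alpha_i$ be the simple roots, $s_i(\alpha_j)=\alpha_j-a_{ij}\alpha_i$ the simple reflections, $W$ the Weyl group. Positive real roots correspond bijectively to reflections in $W$, $w\alpha_i\leftrightarrow ws_iw^{-1}$. Let $\mathfrak W$ be the set of words $i_1\cdots i_k$ in the alphabet $I$ with no two consecutive letters equal; for $w\in W$ let $R_w\subset\mathfrak W$ be the set of words with $s_{i_1}\cdots s_{i_k}=w$ (not necessarily reduced), and let $R=\bigcup R_w$ over all reflections $w\in W$. **Surfaces.** Let $P_{\mathcal Q}\subset S_N$ be the set of permutations $\sigma$ of $I$ such that there is no arrow from $\sigma(j)$ to $\sigma(i)$ for any $j>i$. For $\sigma\in P_{\mathcal Q}$ take two copies $G_1,G_2$ of a regular $N$-gon (a bigon if $N=2$), and label the edges of each by $T_{\sigma(1)},\dots,T_{\sigma(N)}$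 counter-clockwise. On $G_i$ let $L_i$ be the line segment from the center of $G_i$ to the common endpoint of $T_{\sigma(N)}$ and $T_{\sigma(1)}$ at which the counter-clockwise labelling begins (the end of $T_{\sigma(N)}$ and the beginning of $T_{\sigma(1)}$ in counter-clockwise order). Orient all edges of $G_1$ counter-clockwise and all edges of $G_2$ clockwise. Let $\Sigma_\sigma$ be the compact surface obtained by gluing $G_1$ and $G_2$ along edges of the same label according to orientation (a sphere if $N=2$). Let $\mathcal T=T_1\cup\cdots\cup T_N\subset\Sigma_\sigma$ and let $V$ be the set of images of the vertices of the polygons (one point if $N$ is odd, two points if $N$ is even). **Admissible curves.** A $\sigma$-admissible curve is a continuous $\eta:[0,1]\to\Sigma_\sigma$ such that: (1) $\eta(x)\in V$ iff $x\in\{0,1\}$; (2) there is $\epsilon>0$ with $\eta([0,\epsilon])\subset L_1$ and $\eta([1-\epsilon,1])\subset L_2$; (3) if $\eta(x)\in\mathcal T\setminus V$ then $\eta([x-\epsilon,x+\epsilon])$ meets $\mathcal T$ transversally for sufficiently small $\epsilon>0$; (4) $\upsilon(\eta)\in R$, where $\upsilon(\eta)=i_1\cdots i_k$ is given by $\{x\in(0,1):\eta(x)\in\mathcal T\}=\{x_1<\cdots<x_k\}$ and $\eta(x_\ell)\in T_{i_\ell}$. Let $\Gamma_\sigma$ be the set of (isotopy classes of) $\sigma$-admissible curves without self-intersections, i.e. $\eta(x_1)=\eta(x_2)$ implies $x_1=x_2$ or $\{x_1,x_2\}=\{0,1\}$. For $\eta\in\Gamma_\sigma$, $\beta(\eta)$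 is the positive real root corresponding to the reflection $w$ with $\upsilon(\eta)\in R_w$. *)

theory Defs
  imports
    "HOL-Analysis.Analysis"
    "HOL-Combinatorics.Permutations"
    "HOL-Algebra.Ring"
    "HOL-Computational_Algebra.Polynomial"
    "Jordan_Normal_Form.DL_Rank"
    "Graph_Theory.Graph_Theory"
begin

section \<open>Quivers, path algebras and real Schur roots\<close>

text \<open>
  A quiver is a finite directed multigraph (\<^const>\<open>fin_digraph\<close>). A path is a triple \<open>(u, p, v)\<close>
  with \<open>p\<close> a walk from \<open>u\<close> to \<open>v\<close>; the trivial path at \<open>i\<close> is \<open>(i, [], i)\<close>. In the path algebra
  paths compose like functions, so in a left module an arrow \<open>i \<rightarrow> j\<close> maps \<open>e\<^sub>i M\<close> to \<open>e\<^sub>j M\<close>.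
\<close>

type_synonym ('v, 'a) path = "'v \<times> 'a list \<times> 'v"

definition quiver_paths :: "('v, 'a) pre_digraph \<Rightarrow> ('v, 'a) path set" where
  "quiver_paths Q = {(u, p, v). pre_digraph.awalk Q u p v}"

definition path_algebra :: "('v, 'a) pre_digraph \<Rightarrow> (('v, 'a) path \<Rightarrow> 'k::field) ring" where
  "path_algebra Q = \<lparr>
     carrier = {f. finite {x. f x \<noteq> 0} \<and> {x. f x \<noteq> 0} \<subseteq> quiver_paths Q},
     mult = (\<lambda>f g (u, p, v).
       \<Sum>(q, w, r) | p = q @ r \<and> (u, q, w) \<in> quiver_paths Q \<and> (w, r, v) \<in> quiver_paths Q.
         f (w, r, v) * g (u, q, w)),
     one = (\<lambda>(u, p, v). if u \<in> verts Q \<and> p = [] \<and> v = u then 1 else 0),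
     zero = (\<lambda>_. 0),
     add = (\<lambda>f g x. f x + g x)\<rparr>"

definition vertex_idem :: "'v \<Rightarrow> ('v, 'a) path \<Rightarrow> 'k::field" where
  "vertex_idem i = (\<lambda>x. if x = (i, [], i) then 1 else 0)"

text \<open>
  A finite-dimensional module over the path algebra, with underlying vector space \<open>k\<^sup>n\<close>: a unital
  homomorphism of \<open>k\<close>-algebras from the path algebra to the \<open>n \<times> n\<close> matrices. Every
  finite-dimensional module is isomorphic to one of this form.
\<close>

definition is_module ::
  "('v, 'a) pre_digraph \<Rightarrow> nat \<Rightarrow> ((('v, 'a) path \<Rightarrow> 'k::field) \<Rightarrow> 'k mat) \<Rightarrow> bool" where
  "is_module Q n \<rho> \<longleftrightarrow>
     \<rho> \<in> Ring.ring_hom (path_algebra Q) (ring_mat TYPE('k) n ()) \<and>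
     (\<forall>c. \<forall>f \<in> carrier (path_algebra Q). \<rho> (\<lambda>x. c * f x) = c \<cdot>\<^sub>m \<rho> f)"

definition is_module_hom ::
  "('v, 'a) pre_digraph \<Rightarrow> nat \<Rightarrow> ((('v, 'a) path \<Rightarrow> 'k::field) \<Rightarrow> 'k mat) \<Rightarrow>
   nat \<Rightarrow> ((('v, 'a) path \<Rightarrow> 'k) \<Rightarrow> 'k mat) \<Rightarrow> 'k mat \<Rightarrow> bool" where
  "is_module_hom Q n \<rho> n' \<rho>' X \<longleftrightarrow>
     X \<in> carrier_mat n' n \<and> (\<forall>f \<in> carrier (path_algebra Q). X * \<rho> f = \<rho>' f * X)"

definition module_iso ::
  "('v, 'a) pre_digraph \<Rightarrow> nat \<Rightarrow> ((('v, 'a) path \<Rightarrow> 'k::field) \<Rightarrow> 'k mat) \<Rightarrow>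
   nat \<Rightarrow> ((('v, 'a) path \<Rightarrow> 'k) \<Rightarrow> 'k mat) \<Rightarrow> bool" where
  "module_iso Q n \<rho> n' \<rho>' \<longleftrightarrow>
     (\<exists>X Y. is_module_hom Q n \<rho> n' \<rho>' X \<and> is_module_hom Q n' \<rho>' n \<rho> Y \<and>
            Y * X = 1\<^sub>m n \<and> X * Y = 1\<^sub>m n')"

definition direct_sum ::
  "nat \<Rightarrow> ('f \<Rightarrow> 'k::field mat) \<Rightarrow> nat \<Rightarrow> ('f \<Rightarrow> 'k mat) \<Rightarrow> 'f \<Rightarrow> 'k mat" where
  "direct_sum n \<rho> n' \<rho>' = (\<lambda>f. four_block_mat (\<rho> f) (0\<^sub>m n n') (0\<^sub>m n' n) (\<rho>' f))"

definition indecomposable ::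
  "('v, 'a) pre_digraph \<Rightarrow> nat \<Rightarrow> ((('v, 'a) path \<Rightarrow> 'k::field) \<Rightarrow> 'k mat) \<Rightarrow> bool" where
  "indecomposable Q n \<rho> \<longleftrightarrow> n > 0 \<and>
     \<not> (\<exists>n1 \<rho>1 n2 \<rho>2. n1 > 0 \<and> n2 > 0 \<and> is_module Q n1 \<rho>1 \<and> is_module Q n2 \<rho>2 \<and>
          module_iso Q n \<rho> (n1 + n2) (direct_sum n1 \<rho>1 n2 \<rho>2))"

text \<open>
  \<open>Ext\<^sup>1\<close> in the sense of Yoneda: \<open>Ext\<^sup>1(M'', M') = 0\<close> iff every short exact sequence
  \<open>0 \<rightarrow> M' \<rightarrow> E \<rightarrow> M'' \<rightarrow> 0\<close> of modules splits.
\<close>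

definition short_exact ::
  "('v, 'a) pre_digraph \<Rightarrow> nat \<Rightarrow> ((('v, 'a) path \<Rightarrow> 'k::field) \<Rightarrow> 'k mat) \<Rightarrow>
   nat \<Rightarrow> ((('v, 'a) path \<Rightarrow> 'k) \<Rightarrow> 'k mat) \<Rightarrow>
   nat \<Rightarrow> ((('v, 'a) path \<Rightarrow> 'k) \<Rightarrow> 'k mat) \<Rightarrow> 'k mat \<Rightarrow> 'k mat \<Rightarrow> bool" where
  "short_exact Q n' \<rho>' m \<epsilon> n'' \<rho>'' X Y \<longleftrightarrow>
     is_module_hom Q n' \<rho>' m \<epsilon> X \<and> is_module_hom Q m \<epsilon> n'' \<rho>'' Y \<and>
     inj_on ((*\<^sub>v) X) (carrier_vec n') \<and>
     (*\<^sub>v) X ` carrier_vec n' = {v \<in> carrier_vec m. Y *\<^sub>v v = 0\<^sub>v n''} \<and>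
     (*\<^sub>v) Y ` carrier_vec m = carrier_vec n''"

definition Ext1_vanishes ::
  "('v, 'a) pre_digraph \<Rightarrow> nat \<Rightarrow> ((('v, 'a) path \<Rightarrow> 'k::field) \<Rightarrow> 'k mat) \<Rightarrow>
   nat \<Rightarrow> ((('v, 'a) path \<Rightarrow> 'k) \<Rightarrow> 'k mat) \<Rightarrow> bool" where
  "Ext1_vanishes Q n'' \<rho>'' n' \<rho>' \<longleftrightarrow>
     (\<forall>m \<epsilon> X Y. is_module Q m \<epsilon> \<and> short_exact Q n' \<rho>' m \<epsilon> n'' \<rho>'' X Y \<longrightarrow>
        (\<exists>S. is_module_hom Q n'' \<rho>'' m \<epsilon> S \<and> Y * S = 1\<^sub>m n''))"

text \<open>
  The coordinate at \<open>i\<close> is \<open>dim e\<^sub>i M\<close>. The integer function \<open>m\<close> stands for \<open>\<Sum>\<^sub>i m\<^sub>i \<alpha>\<^sub>i\<close>.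
\<close>

definition dimension_vector ::
  "('v, 'a) pre_digraph \<Rightarrow> nat \<Rightarrow> ((('v, 'a) path \<Rightarrow> 'k::field) \<Rightarrow> 'k mat) \<Rightarrow> 'v \<Rightarrow> int" where
  "dimension_vector Q n \<rho> =
     (\<lambda>i. if i \<in> verts Q then int (vec_space.rank n (\<rho> (vertex_idem i))) else 0)"

definition real_schur_roots ::
  "'k::alg_closed_field itself \<Rightarrow> ('v, 'a) pre_digraph \<Rightarrow> ('v \<Rightarrow> int) set" where
  "real_schur_roots _ Q =
     {dimension_vector Q n \<rho> | n (\<rho> :: (('v, 'a) path \<Rightarrow> 'k) \<Rightarrow> 'k mat).
        is_module Q n \<rho> \<and> indecomposable Q n \<rho> \<and> Ext1_vanishes Q n \<rho> n \<rho>}"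

section \<open>The Weyl group\<close>

definition cartan :: "('v, 'a) pre_digraph \<Rightarrow> 'v \<Rightarrow> 'v \<Rightarrow> int" where
  "cartan Q i j = (if i = j then 2
     else - int (card {a \<in> arcs Q. (tail Q a = i \<and> head Q a = j) \<or> (tail Q a = j \<and> head Q a = i)}))"

definition simple_root :: "'v \<Rightarrow> 'v \<Rightarrow> int" where
  "simple_root i = (\<lambda>j. if j = i then 1 else 0)"

text \<open>The linear extension of \<open>s\<^sub>i(\<alpha>\<^sub>j) = \<alpha>\<^sub>j - a\<^sub>i\<^sub>j \<alpha>\<^sub>i\<close>.\<close>

definition simple_reflection :: "('v, 'a) pre_digraph \<Rightarrow> 'v \<Rightarrow> ('v \<Rightarrow> int) \<Rightarrow> 'v \<Rightarrow> int" where
  "simple_reflection Q i x = (\<lambda>l. x l - (\<Sum>j \<in> verts Q. cartan Q i j * x j) * simple_root i l)"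

text \<open>The generators are involutions, so closing under left multiplication gives a group.\<close>

inductive_set weyl_group :: "('v, 'a) pre_digraph \<Rightarrow> (('v \<Rightarrow> int) \<Rightarrow> 'v \<Rightarrow> int) set"
  for Q :: "('v, 'a) pre_digraph" where
  one: "id \<in> weyl_group Q"
| step: "i \<in> verts Q \<Longrightarrow> w \<in> weyl_group Q \<Longrightarrow> simple_reflection Q i \<circ> w \<in> weyl_group Q"

definition reflections :: "('v, 'a) pre_digraph \<Rightarrow> (('v \<Rightarrow> int) \<Rightarrow> 'v \<Rightarrow> int) set" where
  "reflections Q = {w \<circ> simple_reflection Q i \<circ> inv_into UNIV w | w i. w \<in> weyl_group Q \<and> i \<in> verts Q}"

definition root_of_reflection ::
  "('v, 'a) pre_digraph \<Rightarrow> (('v \<Rightarrow> int) \<Rightarrow> 'v \<Rightarrow> int) \<Rightarrow> 'v \<Rightarrow> int" where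
  "root_of_reflection Q r = (THE \<beta>. (\<forall>j. \<beta> j \<ge> 0) \<and>
     (\<exists>w \<in> weyl_group Q. \<exists>i \<in> verts Q.
        \<beta> = w (simple_root i) \<and> r = w \<circ> simple_reflection Q i \<circ> inv_into UNIV w))"

definition word_product :: "('v, 'a) pre_digraph \<Rightarrow> 'v list \<Rightarrow> ('v \<Rightarrow> int) \<Rightarrow> 'v \<Rightarrow> int" where
  "word_product Q ws = foldr (\<lambda>i w. simple_reflection Q i \<circ> w) ws id"

text \<open>The set \<open>R\<close>: words without repeated adjacent letters that represent a reflection.\<close>

definition reflection_words :: "('v, 'a) pre_digraph \<Rightarrow> 'v list set" where
  "reflection_words Q =
     {ws. set ws \<subseteq> verts Q \<and> distinct_adj ws \<and> word_product Q ws \<in> reflections Q}"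

section \<open>The surface\<close>

text \<open>
  From here on the vertices of the quiver are \<open>1, \<dots>, N\<close>. Edge \<open>k\<close> of the \<open>N\<close>-gon is the \<open>k\<close>-th one
  counter-clockwise, starting at the point \<open>1\<close>, and \<open>polygon_edge N k\<close> traverses it
  counter-clockwise. The bigon is the unit disc, whose edges are the two closed half circles.
\<close>

definition polygon_edge :: "nat \<Rightarrow> nat \<Rightarrow> real \<Rightarrow> complex" where
  "polygon_edge N k t =
     (if N = 2 then cis (pi * (real k - 1 + t))
      else linepath (cis (2 * pi * (real k - 1) / real N)) (cis (2 * pi * real k / real N)) t)"

definition polygon_vertices :: "nat \<Rightarrow> complex set" where
  "polygon_vertices N = {cis (2 * pi * real k / real N) | k. k \<in> {1..N}}"

definition polygon :: "nat \<Rightarrow> complex set" where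
  "polygon N = (if N = 2 then cball 0 1 else convex hull (polygon_vertices N))"

definition quotient_topology :: "'a topology \<Rightarrow> ('a \<Rightarrow> 'b) \<Rightarrow> 'b topology" where
  "quotient_topology X f =
     topology (\<lambda>U. U \<subseteq> f ` topspace X \<and> openin X {x \<in> topspace X. f x \<in> U})"

lemma openin_quotient_topology:
  "openin (quotient_topology X f) U \<longleftrightarrow>
     U \<subseteq> f ` topspace X \<and> openin X {x \<in> topspace X. f x \<in> U}"
proof -
  have "istopology (\<lambda>U. U \<subseteq> f ` topspace X \<and> openin X {x \<in> topspace X. f x \<in> U})"
    unfolding istopology_def
  proof (intro conjI allI impI)
    fix S T assume "S \<subseteq> f ` topspace X \<and> openin X {x \<in> topspace X. f x \<in> S}"
      "T \<subseteq> f ` topspace X \<and> openin X {x \<in> topspace X. f x \<in> T}"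
    moreover have "{x \<in> topspace X. f x \<in> S \<inter> T} =
        {x \<in> topspace X. f x \<in> S} \<inter> {x \<in> topspace X. f x \<in> T}" by auto
    ultimately show "S \<inter> T \<subseteq> f ` topspace X" "openin X {x \<in> topspace X. f x \<in> S \<inter> T}"
      by (auto intro: openin_Int)
  next
    fix K assume K: "\<forall>S\<in>K. S \<subseteq> f ` topspace X \<and> openin X {x \<in> topspace X. f x \<in> S}"
    have "{x \<in> topspace X. f x \<in> \<Union>K} = (\<Union>S\<in>K. {x \<in> topspace X. f x \<in> S})" by auto
    with K show "\<Union>K \<subseteq> f ` topspace X" "openin X {x \<in> topspace X. f x \<in> \<Union>K}" by auto
  qed
  then show ?thesis by (simp add: quotient_topology_def)
qed

lemma quotient_map_quotient_topology: "quotient_map X (quotient_topology X f) f"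
proof -
  have "{x \<in> topspace X. f x \<in> f ` topspace X} = topspace X" by auto
  then have "openin (quotient_topology X f) (f ` topspace X)"
    by (simp add: openin_quotient_topology)
  then have "topspace (quotient_topology X f) = f ` topspace X"
    by (metis openin_quotient_topology openin_subset openin_topspace subset_antisym)
  then show ?thesis
    by (auto simp: quotient_map_def openin_quotient_topology)
qed

text \<open>
  The two polygons carry the indices \<open>1\<close> and \<open>2\<close>. Edges of \<open>G\<^sub>1\<close> are oriented counter-clockwise and
  those of \<open>G\<^sub>2\<close> clockwise, hence the \<open>1 - t\<close>. Both polygons have the same label on their \<open>k\<close>-th
  edge, so the glued space is independent of \<open>\<sigma>\<close>; only the names of the arcs depend on it.
\<close>

definition glued :: "nat \<Rightarrow> nat \<times> complex \<Rightarrow> nat \<times> complex \<Rightarrow> bool" where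
  "glued N x y \<longleftrightarrow> (\<exists>k \<in> {1..N}. \<exists>t \<in> {0..1}.
     x = (1, polygon_edge N k t) \<and> y = (2, polygon_edge N k (1 - t)))"

definition surface_proj :: "nat \<Rightarrow> nat \<times> complex \<Rightarrow> (nat \<times> complex) set" where
  "surface_proj N x = {y. equivclp (glued N) x y}"

definition surface :: "nat \<Rightarrow> (nat \<times> complex) set topology" where
  "surface N =
     quotient_topology (sum_topology (\<lambda>_. top_of_set (polygon N)) {1, 2}) (surface_proj N)"

definition marked_points :: "nat \<Rightarrow> (nat \<times> complex) set set" where
  "marked_points N = surface_proj N ` ({1, 2} \<times> polygon_vertices N)"

text \<open>\<open>arc_T N \<sigma> i\<close> is \<open>T\<^sub>i\<close>, i.e.\ the edge in the position \<open>k\<close> with \<open>\<sigma> k = i\<close>.\<close>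

definition arc_T :: "nat \<Rightarrow> (nat \<Rightarrow> nat) \<Rightarrow> nat \<Rightarrow> (nat \<times> complex) set set" where
  "arc_T N \<sigma> i = {surface_proj N (1, polygon_edge N k t) | k t.
     k \<in> {1..N} \<and> \<sigma> k = i \<and> t \<in> {0..1}}"

definition arcs_T :: "nat \<Rightarrow> (nat \<Rightarrow> nat) \<Rightarrow> (nat \<times> complex) set set" where
  "arcs_T N \<sigma> = (\<Union>i \<in> {1..N}. arc_T N \<sigma> i)"

definition segment_L :: "nat \<Rightarrow> nat \<Rightarrow> (nat \<times> complex) set set" where
  "segment_L N g = surface_proj N ` ({g} \<times> closed_segment 0 1)"

section \<open>Admissible curves\<close>

definition P_perms :: "(nat, 'a) pre_digraph \<Rightarrow> (nat \<Rightarrow> nat) set" where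
  "P_perms Q = {\<sigma>. \<sigma> permutes verts Q \<and>
     (\<forall>i \<in> verts Q. \<forall>j \<in> verts Q. i < j \<longrightarrow> (\<sigma> j, \<sigma> i) \<notin> arcs_ends Q)}"

text \<open>
  Topological transversality of the curve \<open>\<eta>\<close> and the set \<open>T\<close> at the time \<open>x\<close>: some chart of the
  surface around \<open>\<eta> x\<close> turns \<open>T\<close> into the real axis and, for times near \<open>x\<close>, the curve into
  a segment of the imaginary axis.
\<close>

definition transversal_at :: "'p topology \<Rightarrow> 'p set \<Rightarrow> (real \<Rightarrow> 'p) \<Rightarrow> real \<Rightarrow> bool" where
  "transversal_at X T \<eta> x \<longleftrightarrow>
     (\<exists>U (h :: 'p \<Rightarrow> complex).
        openin X U \<and> \<eta> x \<in> U \<and> open (h ` U) \<and>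
        homeomorphic_map (subtopology X U) (top_of_set (h ` U)) h \<and>
        (\<forall>p \<in> U. p \<in> T \<longleftrightarrow> Im (h p) = 0) \<and>
        (\<exists>\<epsilon>>0. \<forall>y \<in> {x - \<epsilon>..x + \<epsilon>}. \<eta> y \<in> U \<and> h (\<eta> y) = \<i> * of_real (y - x)))"

definition crossing_times :: "nat \<Rightarrow> (nat \<Rightarrow> nat) \<Rightarrow> (real \<Rightarrow> (nat \<times> complex) set) \<Rightarrow> real set" where
  "crossing_times N \<sigma> \<eta> = {x \<in> {0<..<1}. \<eta> x \<in> arcs_T N \<sigma>}"

definition crossing_word :: "nat \<Rightarrow> (nat \<Rightarrow> nat) \<Rightarrow> (real \<Rightarrow> (nat \<times> complex) set) \<Rightarrow> nat list" where
  "crossing_word N \<sigma> \<eta> =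
     map (\<lambda>x. THE i. i \<in> {1..N} \<and> \<eta> x \<in> arc_T N \<sigma> i)
       (sorted_list_of_set (crossing_times N \<sigma> \<eta>))"

definition admissible ::
  "(nat, 'a) pre_digraph \<Rightarrow> (nat \<Rightarrow> nat) \<Rightarrow> (real \<Rightarrow> (nat \<times> complex) set) \<Rightarrow> bool" where
  "admissible Q \<sigma> \<eta> \<longleftrightarrow> (let N = card (verts Q) in
     pathin (surface N) \<eta> \<and>
     (\<forall>x \<in> {0..1}. \<eta> x \<in> marked_points N \<longleftrightarrow> x \<in> {0, 1}) \<and>
     (\<exists>\<epsilon>>0. \<eta> ` {0..\<epsilon>} \<subseteq> segment_L N 1 \<and> \<eta> ` {1 - \<epsilon>..1} \<subseteq> segment_L N 2) \<and>
     (\<forall>x \<in> {0..1}. \<eta> x \<in> arcs_T N \<sigma> - marked_points N \<longrightarrow>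
        transversal_at (surface N) (arcs_T N \<sigma>) \<eta> x) \<and>
     finite (crossing_times N \<sigma> \<eta>) \<and>
     crossing_word N \<sigma> \<eta> \<in> reflection_words Q)"

definition simple_curve :: "(real \<Rightarrow> 'p) \<Rightarrow> bool" where
  "simple_curve \<eta> \<longleftrightarrow>
     (\<forall>x \<in> {0..1}. \<forall>y \<in> {0..1}. \<eta> x = \<eta> y \<longrightarrow> x = y \<or> {x, y} = {0, 1})"

definition Gamma_curves ::
  "(nat, 'a) pre_digraph \<Rightarrow> (nat \<Rightarrow> nat) \<Rightarrow> (real \<Rightarrow> (nat \<times> complex) set) set" where
  "Gamma_curves Q \<sigma> = {\<eta>. admissible Q \<sigma> \<eta> \<and> simple_curve \<eta>}"

definition curve_root ::
  "(nat, 'a) pre_digraph \<Rightarrow> (nat \<Rightarrow> nat) \<Rightarrow> (real \<Rightarrow> (nat \<times> complex) set) \<Rightarrow> nat \<Rightarrow> int" where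
  "curve_root Q \<sigma> \<eta> =
     root_of_reflection Q (word_product Q (crossing_word (card (verts Q)) \<sigma> \<eta>))"

end

theory Submission
  imports Defs
begin

text \<open>
  Let \<open>n\<close> be the number of arrows, which all go from a vertex \<open>s\<close> to a vertex \<open>t\<close>. Both sides of the
  theorem are the set of all positive real roots of the Weyl group, which is the set of nonnegative
  integer solutions of \<open>a\<^sup>2 + b\<^sup>2 - n a b = 1\<close>. The main tool is a descent: reflecting in the larger
  coordinate of a solution makes it smaller until a simple root is reached (\<open>tits_descent\<close>).

  Curves. The word of an admissible curve represents a reflection, and the root of a reflection is a
  positive real root (\<open>root_of_reflection_positive\<close>). Conversely every reflection is the product of an
  alternating word of odd length (\<open>positive_root_of_alternating_word\<close>), so it suffices to find a curve
  without self-intersections for each such word. The surface is a sphere on which the arcs \<open>T\<^sub>1\<close> and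
  \<open>T\<^sub>2\<close> are the two halves of the equator between the marked points
  (\<open>homeomorphic_map_sphere_coord\<close>). A spiral from one marked point to the other one, with
  \<open>m + 1 / 2\<close> turns about the axis through both, crosses the two arcs alternately \<open>2 m + 1\<close> times, and
  the sense of rotation decides which arc comes first (\<open>spiral_curve_exists\<close>).

  Modules. After a choice of bases of \<open>e\<^sub>s M\<close> and \<open>e\<^sub>t M\<close> a module is a tuple of matrices \<open>A\<^sub>e\<close>, one for each
  arrow (locale \<open>framed_module\<close>). The linear map
  \<open>(X, Y) \<mapsto> (A\<^sub>e X - Y A\<^sub>e)\<^sub>e\<close> has the kernel \<open>End M\<close> and the cokernel \<open>Ext\<^sup>1(M, M)\<close>. If
  \<open>Ext\<^sup>1(M, M) = 0\<close>, counting dimensions gives \<open>a\<^sup>2 + b\<^sup>2 - n a b = dim End M > 0\<close>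
  (\<open>rigid_tuple_tits\<close>). If moreover \<open>M\<close> is indecomposable, the reflection functor at the sink
  (\<open>reflect_tuple\<close>) and the descent lead to a simple module without changing the value of the form, which
  is therefore \<open>1\<close> (\<open>indecomposable_tits\<close>). In the opposite direction the reflection functor constructs
  a module with scalar endomorphisms for each solution (\<open>brick_exists\<close>). It is indecomposable, and the
  same count of dimensions shows that the linear map is onto, so that \<open>Ext\<^sup>1(M, M) = 0\<close>
  (\<open>brick_rigid\<close>).
\<close>


section \<open>Generalized Kronecker quivers and their Weyl group\<close>

text \<open>
  The descent step for the form \<open>a\<^sup>2 + b\<^sup>2 - n a b\<close>. Reflecting in the larger of two positive
  coordinates replaces \<open>a\<close> by the other root \<open>n b - a\<close> of the same quadratic equation, and the
  product of the two roots is \<open>b\<^sup>2\<close> minus the value of the form, hence less than \<open>a\<^sup>2\<close>.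
\<close>

lemma tits_descent:
  fixes a b n :: int
  assumes "a\<^sup>2 + b\<^sup>2 - n * a * b > 0" "a \<ge> b" "b > 0"
  shows "n * b - a < a"
proof -
  have "(n * b - a) * a = b\<^sup>2 - (a\<^sup>2 + b\<^sup>2 - n * a * b)"
    by (simp add: algebra_simps power2_eq_square)
  also have "\<dots> < a * a"
  proof -
    have "b\<^sup>2 \<le> a * a"
      using assms mult_mono[of b a b a] by (simp add: power2_eq_square)
    then show ?thesis using assms(1) by linarith
  qed
  finally show ?thesis
    using assms mult_right_less_imp_less[of "n * b - a" a a] by linarith
qed

fun alternating :: "'b \<Rightarrow> 'b \<Rightarrow> nat \<Rightarrow> 'b list" where
  "alternating i j 0 = []"
| "alternating i j (Suc k) = i # alternating j i k"

lemma alternating_snoc: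
  "alternating i j (Suc k) = alternating i j k @ [if even k then i else j]"
proof (induction k arbitrary: i j)
  case (Suc k)
  have "alternating i j (Suc (Suc k)) = i # alternating j i (Suc k)" by simp
  also have "\<dots> = i # alternating j i k @ [if even k then j else i]"
    by (simp only: Suc)
  finally show ?case by simp
qed simp

text \<open>
  An acyclic connected quiver with two vertices has all its arrows in one direction, and at least
  one of them.
\<close>

locale kronecker_quiver = fin_digraph Q for Q :: "('v, 'a) pre_digraph" +
  fixes s t :: 'v
  assumes verts_Q: "verts Q = {s, t}"
    and s_neq_t: "s \<noteq> t"
    and arcs_Q: "a \<in> arcs Q \<Longrightarrow> tail Q a = s \<and> head Q a = t"
    and arcs_nonempty: "arcs Q \<noteq> {}"
begin

abbreviation n_arrows :: int where
  "n_arrows \<equiv> int (card (arcs Q))"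

lemma n_arrows_pos: "n_arrows \<ge> 1"
  using arcs_nonempty finite_arcs by (simp add: Suc_le_eq card_gt_0_iff)

text \<open>
  The Weyl invariant symmetric form with \<open>(\<alpha>\<^sub>i, \<alpha>\<^sub>j) = a\<^sub>i\<^sub>j\<close>.
\<close>

definition bilinear :: "('v \<Rightarrow> int) \<Rightarrow> ('v \<Rightarrow> int) \<Rightarrow> int" where
  "bilinear x y = 2 * x s * y s + 2 * x t * y t - n_arrows * (x s * y t + x t * y s)"

definition reflection :: "('v \<Rightarrow> int) \<Rightarrow> ('v \<Rightarrow> int) \<Rightarrow> 'v \<Rightarrow> int" where
  "reflection b x = (\<lambda>l. x l - bilinear b x * b l)"

text \<open>
  For two vertices the real roots are exactly the integer vectors on which the form takes the value
  \<open>2\<close>: the lemmas \<open>real_root_cases\<close> and \<open>positive_root_in_orbit\<close> compare this with the orbits of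
  the simple roots. Both sides of the theorem will be shown to be this set.
\<close>

definition positive_roots :: "('v \<Rightarrow> int) set" where
  "positive_roots = {b. (\<forall>j. b j \<ge> 0) \<and> (\<forall>j. j \<notin> {s, t} \<longrightarrow> b j = 0) \<and>
     (b s)\<^sup>2 + (b t)\<^sup>2 - n_arrows * b s * b t = 1}"

lemma bilinear_self: "bilinear b b = 2 * ((b s)\<^sup>2 + (b t)\<^sup>2 - n_arrows * b s * b t)"
  by (simp add: bilinear_def algebra_simps power2_eq_square)

lemma cartan_values:
  "cartan Q s s = 2" "cartan Q t t = 2" "cartan Q s t = - n_arrows" "cartan Q t s = - n_arrows"
proof -
  have "{a \<in> arcs Q. (tail Q a = s \<and> head Q a = t) \<or> (tail Q a = t \<and> head Q a = s)} = arcs Q"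
    using arcs_Q by auto
  moreover have "{a \<in> arcs Q. (tail Q a = t \<and> head Q a = s) \<or> (tail Q a = s \<and> head Q a = t)} = arcs Q"
    using arcs_Q by auto
  ultimately show "cartan Q s s = 2" "cartan Q t t = 2" "cartan Q s t = - n_arrows"
    "cartan Q t s = - n_arrows"
    using s_neq_t by (simp_all add: cartan_def)
qed

lemma simple_reflection_eq:
  "i \<in> verts Q \<Longrightarrow> simple_reflection Q i = reflection (simple_root i)"
  using s_neq_t
  by (auto simp: verts_Q simple_reflection_def reflection_def bilinear_def cartan_values
      simple_root_def fun_eq_iff)

lemma bilinear_simple_root: "i \<in> verts Q \<Longrightarrow> bilinear (simple_root i) (simple_root i) = 2"
  using s_neq_t by (auto simp: verts_Q bilinear_def simple_root_def)

lemma bilinear_diff_right: "bilinear x (\<lambda>l. y l - c * z l) = bilinear x y - c * bilinear x z"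
  and bilinear_diff_left: "bilinear (\<lambda>l. y l - c * z l) x = bilinear y x - c * bilinear z x"
  and bilinear_commute: "bilinear x y = bilinear y x"
  by (simp_all add: bilinear_def algebra_simps)

lemma reflection_involution: "bilinear b b = 2 \<Longrightarrow> reflection b (reflection b x) = x"
  by (simp add: reflection_def bilinear_diff_right)

lemma simple_reflection_involution:
  "i \<in> verts Q \<Longrightarrow> simple_reflection Q i \<circ> simple_reflection Q i = id"
  by (simp add: fun_eq_iff simple_reflection_eq reflection_involution bilinear_simple_root)

lemma bilinear_reflection:
  "bilinear b b = 2 \<Longrightarrow> bilinear (reflection b x) (reflection b y) = bilinear x y"
  using bilinear_commute[of x b] by (simp add: reflection_def bilinear_diff_right bilinear_diff_left)

lemma weyl_bilinear: "w \<in> weyl_group Q \<Longrightarrow> bilinear (w x) (w y) = bilinear x y"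
  by (induction rule: weyl_group.induct)
    (simp_all add: simple_reflection_eq bilinear_reflection bilinear_simple_root)

lemma weyl_linear: "w \<in> weyl_group Q \<Longrightarrow> w (\<lambda>l. x l - c * y l) = (\<lambda>l. w x l - c * w y l)"
proof (induction rule: weyl_group.induct)
  case (step i w)
  then show ?case
    by (simp add: simple_reflection_eq reflection_def bilinear_diff_right)
      (simp add: fun_eq_iff algebra_simps)
qed simp

lemma weyl_bij: "w \<in> weyl_group Q \<Longrightarrow> bij w"
proof (induction rule: weyl_group.induct)
  case (step i w)
  then have "bij (simple_reflection Q i)"
    using simple_reflection_involution o_bij by blast
  then show ?case using step by (metis bij_comp)
next
  case one
  show ?case by (rule bij_id)
qed

lemma conjugate_eq_reflection:
  assumes "w \<in> weyl_group Q" "i \<in> verts Q"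
  shows "w \<circ> simple_reflection Q i \<circ> inv_into UNIV w = reflection (w (simple_root i))"
proof
  fix x
  have wx: "w (inv_into UNIV w x) = x"
    using weyl_bij[OF assms(1)] by (simp add: bij_is_surj surj_f_inv_f)
  then have "bilinear (simple_root i) (inv_into UNIV w x) = bilinear (w (simple_root i)) x"
    using weyl_bilinear[OF assms(1), of "simple_root i" "inv_into UNIV w x"] by simp
  then show "(w \<circ> simple_reflection Q i \<circ> inv_into UNIV w) x = reflection (w (simple_root i)) x"
    using wx assms by (simp add: simple_reflection_eq reflection_def weyl_linear)
qed

lemma weyl_support:
  "w \<in> weyl_group Q \<Longrightarrow> j \<notin> {s, t} \<Longrightarrow> w x j = x j"
  by (induction rule: weyl_group.induct)
    (auto simp: simple_reflection_eq reflection_def simple_root_def verts_Q)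

text \<open>
  The form takes the value \<open>2\<close> on a root, so its two coordinates cannot have opposite signs.
\<close>

lemma real_root_cases:
  assumes "w \<in> weyl_group Q" "i \<in> verts Q"
  shows "w (simple_root i) \<in> positive_roots \<or> (\<lambda>l. - w (simple_root i) l) \<in> positive_roots"
proof -
  define b where "b = w (simple_root i)"
  have "bilinear b b = 2"
    using assms by (simp add: b_def weyl_bilinear bilinear_simple_root)
  then have q: "(b s)\<^sup>2 + (b t)\<^sup>2 - n_arrows * b s * b t = 1"
    using bilinear_self[of b] by simp
  have supp: "b j = 0" if "j \<notin> {s, t}" for j
    using that assms weyl_support[OF assms(1) that] by (auto simp: b_def simple_root_def verts_Q)
  have "(b s \<ge> 0 \<and> b t \<ge> 0) \<or> (b s \<le> 0 \<and> b t \<le> 0)"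
  proof (rule ccontr)
    assume "\<not> ?thesis"
    then have st: "b s * b t < 0" "b s \<noteq> 0" "b t \<noteq> 0"
      by (auto simp: mult_less_0_iff)
    then have "(b s)\<^sup>2 \<ge> 1" "(b t)\<^sup>2 \<ge> 1"
      using zero_less_power2[of "b s"] zero_less_power2[of "b t"] by linarith+
    moreover have "n_arrows * (b s * b t) \<le> 0"
      using st n_arrows_pos by (simp add: mult_nonneg_nonpos)
    ultimately show False using q by (simp add: mult.assoc)
  qed
  moreover have "(\<forall>j. c * b j \<ge> 0)" if "c * b s \<ge> 0" "c * b t \<ge> 0" for c
    using that supp by (metis insertCI insertE mult_zero_right order_refl singletonD)
  from this[of 1] this[of "-1"]
  have "b s \<ge> 0 \<Longrightarrow> b t \<ge> 0 \<Longrightarrow> (\<forall>j. b j \<ge> 0)" "b s \<le> 0 \<Longrightarrow> b t \<le> 0 \<Longrightarrow> (\<forall>j. b j \<le> 0)"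
    by simp_all
  ultimately show ?thesis
    using q supp unfolding b_def[symmetric] positive_roots_def by auto
qed

text \<open>
  Induction on the sum of the coordinates, by \<open>tits_descent\<close>. The reflected coordinate
  \<open>n b - a = (b\<^sup>2 - 1) / a\<close> does not become negative, and the descent can only end at a vector with a
  coordinate zero, which is a simple root.
\<close>

lemma positive_root_in_orbit:
  "b \<in> positive_roots \<Longrightarrow> \<exists>w \<in> weyl_group Q. \<exists>i \<in> verts Q. b = w (simple_root i)"
proof (induction "nat (b s + b t)" arbitrary: b rule: less_induct)
  case less
  have q: "(b s)\<^sup>2 + (b t)\<^sup>2 - n_arrows * b s * b t = 1" and nn: "b j \<ge> 0"
    and supp: "j \<notin> {s, t} \<Longrightarrow> b j = 0" for j
    using less.prems by (auto simp: positive_roots_def)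
  have step: ?case if ij: "{i, j} = {s, t}" "i \<noteq> j" "b i \<ge> b j" "b j > 0" for i j
  proof -
    define c where "c = simple_reflection Q i b"
    have i: "i \<in> verts Q" using ij by (auto simp: verts_Q)
    have qi: "(b i)\<^sup>2 + (b j)\<^sup>2 - n_arrows * b i * b j = 1"
      using q ij by (auto simp: doubleton_eq_iff algebra_simps)
    have c: "c i = n_arrows * b j - b i" "\<And>l. l \<noteq> i \<Longrightarrow> c l = b l"
      using ij i by (auto simp: c_def simple_reflection_eq reflection_def simple_root_def
          bilinear_def doubleton_eq_iff)
    have "c i * b i = (b j)\<^sup>2 - 1"
      using qi by (simp add: c algebra_simps power2_eq_square)
    moreover have "(b j)\<^sup>2 - 1 \<ge> 0"
      using ij(4) zero_less_power[of "b j" 2] by linarith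
    ultimately have "c i \<ge> 0"
      using ij by (smt (verit) mult_neg_pos)
    moreover have "c i < b i"
      using tits_descent[of "b i" "b j" n_arrows] qi ij c by simp
    moreover have "(c s)\<^sup>2 + (c t)\<^sup>2 - n_arrows * c s * c t = 1"
    proof -
      have "bilinear c c = bilinear b b"
        using i by (simp add: c_def simple_reflection_eq bilinear_reflection bilinear_simple_root)
      then show ?thesis using q by (simp add: bilinear_self)
    qed
    moreover have "c l \<ge> 0" for l
      using \<open>c i \<ge> 0\<close> c(2)[of l] nn[of l] by (cases "l = i") simp_all
    moreover have "c l = 0" if "l \<notin> {s, t}" for l
      using c(2)[of l] supp[of l] ij that by auto
    ultimately have "c \<in> positive_roots"
      by (simp add: positive_roots_def)
    have "c s + c t < b s + b t"
      using ij \<open>c i < b i\<close> c(2)[of j] by (auto simp: doubleton_eq_iff)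
    have "nat (c s + c t) < nat (b s + b t)"
      using \<open>c s + c t < b s + b t\<close> nn[of s] nn[of t] ij by (auto simp: doubleton_eq_iff)
    from less.hyps[OF this \<open>c \<in> positive_roots\<close>]
    obtain w k where w: "w \<in> weyl_group Q" "k \<in> verts Q" "c = w (simple_root k)"
      by (elim bexE)
    have "b = (simple_reflection Q i \<circ> w) (simple_root k)"
      using fun_cong[OF simple_reflection_involution[OF i], of b]
      unfolding comp_apply w(3)[symmetric] unfolding c_def by simp
    then show ?case using weyl_group.step[OF i w(1)] w(2) by (intro bexI)
  qed
  have simple: ?case if ij: "{i, j} = {s, t}" "i \<noteq> j" "b j = 0" for i j
  proof -
    have "(b i)\<^sup>2 = 1" using q ij by (auto simp: doubleton_eq_iff)
    then have "b i = 1" using nn[of i] by (simp add: power2_eq_1_iff)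
    moreover have "b l = 0" if "l \<noteq> i" for l
      using supp[of l] ij that by (cases "l = j") auto
    ultimately have "b = id (simple_root i)"
      by (auto simp: simple_root_def)
    moreover have "i \<in> verts Q" using ij by (auto simp: verts_Q)
    ultimately show ?case using weyl_group.one by (intro bexI)
  qed
  consider "b s = 0" | "b t = 0" | "b s \<ge> b t" "b t > 0" | "b t \<ge> b s" "b s > 0"
    using nn[of s] nn[of t] by linarith
  then show ?case
  proof cases
    case 1 show ?thesis by (rule simple[of t s, OF _ _ 1]) (use s_neq_t in auto)
  next
    case 2 show ?thesis by (rule simple[of s t, OF _ _ 2]) (use s_neq_t in auto)
  next
    case 3 show ?thesis by (rule step[of s t, OF _ _ 3]) (use s_neq_t in auto)
  next
    case 4 show ?thesis by (rule step[of t s, OF _ _ 4]) (use s_neq_t in auto)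
  qed
qed

text \<open>
  Applying both reflections to \<open>b\<close> shows that \<open>b\<close> and \<open>c\<close> are proportional. They have the same norm,
  so they agree up to a sign, which positivity excludes.
\<close>

lemma reflection_inj:
  assumes "b \<in> positive_roots" "c \<in> positive_roots" "reflection b = reflection c"
  shows "b = c"
proof -
  have bb: "bilinear b b = 2" "bilinear c c = 2"
    using assms by (auto simp: positive_roots_def bilinear_self)
  have "reflection b b = reflection c b" by (simp add: assms)
  then have *: "2 * b l = bilinear c b * c l" for l
    using bb(1) fun_cong[OF \<open>reflection b b = reflection c b\<close>, of l]
    unfolding reflection_def by simp
  have "4 * bilinear b b = bilinear (\<lambda>l. 2 * b l) (\<lambda>l. 2 * b l)"
    by (simp add: bilinear_def algebra_simps)
  also have "\<dots> = (bilinear c b)\<^sup>2 * bilinear c c"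
    by (simp only: *) (simp add: bilinear_def algebra_simps power2_eq_square)
  finally have "(bilinear c b)\<^sup>2 = 2\<^sup>2" using bb by simp
  then have "bilinear c b = 2 \<or> bilinear c b = -2"
    by (simp only: power2_eq_iff)
  moreover have "bilinear c b \<noteq> -2"
  proof
    assume "bilinear c b = -2"
    then have "b l = - c l" for l using *[of l] by simp
    moreover have "b l \<ge> 0" "c l \<ge> 0" for l
      using assms by (auto simp: positive_roots_def)
    ultimately have "b l = 0" for l
      by (smt (verit))
    then show False using bb by (simp add: bilinear_def)
  qed
  ultimately show ?thesis using * by (auto simp: fun_eq_iff)
qed

text \<open>
  The description of the root of a reflection is unambiguous: every \<open>w \<alpha>\<^sub>i\<close> that gives the reflection is
  determined by it up to a sign.
\<close>

lemma root_of_reflection_eq: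
  assumes "b \<in> positive_roots"
  shows "root_of_reflection Q (reflection b) = b"
  unfolding root_of_reflection_def
proof (rule the_equality)
  show "(\<forall>j. 0 \<le> b j) \<and> (\<exists>w\<in>weyl_group Q. \<exists>i\<in>verts Q. b = w (simple_root i) \<and>
      reflection b = w \<circ> simple_reflection Q i \<circ> inv_into UNIV w)"
  proof -
    obtain w i where "w \<in> weyl_group Q" "i \<in> verts Q" "b = w (simple_root i)"
      using positive_root_in_orbit[OF assms] by blast
    moreover from this have "reflection b = w \<circ> simple_reflection Q i \<circ> inv_into UNIV w"
      by (simp only: conjugate_eq_reflection)
    ultimately show ?thesis using assms by (auto simp: positive_roots_def)
  qed
next
  fix c assume c: "(\<forall>j. 0 \<le> c j) \<and> (\<exists>w\<in>weyl_group Q. \<exists>i\<in>verts Q. c = w (simple_root i) \<and>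
      reflection b = w \<circ> simple_reflection Q i \<circ> inv_into UNIV w)"
  then have r: "reflection b = reflection c"
    using conjugate_eq_reflection by auto
  have "c \<in> positive_roots \<or> (\<lambda>l. - c l) \<in> positive_roots"
    using c real_root_cases by blast
  then have "c \<in> positive_roots"
  proof
    assume m: "(\<lambda>l. - c l) \<in> positive_roots"
    then have "c s = 0" "c t = 0" using c
      by (auto simp: positive_roots_def intro: order_antisym)
    then show ?thesis using m by (simp add: positive_roots_def)
  qed
  then show "c = b" using reflection_inj assms r by metis
qed

lemma reflection_uminus: "reflection (\<lambda>l. - b l) = reflection b"
  by (simp add: reflection_def bilinear_def fun_eq_iff algebra_simps)

lemma root_of_reflection_positive:
  assumes "r \<in> reflections Q"
  shows "root_of_reflection Q r \<in> positive_roots"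
proof -
  obtain w i where w: "w \<in> weyl_group Q" "i \<in> verts Q"
    and r: "r = w \<circ> simple_reflection Q i \<circ> inv_into UNIV w"
    using assms by (auto simp: reflections_def)
  have r': "r = reflection (w (simple_root i))"
    using r conjugate_eq_reflection[OF w] by simp
  from real_root_cases[OF w] show ?thesis
  proof
    assume "w (simple_root i) \<in> positive_roots"
    then show ?thesis using root_of_reflection_eq r' by simp
  next
    assume "(\<lambda>l. - w (simple_root i) l) \<in> positive_roots"
    then show ?thesis using root_of_reflection_eq[of "\<lambda>l. - w (simple_root i) l"] r'
      by (simp add: reflection_uminus)
  qed
qed

lemma word_product_Cons: "word_product Q (i # ws) = simple_reflection Q i \<circ> word_product Q ws"
  by (simp add: word_product_def)

lemma word_product_append: "word_product Q (us @ ws) = word_product Q us \<circ> word_product Q ws"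
  by (induction us) (simp_all add: word_product_def comp_assoc)

definition alternating_reflections :: "(('v \<Rightarrow> int) \<Rightarrow> 'v \<Rightarrow> int) set" where
  "alternating_reflections = {word_product Q (alternating i j (2 * m + 1)) | i j m. {i, j} = {s, t}}"

text \<open>
  The reflections given by alternating words of odd length are closed under conjugation: a
  conjugating letter either extends the word at both ends or cancels both ends, and the word with
  a single letter is not changed by its own letter.
\<close>

lemma alternating_reflections_conjugate:
  assumes "r \<in> alternating_reflections" "k \<in> verts Q"
  shows "simple_reflection Q k \<circ> r \<circ> simple_reflection Q k \<in> alternating_reflections"
proof -
  obtain i j m where ij: "{i, j} = {s, t}" and r: "r = word_product Q (alternating i j (2 * m + 1))"
    using assms(1) unfolding alternating_reflections_def mem_Collect_eq by (elim exE conjE)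
  have ji: "{j, i} = {s, t}" using ij by (simp only: insert_commute)
  have mem: "word_product Q (alternating a b (2 * l + 1)) \<in> alternating_reflections"
    if "{a, b} = {s, t}" for a b l
    using that unfolding alternating_reflections_def mem_Collect_eq
    by (intro exI[of _ a] exI[of _ b] exI[of _ l] conjI refl)
  have i: "i \<in> verts Q" "j \<in> verts Q" "k = i \<or> k = j"
    using assms(2) unfolding verts_Q ij[symmetric] by auto
  have single: "word_product Q [l] = simple_reflection Q l" for l
    by (simp add: word_product_def)
  have ext: "simple_reflection Q b \<circ> word_product Q (alternating a b (2 * l + 1)) \<circ> simple_reflection Q b
      = word_product Q (alternating b a (2 * Suc l + 1))" for a b l
  proof -
    have "alternating b a (2 * Suc l + 1) = b # alternating a b (2 * l + 2)" by simp
    also have "alternating a b (2 * l + 2) = alternating a b (2 * l + 1) @ [b]"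
      using alternating_snoc[of a b "2 * l + 1"] by simp
    finally show ?thesis
      by (simp add: word_product_Cons word_product_append comp_assoc word_product_def[of Q "[]"]
          del: alternating.simps)
  qed
  show ?thesis
  proof (cases "k = j")
    case True
    then have "simple_reflection Q k \<circ> r \<circ> simple_reflection Q k
        = word_product Q (alternating j i (2 * Suc m + 1))"
      using ext[of j i m] unfolding r by (simp only:)
    then show ?thesis using mem[OF ji] by (simp only:)
  next
    case False
    then have k: "k = i" using i by auto
    show ?thesis
    proof (cases m)
      case 0
      then have "r = simple_reflection Q k" using r k single by simp
      then have "simple_reflection Q k \<circ> r \<circ> simple_reflection Q k = r"
        using simple_reflection_involution[OF assms(2)] by simp
      then show ?thesis using assms(1) by simp
    next
      case (Suc l)
      have "r = simple_reflection Q i \<circ> word_product Q (alternating j i (2 * l + 1)) \<circ> simple_reflection Q i"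
        using ext[of i j l] unfolding r Suc by (simp only:)
      then have "simple_reflection Q k \<circ> r \<circ> simple_reflection Q k = word_product Q (alternating j i (2 * l + 1))"
        using simple_reflection_involution[OF i(1)] k
        by (simp add: comp_assoc) (simp add: comp_assoc[symmetric])
      then show ?thesis using mem[OF ji] by (simp only:)
    qed
  qed
qed

lemma reflection_is_alternating:
  "w \<in> weyl_group Q \<Longrightarrow> i \<in> verts Q \<Longrightarrow>
    reflection (w (simple_root i)) \<in> alternating_reflections"
proof (induction rule: weyl_group.induct)
  case one
  have "simple_reflection Q i = word_product Q (alternating i (if i = s then t else s) (2 * 0 + 1))"
    by (simp add: word_product_def)
  moreover have "{i, if i = s then t else s} = {s, t}" using one by (auto simp: verts_Q)
  ultimately have "simple_reflection Q i \<in> alternating_reflections"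
    unfolding alternating_reflections_def by blast
  then show ?case using one by (simp add: simple_reflection_eq)
next
  case (step k w)
  let ?s = "simple_reflection Q k"
  have inv: "inv_into UNIV (?s \<circ> w) = inv_into UNIV w \<circ> ?s"
  proof -
    have "bij ?s" "inv_into UNIV ?s = ?s"
      using simple_reflection_involution[OF step(1)] o_bij inv_unique_comp by blast+
    then show ?thesis using weyl_bij[OF step(2)] by (simp add: o_inv_distrib)
  qed
  have "reflection ((?s \<circ> w) (simple_root i)) = ?s \<circ> (w \<circ> simple_reflection Q i \<circ> inv_into UNIV w) \<circ> ?s"
    using conjugate_eq_reflection[OF weyl_group.step[OF step(1,2)] step.prems]
    by (simp add: inv comp_assoc)
  then show ?case
    using alternating_reflections_conjugate[OF step.IH[OF step.prems] step(1)]
    by (simp only: conjugate_eq_reflection[OF step(2) step.prems])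
qed

lemma positive_root_of_alternating_word:
  assumes "b \<in> positive_roots"
  obtains i j m where "{i, j} = {s, t}"
    "alternating i j (2 * m + 1) \<in> reflection_words Q"
    "root_of_reflection Q (word_product Q (alternating i j (2 * m + 1))) = b"
proof -
  obtain w k where w: "w \<in> weyl_group Q" "k \<in> verts Q" "b = w (simple_root k)"
    using positive_root_in_orbit[OF assms] by auto
  then have "reflection b \<in> alternating_reflections"
    using reflection_is_alternating by blast
  then obtain i j m where ij: "{i, j} = {s, t}"
    and r: "reflection b = word_product Q (alternating i j (2 * m + 1))"
    by (auto simp: alternating_reflections_def)
  have "set (alternating i j l) \<subseteq> {i, j}" "i \<noteq> j \<Longrightarrow> distinct_adj (alternating i j l)" for i j :: 'v and l
  proof (induction l arbitrary: i j)
    case (Suc l)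
    { case 1 show ?case using Suc(1)[of j i] by auto }
    { case 2 then show ?case using Suc(2)[of j i] by (cases l) auto }
  qed auto
  moreover have "reflection b \<in> reflections Q"
    unfolding reflections_def mem_Collect_eq
    by (intro exI[of _ w] exI[of _ k] conjI w(1,2))
      (simp only: w(3) conjugate_eq_reflection[OF w(1,2)])
  moreover have "i \<noteq> j" using ij s_neq_t by auto
  ultimately have "alternating i j (2 * m + 1) \<in> reflection_words Q"
    unfolding reflection_words_def verts_Q ij[symmetric] r by blast
  then show ?thesis using that[OF ij] root_of_reflection_eq[OF assms] r by simp
qed

end


section \<open>The surface of a bigon is the round sphere\<close>

lemma continuous_map_from_sum_topology:
  assumes "\<And>i. i \<in> I \<Longrightarrow> continuous_map (X i) Y (\<lambda>x. f (i, x))"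
  shows "continuous_map (sum_topology X I) Y f"
  unfolding continuous_map_def
proof (intro conjI allI impI)
  show "f \<in> topspace (sum_topology X I) \<rightarrow> topspace Y"
    using assms by (fastforce simp: continuous_map_def Pi_iff)
next
  fix U assume U: "openin Y U"
  have "{x. (i, x) \<in> {p \<in> topspace (sum_topology X I). f p \<in> U}} = {x \<in> topspace (X i). f (i, x) \<in> U}"
    if "i \<in> I" for i using that by auto
  then show "openin (sum_topology X I) {p \<in> topspace (sum_topology X I). f p \<in> U}"
    using assms U by (auto simp: openin_sum_topology continuous_map_def)
qed

lemma compact_space_sum_topology:
  assumes "finite I" "\<And>i. i \<in> I \<Longrightarrow> compact_space (X i)"
  shows "compact_space (sum_topology X I)"
proof -
  have "compactin (sum_topology X I) (\<Union>i \<in> I. Pair i ` topspace (X i))"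
    using assms by (intro compactin_Union)
      (auto intro: image_compactin continuous_map_component_injection simp: compact_space_def)
  moreover have "(\<Union>i \<in> I. Pair i ` topspace (X i)) = topspace (sum_topology X I)"
    by auto
  ultimately show ?thesis by (simp add: compact_space_def)
qed

abbreviation two_discs :: "(nat \<times> complex) set" where
  "two_discs \<equiv> {1, 2} \<times> cball 0 1"

text \<open>
  The edges of the two discs are glued by \<open>z \<mapsto> - cnj z\<close>. The first disc becomes the upper hemisphere
  by vertical projection, the second one the lower hemisphere after the reflection \<open>z \<mapsto> - cnj z\<close>.
\<close>

definition to_sphere :: "nat \<times> complex \<Rightarrow> complex \<times> real" where
  "to_sphere p = (if fst p = 1 then (snd p, sqrt (1 - (cmod (snd p))\<^sup>2))
     else (- cnj (snd p), - sqrt (1 - (cmod (snd p))\<^sup>2)))"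

definition round_sphere :: "(complex \<times> real) set" where
  "round_sphere = {(z, h). (cmod z)\<^sup>2 + h\<^sup>2 = 1}"

text \<open>
  Glued points have the same image on the sphere (\<open>to_sphere_equivclp\<close>), so the choice of a
  representative does not matter.
\<close>

definition sphere_coord :: "(nat \<times> complex) set \<Rightarrow> complex \<times> real" where
  "sphere_coord c = to_sphere (SOME y. y \<in> c)"

lemma polygon_edge_2: "polygon_edge 2 k u = cis (pi * (real k - 1 + u))"
  by (simp add: polygon_edge_def)

lemma unit_circle_edges:
  assumes "cmod z = 1"
  obtains k u where "k \<in> {1..2}" "u \<in> {0..1}" "z = polygon_edge 2 k u"
    "k = 1 \<longleftrightarrow> Im z \<ge> 0"
proof -
  obtain a where a: "0 \<le> a" "a < 2 * pi" "z = Complex (cos a) (sin a)"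
    using complex_unimodular_polar assms by blast
  then have z: "z = cis a" by (simp add: cis.code)
  show ?thesis
  proof (cases "a \<le> pi")
    case True
    have "Im z \<ge> 0" using a True by (simp add: sin_ge_zero)
    moreover have "z = polygon_edge 2 1 (a / pi)" by (simp add: z polygon_edge_2)
    moreover have "a / pi \<in> {0..1}" using a True by simp
    ultimately show ?thesis using that[of 1 "a / pi"] by simp
  next
    case False
    have "Im z < 0" using a False sin_lt_zero[of a] by simp
    moreover have "z = polygon_edge 2 2 (a / pi - 1)" by (simp add: z polygon_edge_2)
    moreover have "a / pi - 1 \<in> {0..1}" using a False by (simp add: field_simps)
    ultimately show ?thesis using that[of 2 "a / pi - 1"] by simp
  qed
qed

lemma edge_1: "polygon_edge 2 1 ` {0..1} = {z. cmod z = 1 \<and> Im z \<ge> 0}"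
proof (intro subset_antisym subsetI)
  fix z assume "z \<in> polygon_edge 2 1 ` {0..1}"
  then obtain u where "u \<in> {0..1}" "z = cis (pi * u)" by (auto simp: polygon_edge_2)
  then show "z \<in> {z. cmod z = 1 \<and> Im z \<ge> 0}"
    by (auto intro!: sin_ge_zero simp: mult_left_le)
next
  fix z assume "z \<in> {z. cmod z = 1 \<and> Im z \<ge> 0}"
  then have z: "cmod z = 1" "Im z \<ge> 0" by auto
  obtain k u where "u \<in> {0..1}" "z = polygon_edge 2 k u" "k = 1 \<longleftrightarrow> Im z \<ge> 0"
    by (rule unit_circle_edges[OF z(1)])
  then show "z \<in> polygon_edge 2 1 ` {0..1}" using z(2) by simp
qed

lemma edge_2: "polygon_edge 2 2 ` {0..1} = {z. cmod z = 1 \<and> Im z \<le> 0}"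
proof -
  have e: "polygon_edge 2 2 u = cnj (polygon_edge 2 1 (1 - u))" for u
  proof -
    have "cis (pi * (1 + u)) = cis (2 * pi) * cis (- (pi * (1 - u)))"
      by (simp only: cis_mult) (simp add: algebra_simps)
    then show ?thesis by (simp add: polygon_edge_2 cis_cnj)
  qed
  have "polygon_edge 2 2 ` {0..1} = (\<lambda>u. cnj (polygon_edge 2 1 (1 - u))) ` {0..1}"
    by (rule image_cong[OF refl e])
  also have "\<dots> = cnj ` polygon_edge 2 1 ` (\<lambda>u. 1 - u) ` {0..1}"
    by (simp only: image_image)
  also have "(\<lambda>u::real. 1 - u) ` {0..1} = {0..1}"
    by simp
  also have "cnj ` polygon_edge 2 1 ` {0..1} = {z. cmod z = 1 \<and> Im z \<le> 0}"
    unfolding edge_1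
  proof (intro subset_antisym subsetI)
    fix z assume "z \<in> {z. cmod z = 1 \<and> Im z \<le> 0}"
    then show "z \<in> cnj ` {z. cmod z = 1 \<and> Im z \<ge> 0}"
      by (intro image_eqI[of _ _ "cnj z"]) auto
  qed auto
  finally show ?thesis .
qed

lemma glued_2_iff: "glued 2 x y \<longleftrightarrow> (\<exists>z. cmod z = 1 \<and> x = (1, z) \<and> y = (2, - cnj z))"
proof -
  have *: "polygon_edge 2 k (1 - u) = - cnj (polygon_edge 2 k u)" if "k \<in> {1..2}" for k u
  proof -
    have "k = 1 \<or> k = 2" using that by auto
    then consider "k = 1" | "k = 2" by blast
    then show ?thesis
    proof cases
      case 1
      have "cis (pi * (1 - u)) = cis pi * cis (- (pi * u))"
        by (simp only: cis_mult) (simp add: algebra_simps)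
      then show ?thesis using 1 by (simp add: polygon_edge_2 cis_cnj)
    next
      case 2
      have "cis (pi * (1 + (1 - u))) = cis (2 * pi) * cis (- (pi * u))"
        by (simp only: cis_mult) (simp add: algebra_simps)
      moreover have "cis (pi * (1 + u)) = cis pi * cis (pi * u)"
        by (simp only: cis_mult) (simp add: algebra_simps)
      ultimately show ?thesis using 2 by (simp add: polygon_edge_2 cis_cnj)
    qed
  qed
  show ?thesis
  proof
    assume "glued 2 x y"
    then show "\<exists>z. cmod z = 1 \<and> x = (1, z) \<and> y = (2, - cnj z)"
      unfolding glued_def by (auto simp: *) (simp add: polygon_edge_2)
  next
    assume "\<exists>z. cmod z = 1 \<and> x = (1, z) \<and> y = (2, - cnj z)"
    then obtain z where z: "cmod z = 1" "x = (1, z)" "y = (2, - cnj z)" by blast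
    obtain k u where "k \<in> {1..2}" "u \<in> {0..1}" "z = polygon_edge 2 k u"
      by (rule unit_circle_edges[OF z(1)])
    then show "glued 2 x y" unfolding glued_def
      by (intro bexI[of _ k] bexI[of _ u]) (simp_all add: z *)
  qed
qed

lemma to_sphere_glued: "glued 2 x y \<Longrightarrow> to_sphere x = to_sphere y"
  by (auto simp: glued_2_iff to_sphere_def)

lemma to_sphere_equivclp: "equivclp (glued 2) x y \<Longrightarrow> to_sphere x = to_sphere y"
  by (induction rule: equivclp_induct) (auto simp: to_sphere_glued)

lemma equivclp_if_to_sphere_eq:
  assumes "x \<in> two_discs" "y \<in> two_discs" "to_sphere x = to_sphere y"
  shows "equivclp (glued 2) x y"
proof -
  obtain a z b w where xy: "x = (a, z)" "y = (b, w)" "a \<in> {1, 2}" "b \<in> {1, 2}"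
    "cmod z \<le> 1" "cmod w \<le> 1"
    using assms by (cases x; cases y) auto
  have le: "(cmod z)\<^sup>2 \<le> 1" "(cmod w)\<^sup>2 \<le> 1"
    using xy by (simp_all add: power_le_one)
  have one: "cmod v = 1" if "sqrt (1 - (cmod v)\<^sup>2) = - sqrt (1 - (cmod v')\<^sup>2)" "(cmod v)\<^sup>2 \<le> 1" "(cmod v')\<^sup>2 \<le> 1"
    for v v'
  proof -
    have "sqrt (1 - (cmod v)\<^sup>2) = 0"
      using that real_sqrt_ge_zero[of "1 - (cmod v)\<^sup>2"] real_sqrt_ge_zero[of "1 - (cmod v')\<^sup>2"] by linarith
    then have "cmod v = 1 \<or> cmod v = - 1" by (simp add: power2_eq_1_iff)
    then show ?thesis using norm_ge_zero[of v] by linarith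
  qed
  consider "a = b" | "a = 1" "b = 2" | "a = 2" "b = 1" using xy by auto
  then show ?thesis
  proof cases
    case 1
    then have "x = y" using assms xy by (auto simp: to_sphere_def split: if_splits)
    then show ?thesis by simp
  next
    case 2
    then have "z = - cnj w" "sqrt (1 - (cmod z)\<^sup>2) = - sqrt (1 - (cmod w)\<^sup>2)"
      using assms xy by (auto simp: to_sphere_def)
    then have "glued 2 x y" using 2 xy one le by (auto simp: glued_2_iff)
    then show ?thesis by blast
  next
    case 3
    then have "w = - cnj z" "sqrt (1 - (cmod w)\<^sup>2) = - sqrt (1 - (cmod z)\<^sup>2)"
      using assms xy by (auto simp: to_sphere_def)
    then have "glued 2 y x" using 3 xy one le by (auto simp: glued_2_iff)
    then show ?thesis by blast
  qed
qed

lemma sphere_coord_proj: "sphere_coord (surface_proj 2 x) = to_sphere x"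
proof -
  have "x \<in> surface_proj 2 x" by (simp add: surface_proj_def)
  then have "(SOME y. y \<in> surface_proj 2 x) \<in> surface_proj 2 x" by (rule someI)
  then show ?thesis
    using to_sphere_equivclp by (simp add: sphere_coord_def surface_proj_def)
qed

lemma surface_proj_eqI:
  assumes "x \<in> two_discs" "y \<in> two_discs" "to_sphere x = to_sphere y"
  shows "surface_proj 2 x = surface_proj 2 y"
proof -
  have xy: "equivclp (glued 2) x y" by (rule equivclp_if_to_sphere_eq[OF assms])
  have "equivclp (glued 2) x z \<longleftrightarrow> equivclp (glued 2) y z" for z
    using equivclp_trans[OF xy, of z] equivclp_trans[OF equivclp_sym[OF xy], of z] by auto
  then show ?thesis unfolding surface_proj_def by (intro Collect_cong)
qed

lemma quotient_map_surface:
  "quotient_map (sum_topology (\<lambda>_. top_of_set (cball 0 1)) {1, 2}) (surface 2) (surface_proj 2)"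
  using quotient_map_quotient_topology by (simp add: surface_def polygon_def)

lemma topspace_surface: "topspace (surface 2) = surface_proj 2 ` two_discs"
proof -
  have "topspace (sum_topology (\<lambda>_. top_of_set (cball (0::complex) 1)) {1, 2::nat}) = two_discs"
    by auto
  then show ?thesis
    using quotient_imp_surjective_map[OF quotient_map_surface] by (simp only:)
qed

lemma to_sphere_image: "to_sphere ` two_discs = round_sphere"
proof (intro subset_antisym subsetI)
  fix p assume "p \<in> to_sphere ` two_discs"
  then show "p \<in> round_sphere"
    by (auto simp: to_sphere_def round_sphere_def power_le_one)
next
  fix p assume "p \<in> round_sphere"
  then obtain z h where p: "p = (z, h)" "(cmod z)\<^sup>2 + h\<^sup>2 = 1" by (auto simp: round_sphere_def)
  have "(cmod z)\<^sup>2 \<le> 1" using p zero_le_power2[of h] by linarith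
  then have z: "cmod z \<le> 1" using abs_square_le_1[of "cmod z"] by simp
  have "1 - (cmod z)\<^sup>2 = h\<^sup>2" using p by linarith
  then have h: "sqrt (1 - (cmod z)\<^sup>2) = \<bar>h\<bar>" by simp
  show "p \<in> to_sphere ` two_discs"
  proof (cases "h \<ge> 0")
    case True
    then show ?thesis using z p by (intro image_eqI[of _ _ "(1, z)"]) (auto simp: to_sphere_def h)
  next
    case False
    then show ?thesis using z p
      by (intro image_eqI[of _ _ "(2, - cnj z)"]) (auto simp: to_sphere_def h)
  qed
qed

text \<open>
  A continuous bijection from a compact space to a Hausdorff space.
\<close>

lemma homeomorphic_map_sphere_coord:
  "homeomorphic_map (surface 2) (top_of_set round_sphere) sphere_coord"
proof (rule continuous_imp_homeomorphic_map)
  let ?X = "sum_topology (\<lambda>_. top_of_set (cball (0::complex) 1)) {1, 2::nat}"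
  have "continuous_map ?X euclidean to_sphere"
    by (rule continuous_map_from_sum_topology)
      (auto simp: to_sphere_def intro!: continuous_intros)
  then have "continuous_map ?X (top_of_set round_sphere) to_sphere"
    using to_sphere_image by (auto simp: continuous_map_in_subtopology)
  moreover have "sphere_coord \<circ> surface_proj 2 = to_sphere"
    by (simp add: fun_eq_iff sphere_coord_proj)
  ultimately show "continuous_map (surface 2) (top_of_set round_sphere) sphere_coord"
    by (intro continuous_compose_quotient_map[OF quotient_map_surface]) (simp only:)
  have "compact_space ?X"
    by (rule compact_space_sum_topology) (auto simp: compact_space_subtopology)
  then show "compact_space (surface 2)"
    unfolding compact_space_def
    by (metis image_compactin quotient_imp_continuous_map[OF quotient_map_surface]
        quotient_imp_surjective_map[OF quotient_map_surface])
  show "Hausdorff_space (top_of_set round_sphere)"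
    by (simp add: Hausdorff_space_subtopology)
  show "sphere_coord ` topspace (surface 2) = topspace (top_of_set round_sphere)"
    by (simp add: topspace_surface image_image sphere_coord_proj to_sphere_image del: One_nat_def)
  show "inj_on sphere_coord (topspace (surface 2))"
    unfolding topspace_surface
  proof (rule inj_onI, elim imageE)
    fix p q x y
    assume xy: "x \<in> two_discs" "y \<in> two_discs"
      and pq: "p = surface_proj 2 x" "q = surface_proj 2 y" "sphere_coord p = sphere_coord q"
    from pq have "to_sphere x = to_sphere y" by (simp add: sphere_coord_proj)
    then show "p = q" unfolding pq(1,2) by (rule surface_proj_eqI[OF xy])
  qed
qed

lemma mem_surface_proj_image:
  assumes "p \<in> topspace (surface 2)" "A \<subseteq> two_discs"
  shows "p \<in> surface_proj 2 ` A \<longleftrightarrow> sphere_coord p \<in> to_sphere ` A"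
proof
  assume "sphere_coord p \<in> to_sphere ` A"
  then obtain y where y: "y \<in> A" "sphere_coord p = to_sphere y" by blast
  obtain x where x: "p = surface_proj 2 x" "x \<in> two_discs"
    using assms(1) unfolding topspace_surface by blast
  have "p = surface_proj 2 y"
    using surface_proj_eqI[OF x(2), of y] x(1) y assms(2) by (auto simp: sphere_coord_proj)
  then show "p \<in> surface_proj 2 ` A" using y(1) by blast
qed (auto simp: sphere_coord_proj)

lemma cmod_neq_minus_1: "cmod z \<noteq> - 1"
  using norm_ge_zero[of z] by linarith

lemma mem_arc_T:
  assumes "p \<in> topspace (surface 2)"
  shows "p \<in> arc_T 2 \<sigma> i \<longleftrightarrow> snd (sphere_coord p) = 0 \<and>
    (\<sigma> 1 = i \<and> Im (fst (sphere_coord p)) \<ge> 0 \<or> \<sigma> 2 = i \<and> Im (fst (sphere_coord p)) \<le> 0)"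
proof -
  have S: "sphere_coord p \<in> round_sphere"
    using assms to_sphere_image by (auto simp: topspace_surface sphere_coord_proj)
  have circle: "p \<in> surface_proj 2 ` Pair 1 ` {z. cmod z = 1 \<and> P z} \<longleftrightarrow>
      snd (sphere_coord p) = 0 \<and> P (fst (sphere_coord p))" for P
  proof -
    have "p \<in> surface_proj 2 ` Pair 1 ` {z. cmod z = 1 \<and> P z} \<longleftrightarrow>
        sphere_coord p \<in> to_sphere ` Pair 1 ` {z. cmod z = 1 \<and> P z}"
      by (rule mem_surface_proj_image[OF assms]) auto
    also have "to_sphere ` Pair 1 ` {z. cmod z = 1 \<and> P z} = (\<lambda>z. (z, 0)) ` {z. cmod z = 1 \<and> P z}"
      unfolding image_image by (rule image_cong) (auto simp: to_sphere_def)
    finally show ?thesis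
      using S by (cases "sphere_coord p") (auto simp: round_sphere_def power2_eq_1_iff cmod_neq_minus_1)
  qed
  have "p \<in> arc_T 2 \<sigma> i \<longleftrightarrow>
      (\<exists>k \<in> {1..2}. \<sigma> k = i \<and> p \<in> surface_proj 2 ` Pair 1 ` polygon_edge 2 k ` {0..1})"
  proof
    assume "p \<in> arc_T 2 \<sigma> i"
    then obtain k u where "p = surface_proj 2 (1, polygon_edge 2 k u)" "k \<in> {1..2}" "\<sigma> k = i" "u \<in> {0..1}"
      unfolding arc_T_def mem_Collect_eq by (elim exE conjE)
    then show "\<exists>k \<in> {1..2}. \<sigma> k = i \<and> p \<in> surface_proj 2 ` Pair 1 ` polygon_edge 2 k ` {0..1}"
      by (intro bexI[of _ k] conjI) (simp_all only: image_eqI)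
  next
    assume "\<exists>k \<in> {1..2}. \<sigma> k = i \<and> p \<in> surface_proj 2 ` Pair 1 ` polygon_edge 2 k ` {0..1}"
    then obtain k u where "k \<in> {1..2}" "\<sigma> k = i" "u \<in> {0..1}" "p = surface_proj 2 (1, polygon_edge 2 k u)"
      by (elim bexE conjE imageE) (simp only:)
    then show "p \<in> arc_T 2 \<sigma> i"
      unfolding arc_T_def mem_Collect_eq by (intro exI conjI)
  qed
  also have "{1..2} = {1, 2::nat}" by auto
  finally have "p \<in> arc_T 2 \<sigma> i \<longleftrightarrow>
      \<sigma> 1 = i \<and> p \<in> surface_proj 2 ` Pair 1 ` polygon_edge 2 1 ` {0..1} \<or>
      \<sigma> 2 = i \<and> p \<in> surface_proj 2 ` Pair 1 ` polygon_edge 2 2 ` {0..1}"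
    by (simp only: bex_simps) simp
  then show ?thesis
    by (simp only: edge_1 edge_2 circle) auto
qed

lemma mem_marked_points:
  assumes "p \<in> topspace (surface 2)"
  shows "p \<in> marked_points 2 \<longleftrightarrow> sphere_coord p = (1, 0) \<or> sphere_coord p = (-1, 0)"
proof -
  have "polygon_vertices 2 = {1, -1}"
  proof -
    have "{1..2} = {1, 2::nat}" by auto
    then have "polygon_vertices 2 = (\<lambda>k. cis (2 * pi * real k / real 2)) ` {1, 2}"
      unfolding polygon_vertices_def Setcompr_eq_image by (simp only:)
    then show ?thesis using cis_2pi by (simp add: insert_commute mult.commute)
  qed
  then have "p \<in> marked_points 2 \<longleftrightarrow> sphere_coord p \<in> to_sphere ` ({1, 2} \<times> {1, -1})"
    unfolding marked_points_def using mem_surface_proj_image[OF assms, of "{1, 2} \<times> {1, -1}"]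
    by simp
  then show ?thesis by (auto simp: to_sphere_def)
qed


section \<open>Spirals on the sphere\<close>

text \<open>
  Near a point \<open>(z, h)\<close> of the equator with \<open>Im z \<noteq> 0\<close> the sphere has the coordinates \<open>Re z\<close> and
  \<open>\<psi> = - arctan (h / Im z)\<close>, the angle about the axis through the two marked points, measured from the
  equator. A curve with \<open>Re z = a - 2 (x - x0)\<close> and \<open>\<psi> = c (x - x0)\<close> at the time \<open>x\<close> becomes vertical
  with unit speed after the shear below, as the definition of transversality wants it.
\<close>

definition spiral_chart :: "real \<Rightarrow> real \<Rightarrow> complex \<times> real \<Rightarrow> complex" where
  "spiral_chart a c p = (let \<psi> = - arctan (snd p / Im (fst p)) in
     Complex (Re (fst p) - a + 2 * \<psi> / c) (\<psi> / c))"

definition spiral_chart_inv :: "real \<Rightarrow> real \<Rightarrow> real \<Rightarrow> complex \<Rightarrow> complex \<times> real" where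
  "spiral_chart_inv a c e w = (let \<psi> = c * Im w; x = Re w + a - 2 * Im w; r = sqrt (1 - x\<^sup>2) in
     (Complex x (e * r * cos \<psi>), - (e * r * sin \<psi>)))"

definition half_sphere :: "real \<Rightarrow> (complex \<times> real) set" where
  "half_sphere e = {p \<in> round_sphere. e * Im (fst p) > 0}"

lemma homeomorphic_maps_spiral_chart:
  fixes a c e :: real
  assumes c: "c \<noteq> 0" and e: "e = 1 \<or> e = - 1"
  defines "V \<equiv> {w. \<bar>c * Im w\<bar> < pi / 2 \<and> \<bar>Re w + a - 2 * Im w\<bar> < 1}"
  shows "homeomorphic_maps (top_of_set (half_sphere e)) (top_of_set V)
    (spiral_chart a c) (spiral_chart_inv a c e)"
proof -
  have S: "Re z ^ 2 + Im z ^ 2 + h ^ 2 = 1" "e * Im z > 0" "Im z \<noteq> 0" "(Re z)\<^sup>2 < 1"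
    if "(z, h) \<in> half_sphere e" for z h
  proof -
    show 1: "Re z ^ 2 + Im z ^ 2 + h ^ 2 = 1" "e * Im z > 0"
      using that by (auto simp: half_sphere_def round_sphere_def cmod_power2)
    then show 2: "Im z \<noteq> 0" by auto
    then have "(Im z)\<^sup>2 > 0" by simp
    then show "(Re z)\<^sup>2 < 1" using 1(1) zero_le_power2[of h] by linarith
  qed
  have chart: "spiral_chart a c p \<in> V" "spiral_chart_inv a c e (spiral_chart a c p) = p"
    if p: "p \<in> half_sphere e" for p
  proof -
    obtain z h where zh: "p = (z, h)" by (cases p)
    note S = S[OF p[unfolded zh]]
    define r where "r = sqrt (1 - (Re z)\<^sup>2)"
    have r: "r > 0" using S by (simp add: r_def)
    have "1 - (Re z)\<^sup>2 = (Im z)\<^sup>2 * (1 + (h / Im z)\<^sup>2)"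
      using S(1,3) by (simp add: power_divide distrib_left)
    then have r_eq: "r = e * Im z * sqrt (1 + (h / Im z)\<^sup>2)"
      using e S(2) by (auto simp: r_def real_sqrt_mult)
    have q: "sqrt (1 + (h / Im z)\<^sup>2) > 0" by (simp add: add_pos_nonneg)
    have ee: "e * e = 1" using e by auto
    have "e * r * cos (arctan (h / Im z)) = Im z"
      using q ee by (simp add: r_eq cos_arctan field_simps)
    moreover have "e * r * sin (arctan (h / Im z)) = h"
      using q ee S(3) by (simp add: r_eq sin_arctan field_simps)
    ultimately show "spiral_chart_inv a c e (spiral_chart a c p) = p"
      using c by (simp add: zh spiral_chart_def spiral_chart_inv_def Let_def r_def complex_eq_iff)
    have "\<bar>arctan (h / Im z)\<bar> < pi / 2"
      using arctan_bounded[of "h / Im z"] unfolding abs_less_iff by linarith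
    moreover have "\<bar>Re z\<bar> < 1" using S(4) by (simp add: abs_square_less_1)
    ultimately show "spiral_chart a c p \<in> V"
      using c by (simp add: zh spiral_chart_def V_def Let_def)
  qed
  have inv: "spiral_chart_inv a c e w \<in> half_sphere e" "spiral_chart a c (spiral_chart_inv a c e w) = w"
    if w: "w \<in> V" for w
  proof -
    define \<psi> x r where "\<psi> = c * Im w" and "x = Re w + a - 2 * Im w" and "r = sqrt (1 - x\<^sup>2)"
    have b: "\<bar>\<psi>\<bar> < pi / 2" "\<bar>x\<bar> < 1" using w by (auto simp: V_def \<psi>_def x_def)
    have inv_eq: "spiral_chart_inv a c e w = (Complex x (e * r * cos \<psi>), - (e * r * sin \<psi>))"
      by (simp add: spiral_chart_inv_def \<psi>_def x_def r_def Let_def)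
    have "x\<^sup>2 < 1" using b(2) by (simp add: abs_square_less_1)
    then have r: "r > 0" "r\<^sup>2 = 1 - x\<^sup>2" by (simp_all add: r_def)
    have cos: "cos \<psi> > 0" using b(1) by (intro cos_gt_zero_pi) (auto simp: abs_less_iff)
    have ee: "e * e = 1" "e\<^sup>2 = 1" using e by auto
    have "x\<^sup>2 + (e * r * cos \<psi>)\<^sup>2 + (e * r * sin \<psi>)\<^sup>2 = x\<^sup>2 + r\<^sup>2 * ((cos \<psi>)\<^sup>2 + (sin \<psi>)\<^sup>2)"
      by (simp only: power_mult_distrib ee mult_1 distrib_left add.assoc)
    also have "\<dots> = 1" using r by simp
    finally have "spiral_chart_inv a c e w \<in> round_sphere"
      by (simp add: inv_eq round_sphere_def cmod_power2)
    moreover have "e * (e * r * cos \<psi>) > 0"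
      using ee r cos by (simp add: mult.assoc[symmetric])
    ultimately show "spiral_chart_inv a c e w \<in> half_sphere e"
      by (simp add: half_sphere_def inv_eq)
    have "- (e * r * sin \<psi>) / (e * r * cos \<psi>) = - tan \<psi>"
      using e r by (auto simp: tan_def)
    moreover have "arctan (- tan \<psi>) = - \<psi>"
      using b(1) arctan_tan[of \<psi>] by (simp add: arctan_minus abs_less_iff)
    ultimately have "spiral_chart a c (spiral_chart_inv a c e w) = Complex (x - a + 2 * \<psi> / c) (\<psi> / c)"
      by (simp add: spiral_chart_def inv_eq Let_def)
    then show "spiral_chart a c (spiral_chart_inv a c e w) = w"
      using c by (simp add: \<psi>_def x_def complex_eq_iff)
  qed
  have "continuous_on (half_sphere e) (spiral_chart a c)"
  proof -
    have "Im (fst p) \<noteq> 0" if "p \<in> half_sphere e" for p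
      using that S(3)[of "fst p" "snd p"] by simp
    then show ?thesis
      unfolding spiral_chart_def Let_def Complex_eq
      using c by (intro continuous_intros) auto
  qed
  moreover have "continuous_on V (spiral_chart_inv a c e)"
    unfolding spiral_chart_inv_def Let_def Complex_eq by (intro continuous_intros)
  ultimately show ?thesis
    using chart inv by (auto simp: homeomorphic_maps_def continuous_map_in_subtopology image_subset_iff)
qed

text \<open>
  The angle is constant during the first and the last quarter of the time, where the curve runs along
  the segments \<open>L\<^sub>1\<close> and \<open>L\<^sub>2\<close>, and linear in between, where the crossings are and the chart needs it.
  The curve makes \<open>m + 1 / 2\<close> turns, and \<open>d = 1\<close> or \<open>d = - 1\<close> is the sense of rotation.
\<close>

definition spiral_angle :: "real \<Rightarrow> nat \<Rightarrow> real \<Rightarrow> real" where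
  "spiral_angle d m x = d * (real (2 * m + 1) * pi * max 0 (min 1 (2 * x - 1 / 2)))"

text \<open>
  The first coordinate decreases linearly from \<open>1\<close> to \<open>- 1\<close>. This alone makes the curve simple.
\<close>

definition spiral :: "real \<Rightarrow> nat \<Rightarrow> real \<Rightarrow> complex \<times> real" where
  "spiral d m x = (let r = sqrt (1 - (1 - 2 * x)\<^sup>2) in
     (Complex (1 - 2 * x) (r * sin (spiral_angle d m x)), r * cos (spiral_angle d m x)))"

definition crossing_time :: "nat \<Rightarrow> nat \<Rightarrow> real" where
  "crossing_time m k = 1 / 4 + real (2 * k + 1) / real (4 * (2 * m + 1))"

lemma spiral_radius:
  assumes "x \<in> {0..1}"
  shows "(1 - 2 * x)\<^sup>2 \<le> 1" "x \<in> {0<..<1} \<Longrightarrow> sqrt (1 - (1 - 2 * x)\<^sup>2) > 0"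
proof -
  have *: "1 - (1 - 2 * x)\<^sup>2 = 4 * (x * (1 - x))" by (simp add: power2_eq_square algebra_simps)
  have "x * (1 - x) \<ge> 0" using assms by simp
  then show "(1 - 2 * x)\<^sup>2 \<le> 1" using * by linarith
  assume "x \<in> {0<..<1}"
  then have "x * (1 - x) > 0" by simp
  then show "sqrt (1 - (1 - 2 * x)\<^sup>2) > 0" using * by simp
qed

lemma spiral_in_sphere: "x \<in> {0..1} \<Longrightarrow> spiral d m x \<in> round_sphere"
proof -
  assume x: "x \<in> {0..1}"
  define r where "r = sqrt (1 - (1 - 2 * x)\<^sup>2)"
  have r: "r\<^sup>2 = 1 - (1 - 2 * x)\<^sup>2"
    using spiral_radius(1)[OF x] by (simp add: r_def)
  have "(r * sin (spiral_angle d m x))\<^sup>2 + (r * cos (spiral_angle d m x))\<^sup>2 =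
      r\<^sup>2 * ((sin (spiral_angle d m x))\<^sup>2 + (cos (spiral_angle d m x))\<^sup>2)"
    by (simp only: power_mult_distrib distrib_left)
  then show ?thesis
    using r unfolding sin_cos_squared_add
    by (simp add: spiral_def Let_def r_def[symmetric] round_sphere_def cmod_power2 del: sin_cos_squared_add)
qed

lemma continuous_spiral: "continuous_on A (spiral d m)"
  unfolding spiral_def spiral_angle_def Let_def Complex_eq by (intro continuous_intros)

lemma crossing_time_bounds:
  assumes "k \<le> 2 * m"
  shows "1 / 4 < crossing_time m k" "crossing_time m k < 3 / 4"
proof -
  have "0 < real (2 * k + 1) / real (4 * (2 * m + 1))" by (intro divide_pos_pos) auto
  moreover have "real (2 * k + 1) / real (4 * (2 * m + 1)) < 1 / 2"
    using assms by (simp add: field_simps)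
  ultimately show "1 / 4 < crossing_time m k" "crossing_time m k < 3 / 4"
    unfolding crossing_time_def by linarith+
qed

lemma spiral_angle_near_crossing:
  assumes "1 / 4 \<le> x" "x \<le> 3 / 4"
  shows "spiral_angle d m x = d * (real k * pi + pi / 2 + 2 * real (2 * m + 1) * pi * (x - crossing_time m k))"
proof -
  have m: "max 0 (min 1 (2 * x - 1 / 2)) = 2 * x - 1 / 2" using assms by auto
  have "real (2 * m + 1) * (2 * crossing_time m k - 1 / 2) = real k + 1 / 2"
    by (simp add: crossing_time_def field_simps)
  then have "real (2 * m + 1) * (2 * x - 1 / 2) = real k + 1 / 2 + 2 * real (2 * m + 1) * (x - crossing_time m k)"
    by (simp add: algebra_simps)
  then have "pi * (real (2 * m + 1) * (2 * x - 1 / 2)) =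
      pi * (real k + 1 / 2 + 2 * real (2 * m + 1) * (x - crossing_time m k))" by simp
  then show ?thesis unfolding spiral_angle_def m by (simp add: algebra_simps)
qed

lemma spiral_crossings:
  assumes x: "x \<in> {0..1}" and d: "d = 1 \<or> d = - 1"
  shows "cos (spiral_angle d m x) = 0 \<longleftrightarrow> (\<exists>k \<le> 2 * m. x = crossing_time m k)"
proof
  define u where "u = max 0 (min 1 (2 * x - 1 / 2))"
  assume "cos (spiral_angle d m x) = 0"
  then have "cos (real (2 * m + 1) * pi * u) = 0"
    using d by (auto simp: spiral_angle_def u_def)
  then obtain i :: int where "real (2 * m + 1) * pi * u = of_int i * pi + pi / 2"
    unfolding cos_zero_iff_int2 by blast
  then have "pi * (real (2 * m + 1) * u) = pi * (of_int i + 1 / 2)" by (simp add: algebra_simps)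
  then have i: "real (2 * m + 1) * u = of_int i + 1 / 2" by simp
  have u: "0 \<le> u" "u \<le> 1" by (auto simp: u_def)
  have "0 \<le> real (2 * m + 1) * u" using u by simp
  moreover have "real (2 * m + 1) * u \<le> real (2 * m + 1)" using u by (simp add: mult_left_le)
  ultimately have "- 1 < i" "i < 2 * int m + 1" unfolding i by linarith+
  then have k: "i = int (nat i)" "nat i \<le> 2 * m" by linarith+
  define k where "k = nat i"
  note k = k[folded k_def]
  have uk: "u = (real k + 1 / 2) / real (2 * m + 1)"
    using i k by (simp add: field_simps)
  have "(real k + 1 / 2) / real (2 * m + 1) < 1" "0 < (real k + 1 / 2) / real (2 * m + 1)"
    using k by (simp_all add: field_simps)
  then have "u = 2 * x - 1 / 2" unfolding uk[symmetric] u_def by (auto simp: max_def min_def split: if_splits)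
  then have "x = crossing_time m k" using uk by (simp add: crossing_time_def field_simps)
  then show "\<exists>k \<le> 2 * m. x = crossing_time m k" using k by blast
next
  assume "\<exists>k \<le> 2 * m. x = crossing_time m k"
  then obtain k where k: "k \<le> 2 * m" "x = crossing_time m k" by blast
  then have "spiral_angle d m x = d * (real k * pi + pi / 2)"
    using spiral_angle_near_crossing[of x d m k] crossing_time_bounds[of k m] by simp
  moreover have "cos (d * y) = cos y" for y using d by auto
  ultimately show "cos (spiral_angle d m x) = 0"
    by (simp add: cos_add)
qed

lemma sin_at_crossing:
  assumes "k \<le> 2 * m" and d: "d = 1 \<or> d = - 1"
  shows "sin (spiral_angle d m (crossing_time m k)) = d * (- 1) ^ k"
proof -
  have "spiral_angle d m (crossing_time m k) = d * (real k * pi + pi / 2)"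
    using spiral_angle_near_crossing[of "crossing_time m k" d m k] crossing_time_bounds[OF assms(1)] by simp
  moreover have "sin (d * y) = d * sin y" for y using d by auto
  ultimately show ?thesis by (simp add: sin_add cos_npi)
qed

section \<open>Every odd alternating word is the word of a simple curve\<close>

lemma length_alternating [simp]: "length (alternating i j k) = k"
  by (induction k arbitrary: i j) auto

lemma nth_alternating: "k < l \<Longrightarrow> alternating i j l ! k = (if even k then i else j)"
proof (induction l arbitrary: i j k)
  case (Suc l)
  then show ?case by (cases k) auto
qed simp

locale spiral_on_surface =
  fixes d :: real and m :: nat and \<sigma> :: "nat \<Rightarrow> nat" and \<eta> :: "real \<Rightarrow> (nat \<times> complex) set"
  assumes d: "d = 1 \<or> d = - 1"
    and \<sigma>: "{\<sigma> 1, \<sigma> 2} = {1, 2}"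
    and pathin_\<eta>: "pathin (surface 2) \<eta>"
    and coord_\<eta>: "x \<in> {0..1} \<Longrightarrow> sphere_coord (\<eta> x) = spiral d m x"
begin

lemma \<eta>_in_surface: "x \<in> {0..1} \<Longrightarrow> \<eta> x \<in> topspace (surface 2)"
  using path_image_subset_topspace[OF pathin_\<eta>] by auto

lemma marked_iff: "x \<in> {0..1} \<Longrightarrow> \<eta> x \<in> marked_points 2 \<longleftrightarrow> x \<in> {0, 1}"
  by (auto simp: mem_marked_points[OF \<eta>_in_surface] coord_\<eta> spiral_def Let_def complex_eq_iff)

lemma mem_arcs_T:
  assumes "p \<in> topspace (surface 2)"
  shows "p \<in> arcs_T 2 \<sigma> \<longleftrightarrow> snd (sphere_coord p) = 0"
proof -
  have *: "{1..2} = {\<sigma> 1, \<sigma> 2}" unfolding \<sigma> by auto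
  show ?thesis
    unfolding arcs_T_def * using mem_arc_T[OF assms] by auto
qed

lemma on_arcs_iff:
  assumes "x \<in> {0<..<1}"
  shows "\<eta> x \<in> arcs_T 2 \<sigma> \<longleftrightarrow> (\<exists>k \<le> 2 * m. x = crossing_time m k)"
proof -
  have x: "x \<in> {0..1}" using assms by auto
  have "\<eta> x \<in> arcs_T 2 \<sigma> \<longleftrightarrow> cos (spiral_angle d m x) = 0"
    using spiral_radius(2)[OF x assms]
    by (simp add: mem_arcs_T[OF \<eta>_in_surface[OF x]] coord_\<eta>[OF x] spiral_def Let_def)
  then show ?thesis using spiral_crossings[OF x d] by simp
qed

lemma crossing_times_eq: "crossing_times 2 \<sigma> \<eta> = crossing_time m ` {..2 * m}"
proof -
  have "crossing_time m k \<in> {0<..<1}" if "k \<le> 2 * m" for k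
    using crossing_time_bounds[OF that] by auto
  then show ?thesis
    using on_arcs_iff by (auto simp: crossing_times_def image_iff)
qed

lemma simple_curve_\<eta>: "simple_curve \<eta>"
  unfolding simple_curve_def
proof (intro ballI impI disjI1)
  fix x y :: real assume xy: "x \<in> {0..1}" "y \<in> {0..1}" "\<eta> x = \<eta> y"
  then have "spiral d m x = spiral d m y" using coord_\<eta> by metis
  then show "x = y" by (simp add: spiral_def Let_def)
qed

lemma starts_in_L1: "\<eta> ` {0..1 / 4} \<subseteq> segment_L 2 1"
proof clarify
  fix x :: real assume x: "x \<in> {0..1 / 4}"
  define u where "u = 1 - 2 * x"
  have "spiral d m x = to_sphere (1, of_real u)"
    using x by (simp add: spiral_def spiral_angle_def to_sphere_def complex_eq_iff u_def[symmetric])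
  moreover have "complex_of_real u \<in> closed_segment 0 1"
    using x by (auto simp: in_segment u_def scaleR_conv_of_real intro!: exI[of _ "1 - 2 * x"])
  moreover have "closed_segment 0 (1::complex) \<subseteq> cball 0 1"
    by (simp add: closed_segment_subset)
  ultimately show "\<eta> x \<in> segment_L 2 1"
    unfolding segment_L_def using x
    by (subst mem_surface_proj_image) (auto simp: coord_\<eta> intro!: \<eta>_in_surface)
qed

lemma ends_in_L2: "\<eta> ` {1 - 1 / 4..1} \<subseteq> segment_L 2 2"
proof clarify
  fix x :: real assume x: "x \<in> {1 - 1 / 4..1}"
  have "sin (real (2 * m + 1) * pi) = 0" "cos (real (2 * m + 1) * pi) = - 1"
    using sin_npi[of "2 * m + 1"] cos_npi[of "2 * m + 1"] by (simp_all del: of_nat_add of_nat_mult)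
  moreover have "max 0 (min 1 (2 * x - 1 / 2)) = 1" using x by auto
  ultimately have "sin (spiral_angle d m x) = 0" "cos (spiral_angle d m x) = - 1"
    using d by (auto simp: spiral_angle_def simp del: of_nat_add of_nat_mult)
  moreover define u where "u = 2 * x - 1"
  moreover have "1 - 2 * x = - u" by (simp add: u_def)
  ultimately have "spiral d m x = to_sphere (2, of_real u)"
    by (simp add: spiral_def to_sphere_def complex_eq_iff Let_def)
  moreover have "complex_of_real u \<in> closed_segment 0 1"
    using x by (auto simp: in_segment u_def scaleR_conv_of_real intro!: exI[of _ "2 * x - 1"])
  moreover have "closed_segment 0 (1::complex) \<subseteq> cball 0 1"
    by (simp add: closed_segment_subset)
  ultimately show "\<eta> x \<in> segment_L 2 2"
    unfolding segment_L_def using x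
    by (subst mem_surface_proj_image) (auto simp: coord_\<eta> intro!: \<eta>_in_surface)
qed

text \<open>
  The angle grows by \<open>\<pi>\<close> from one crossing to the next one, so the curve meets the two halves of the
  equator in turn.
\<close>

lemma crossing_word_\<eta>:
  "crossing_word 2 \<sigma> \<eta> =
    (if d = 1 then alternating (\<sigma> 1) (\<sigma> 2) (2 * m + 1) else alternating (\<sigma> 2) (\<sigma> 1) (2 * m + 1))"
proof -
  have mono: "crossing_time m k < crossing_time m l" if "k < l" for k l
    using that by (simp add: crossing_time_def divide_strict_right_mono)
  have times: "sorted_list_of_set (crossing_times 2 \<sigma> \<eta>) = map (crossing_time m) [0..<2 * m + 1]"
  proof -
    have "sorted_wrt (<) (map (crossing_time m) [0..<2 * m + 1])"
      unfolding sorted_wrt_map by (rule sorted_wrt_mono_rel[OF _ sorted_wrt_upt]) (rule mono)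
    then have "sorted (map (crossing_time m) [0..<2 * m + 1])"
      "distinct (map (crossing_time m) [0..<2 * m + 1])"
      by (simp_all only: strict_sorted_iff)
    moreover have "set (map (crossing_time m) [0..<2 * m + 1]) = crossing_times 2 \<sigma> \<eta>"
      by (simp add: crossing_times_eq atLeast0LessThan lessThan_Suc_atMost del: upt_Suc)
    ultimately show ?thesis
      by (intro sorted_distinct_set_unique) (simp_all add: crossing_times_eq del: upt_Suc)
  qed
  have letter: "(THE i. i \<in> {1..2} \<and> \<eta> (crossing_time m k) \<in> arc_T 2 \<sigma> i) =
      (if d * (- 1) ^ k = 1 then \<sigma> 1 else \<sigma> 2)" if k: "k \<le> 2 * m" for k
  proof -
    let ?x = "crossing_time m k"
    have x: "?x \<in> {0..1}" "?x \<in> {0<..<1}" using crossing_time_bounds[OF k] by auto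
    define r where "r = sqrt (1 - (1 - 2 * ?x)\<^sup>2)"
    have "cos (spiral_angle d m ?x) = 0" using spiral_crossings[OF x(1) d] k by blast
    then have c: "sphere_coord (\<eta> ?x) = (Complex (1 - 2 * ?x) (r * (d * (- 1) ^ k)), 0)"
      using sin_at_crossing[OF k d] by (simp add: coord_\<eta>[OF x(1)] spiral_def Let_def r_def)
    have r: "r > 0" using spiral_radius(2)[OF x] by (simp add: r_def)
    have s: "d * (- 1) ^ k = 1 \<or> d * (- 1) ^ k = - 1" using d by (cases "even k") auto
    have "card {\<sigma> 1, \<sigma> 2} = 2" unfolding \<sigma> by simp
    then have "\<sigma> 1 \<noteq> \<sigma> 2" by auto
    moreover have "\<eta> ?x \<in> arc_T 2 \<sigma> i \<longleftrightarrow> i = (if d * (- 1) ^ k = 1 then \<sigma> 1 else \<sigma> 2)" for i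
      using mem_arc_T[OF \<eta>_in_surface[OF x(1)], of \<sigma> i] c r s by auto
    moreover have "\<sigma> 1 \<in> {1..2}" "\<sigma> 2 \<in> {1..2}"
    proof -
      have "\<sigma> 1 \<in> {1, 2}" "\<sigma> 2 \<in> {1, 2}" unfolding \<sigma>[symmetric] by simp_all
      then show "\<sigma> 1 \<in> {1..2}" "\<sigma> 2 \<in> {1..2}" by auto
    qed
    ultimately show ?thesis by (intro the_equality) auto
  qed
  show ?thesis
  proof (rule nth_equalityI)
    show "length (crossing_word 2 \<sigma> \<eta>) = length (if d = 1 then alternating (\<sigma> 1) (\<sigma> 2) (2 * m + 1)
        else alternating (\<sigma> 2) (\<sigma> 1) (2 * m + 1))"
      unfolding crossing_word_def times by simp
    fix k assume "k < length (crossing_word 2 \<sigma> \<eta>)"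
    then have k: "k < 2 * m + 1" unfolding crossing_word_def times by simp
    then have "crossing_word 2 \<sigma> \<eta> ! k = (if d * (- 1) ^ k = 1 then \<sigma> 1 else \<sigma> 2)"
      unfolding crossing_word_def times using letter[of k] by (simp del: upt_Suc)
    moreover have "(if d = 1 then alternating (\<sigma> 1) (\<sigma> 2) (2 * m + 1)
        else alternating (\<sigma> 2) (\<sigma> 1) (2 * m + 1)) ! k =
        (if d = 1 then if even k then \<sigma> 1 else \<sigma> 2 else if even k then \<sigma> 2 else \<sigma> 1)"
      unfolding nth_alternating[OF k, symmetric] by (rule if_distrib)
    ultimately show "crossing_word 2 \<sigma> \<eta> ! k = (if d = 1 then alternating (\<sigma> 1) (\<sigma> 2) (2 * m + 1)
        else alternating (\<sigma> 2) (\<sigma> 1) (2 * m + 1)) ! k"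
      using d by (cases "even k") auto
  qed
qed

lemma transversal_\<eta>:
  assumes k: "k \<le> 2 * m"
  shows "transversal_at (surface 2) (arcs_T 2 \<sigma>) \<eta> (crossing_time m k)"
proof -
  define x0 e c a where "x0 = crossing_time m k" and "e = d * (- 1) ^ k"
    and "c = d * (2 * real (2 * m + 1) * pi)" and "a = 1 - 2 * x0"
  have e: "e = 1 \<or> e = - 1" using d by (cases "even k") (auto simp: e_def)
  have c: "c \<noteq> 0" using d by (auto simp: c_def)
  define V where "V = {w. \<bar>c * Im w\<bar> < pi / 2 \<and> \<bar>Re w + a - 2 * Im w\<bar> < 1}"
  define U where "U = {p \<in> topspace (surface 2). e * Im (fst (sphere_coord p)) > 0}"
  define h where "h = spiral_chart a c \<circ> sphere_coord"
  have chart: "homeomorphic_map (top_of_set (half_sphere e)) (top_of_set V) (spiral_chart a c)"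
    using homeomorphic_maps_spiral_chart[OF c e] by (simp add: V_def homeomorphic_maps_map)
  have coord: "sphere_coord p \<in> round_sphere" if "p \<in> topspace (surface 2)" for p
    using homeomorphic_imp_surjective_map[OF homeomorphic_map_sphere_coord] that by auto
  have "sphere_coord ` (topspace (surface 2) \<inter> U) = topspace (top_of_set round_sphere) \<inter> half_sphere e"
    unfolding homeomorphic_imp_surjective_map[OF homeomorphic_map_sphere_coord, symmetric]
    using coord by (force simp: U_def half_sphere_def)
  then have "homeomorphic_map (subtopology (surface 2) U)
      (subtopology (top_of_set round_sphere) (half_sphere e)) sphere_coord"
    by (rule homeomorphic_map_subtopologies[OF homeomorphic_map_sphere_coord])
  moreover have "subtopology (top_of_set round_sphere) (half_sphere e) = top_of_set (half_sphere e)"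
    by (simp add: subtopology_subtopology half_sphere_def Int_absorb1)
  ultimately have hom: "homeomorphic_map (subtopology (surface 2) U) (top_of_set V) h"
    unfolding h_def using homeomorphic_map_compose chart by metis
  have "U \<subseteq> topspace (surface 2)" by (auto simp: U_def)
  then have hU: "h ` U = V"
    using homeomorphic_imp_surjective_map[OF hom] by (simp add: Int_absorb1)
  have "open V"
    unfolding V_def by (intro open_Collect_conj open_Collect_less continuous_intros)
  have "openin (surface 2) {p \<in> topspace (surface 2). sphere_coord p \<in> {q. e * Im (fst q) > 0}}"
  proof (rule openin_continuous_map_preimage)
    show "continuous_map (surface 2) euclidean sphere_coord"
      using homeomorphic_imp_continuous_map[OF homeomorphic_map_sphere_coord]
      by (simp add: continuous_map_in_subtopology)
    show "openin euclidean {q::complex \<times> real. e * Im (fst q) > 0}"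
      unfolding open_openin[symmetric] by (intro open_Collect_less continuous_intros)
  qed
  then have openU: "openin (surface 2) U" by (simp add: U_def)
  have T: "p \<in> arcs_T 2 \<sigma> \<longleftrightarrow> Im (h p) = 0" if "p \<in> U" for p
    using that c e by (auto simp: U_def mem_arcs_T h_def spiral_chart_def Let_def)
  \<comment> \<open>The last bound keeps the angle within \<open>\<pi> / 2\<close> of the equator, where the chart is defined.\<close>
  define \<epsilon> where "\<epsilon> = min (min (x0 - 1 / 4) (3 / 4 - x0)) (1 / (8 * real (2 * m + 1)))"
  have b: "1 / 4 < x0" "x0 < 3 / 4" using crossing_time_bounds[OF k] by (simp_all add: x0_def)
  have \<epsilon>: "\<epsilon> > 0" using b by (simp add: \<epsilon>_def)
  have near: "\<eta> y \<in> U \<and> h (\<eta> y) = \<i> * of_real (y - x0)" if y: "y \<in> {x0 - \<epsilon>..x0 + \<epsilon>}" for y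
  proof -
    have y': "1 / 4 \<le> y" "y \<le> 3 / 4" "\<bar>y - x0\<bar> \<le> 1 / (8 * real (2 * m + 1))"
      using y by (auto simp: \<epsilon>_def)
    then have y01: "y \<in> {0..1}" "y \<in> {0<..<1}" by auto
    define \<psi> where "\<psi> = c * (y - x0)"
    define r where "r = sqrt (1 - (1 - 2 * y)\<^sup>2)"
    have r: "r > 0" using spiral_radius(2)[OF y01] by (simp add: r_def)
    have "\<bar>\<psi>\<bar> = 2 * pi * (real (2 * m + 1) * \<bar>y - x0\<bar>)"
      using d by (auto simp: \<psi>_def c_def abs_mult)
    also have "\<dots> \<le> 2 * pi * (1 / 8)"
      using y'(3) by (intro mult_left_mono) (simp_all add: field_simps)
    finally have \<psi>: "\<bar>\<psi>\<bar> < pi / 2" using pi_gt_zero by linarith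
    have angle: "spiral_angle d m y = d * (real k * pi + pi / 2) + \<psi>"
      using spiral_angle_near_crossing[OF y'(1,2), of d m k]
      by (simp add: \<psi>_def c_def x0_def algebra_simps)
    have dd: "cos (d * z) = cos z" "sin (d * z) = d * sin z" for z using d by auto
    have sc: "sin (spiral_angle d m y) = e * cos \<psi>" "cos (spiral_angle d m y) = - (e * sin \<psi>)"
      unfolding angle sin_add cos_add dd by (simp_all add: sin_add cos_add cos_npi e_def)
    have co: "sphere_coord (\<eta> y) = (Complex (1 - 2 * y) (e * r * cos \<psi>), - (e * r * sin \<psi>))"
      by (simp add: coord_\<eta>[OF y01(1)] spiral_def Let_def sc r_def algebra_simps)
    have "cos \<psi> > 0" using \<psi> by (intro cos_gt_zero_pi) (auto simp: abs_less_iff)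
    then have "e * (e * r * cos \<psi>) > 0" using e r by auto
    then have U: "\<eta> y \<in> U" using \<eta>_in_surface[OF y01(1)] co by (simp add: U_def)
    have "h (\<eta> y) = spiral_chart a c (spiral_chart_inv a c e (\<i> * of_real (y - x0)))"
    proof -
      have "c * Im (\<i> * of_real (y - x0)) = \<psi>"
        "Re (\<i> * of_real (y - x0)) + a - 2 * Im (\<i> * of_real (y - x0)) = 1 - 2 * y"
        by (simp_all add: \<psi>_def a_def)
      then show ?thesis
        by (simp only: h_def comp_apply co spiral_chart_inv_def Let_def r_def)
    qed
    also have "\<dots> = \<i> * of_real (y - x0)"
    proof -
      have "\<i> * of_real (y - x0) \<in> V"
        using \<psi> y01(2) by (auto simp: V_def \<psi>_def[symmetric] a_def abs_less_iff)
      then show ?thesis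
        using homeomorphic_maps_spiral_chart[OF c e, of a] by (simp add: V_def homeomorphic_maps_def)
    qed
    finally show ?thesis using U by simp
  qed
  have "\<eta> x0 \<in> U" using near[of x0] \<epsilon> by simp
  then show ?thesis
    unfolding transversal_at_def x0_def[symmetric]
    using openU \<open>open V\<close> hom hU T \<epsilon> near
    by (intro exI[of _ U] exI[of _ h]) (auto intro!: exI[of _ \<epsilon>])
qed

end

lemma spiral_curve_exists:
  assumes "\<sigma> permutes {1, 2}" "{i, j} = {1, 2}"
  obtains \<eta> where "pathin (surface 2) \<eta>"
    "\<forall>x \<in> {0..1}. \<eta> x \<in> marked_points 2 \<longleftrightarrow> x \<in> {0, 1}"
    "\<exists>\<epsilon>>0. \<eta> ` {0..\<epsilon>} \<subseteq> segment_L 2 1 \<and> \<eta> ` {1 - \<epsilon>..1} \<subseteq> segment_L 2 2"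
    "\<forall>x \<in> {0..1}. \<eta> x \<in> arcs_T 2 \<sigma> - marked_points 2 \<longrightarrow>
       transversal_at (surface 2) (arcs_T 2 \<sigma>) \<eta> x"
    "finite (crossing_times 2 \<sigma> \<eta>)"
    "crossing_word 2 \<sigma> \<eta> = alternating i j (2 * m + 1)"
    "simple_curve \<eta>"
proof -
  have \<sigma>: "{\<sigma> 1, \<sigma> 2} = {1, 2}" using permutes_image[OF assms(1)] by simp
  \<comment> \<open>With \<open>d = 1\<close> the first crossing is on the half \<open>Im z \<ge> 0\<close>, which is the arc labelled \<open>\<sigma> 1\<close>.\<close>
  define d :: real where "d = (if i = \<sigma> 1 then 1 else - 1)"
  obtain g where g: "homeomorphic_maps (surface 2) (top_of_set round_sphere) sphere_coord g"
    using homeomorphic_map_sphere_coord homeomorphic_map_maps by blast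
  have "pathin (top_of_set round_sphere) (spiral d m)"
    using continuous_spiral[of "{0..1}" d m] spiral_in_sphere
    by (auto simp: pathin_def continuous_map_in_subtopology)
  then have "pathin (surface 2) (g \<circ> spiral d m)"
    using g pathin_compose unfolding homeomorphic_maps_def by blast
  moreover have "sphere_coord ((g \<circ> spiral d m) x) = spiral d m x" if "x \<in> {0..1}" for x
    using g spiral_in_sphere[OF that] by (simp add: homeomorphic_maps_def)
  ultimately interpret spiral_on_surface d m \<sigma> "g \<circ> spiral d m"
    using \<sigma> by unfold_locales (auto simp: d_def)
  have "crossing_word 2 \<sigma> (g \<circ> spiral d m) = alternating i j (2 * m + 1)"
  proof -
    have "i = \<sigma> 1 \<and> j = \<sigma> 2 \<or> i = \<sigma> 2 \<and> j = \<sigma> 1 \<and> i \<noteq> \<sigma> 1"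
      using \<sigma> assms(2) by (auto simp: doubleton_eq_iff)
    then show ?thesis using crossing_word_\<eta> by (auto simp: d_def)
  qed
  moreover have "transversal_at (surface 2) (arcs_T 2 \<sigma>) (g \<circ> spiral d m) x"
    if x: "x \<in> {0..1}" and T: "(g \<circ> spiral d m) x \<in> arcs_T 2 \<sigma> - marked_points 2" for x
  proof -
    have "x \<in> {0<..<1}" using x T marked_iff[OF x] by auto
    then obtain k where "k \<le> 2 * m" "x = crossing_time m k" using on_arcs_iff T by auto
    then show ?thesis using transversal_\<eta> by simp
  qed
  moreover have "\<exists>\<epsilon>>0. (g \<circ> spiral d m) ` {0..\<epsilon>} \<subseteq> segment_L 2 1 \<and> (g \<circ> spiral d m) ` {1 - \<epsilon>..1} \<subseteq> segment_L 2 2"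
    using starts_in_L1 ends_in_L2 by (intro exI[of _ "1 / 4"]) simp
  ultimately show ?thesis
    using that[of "g \<circ> spiral d m"] pathin_\<eta> marked_iff simple_curve_\<eta>
    by (simp add: crossing_times_eq)
qed


section \<open>Linear equations over a field\<close>

text \<open>
  Gaussian elimination: an equation with a nonzero coefficient eliminates one unknown.
\<close>

lemma homogeneous_system_solution:
  fixes a :: "'j \<Rightarrow> 'i \<Rightarrow> 'k::field"
  assumes "finite J" "finite I" "card J < card I"
  shows "\<exists>x. (\<exists>i\<in>I. x i \<noteq> 0) \<and> (\<forall>j\<in>J. (\<Sum>i\<in>I. a j i * x i) = 0)"
  using assms
proof (induction J arbitrary: I a rule: finite_induct)
  case empty
  then obtain i where "i \<in> I" by fastforce
  then show ?case by (intro exI[of _ "\<lambda>_. 1"]) auto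
next
  case (insert j0 J)
  show ?case
  proof (cases "\<exists>i0\<in>I. a j0 i0 \<noteq> 0")
    case False
    then obtain x where "(\<exists>i\<in>I. x i \<noteq> 0) \<and> (\<forall>j\<in>J. (\<Sum>i\<in>I. a j i * x i) = 0)"
      using insert.IH[of I a] insert.prems insert.hyps by auto
    then show ?thesis using False by (intro exI[of _ x]) auto
  next
    case True
    then obtain i0 where i0: "i0 \<in> I" "a j0 i0 \<noteq> 0" by blast
    define b where "b = (\<lambda>j i. a j i - a j i0 * a j0 i / a j0 i0)"
    have "card J < card (I - {i0})" using insert.prems insert.hyps i0 by simp
    then obtain y where y: "\<exists>i\<in>I - {i0}. y i \<noteq> 0" "\<forall>j\<in>J. (\<Sum>i\<in>I - {i0}. b j i * y i) = 0"
      using insert.IH[of "I - {i0}" b] insert.prems by auto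
    define t where "t = - (\<Sum>i\<in>I - {i0}. a j0 i * y i) / a j0 i0"
    define x where "x = (\<lambda>i. if i = i0 then t else y i)"
    have split: "(\<Sum>i\<in>I. a j i * x i) = a j i0 * t + (\<Sum>i\<in>I - {i0}. a j i * y i)" for j
      by (subst sum.remove[OF insert.prems(1) i0(1)]) (simp add: x_def)
    have "(\<Sum>i\<in>I. a j0 i * x i) = 0" unfolding split t_def using i0 by simp
    moreover have "(\<Sum>i\<in>I. a j i * x i) = 0" if "j \<in> J" for j
    proof -
      have "0 = (\<Sum>i\<in>I - {i0}. b j i * y i)" using y(2) that by simp
      also have "\<dots> = (\<Sum>i\<in>I - {i0}. a j i * y i) - a j i0 / a j0 i0 * (\<Sum>i\<in>I - {i0}. a j0 i * y i)"
        by (simp add: b_def sum_distrib_left sum_subtractf algebra_simps)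
      also have "\<dots> = (\<Sum>i\<in>I. a j i * x i)" unfolding split t_def by simp
      finally show ?thesis by simp
    qed
    moreover have "\<exists>i\<in>I. x i \<noteq> 0" using y(1) by (auto simp: x_def)
    ultimately show ?thesis by (intro exI[of _ x]) auto
  qed
qed

text \<open>
  Otherwise there are more vectors than coordinates among \<open>u\<close> and the preimages \<open>g l\<close> of the unit
  vectors, and a dependency between them cannot exist.
\<close>

lemma surjective_with_kernel_card:
  fixes a :: "'j \<Rightarrow> 'i \<Rightarrow> 'k::field"
  assumes fin: "finite J" "finite I"
    and surj: "\<And>w. \<exists>x. \<forall>j\<in>J. (\<Sum>i\<in>I. a j i * x i) = w j"
    and u: "\<exists>i\<in>I. u i \<noteq> 0" "\<forall>j\<in>J. (\<Sum>i\<in>I. a j i * u i) = 0"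
  shows "card J < card I"
proof (rule ccontr)
  assume *: "\<not> card J < card I"
  define g where "g l = (SOME x. \<forall>j\<in>J. (\<Sum>i\<in>I. a j i * x i) = (if j = l then 1 else 0))" for l
  have g: "\<forall>j\<in>J. (\<Sum>i\<in>I. a j i * g l i) = (if j = l then 1 else 0)" for l
    unfolding g_def using surj[of "\<lambda>j. if j = l then 1 else 0"] by (rule someI_ex)
  define b where "b i l = (case l of None \<Rightarrow> u i | Some l \<Rightarrow> g l i)" for i and l :: "'j option"
  have "card I < card (insert None (Some ` J))"
    using * fin by (simp add: card_insert_if card_image)
  then obtain v where v: "\<exists>l\<in>insert None (Some ` J). v l \<noteq> 0"
    "\<forall>i\<in>I. (\<Sum>l\<in>insert None (Some ` J). b i l * v l) = 0"
    using homogeneous_system_solution[of I "insert None (Some ` J)" b] fin by auto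
  have eq: "u i * v None + (\<Sum>l\<in>J. g l i * v (Some l)) = 0" if "i \<in> I" for i
    using v(2) that fin by (simp add: sum.reindex b_def)
  have vj: "v (Some j) = 0" if j: "j \<in> J" for j
  proof -
    have "0 = (\<Sum>i\<in>I. a j i * (u i * v None + (\<Sum>l\<in>J. g l i * v (Some l))))"
      using eq by simp
    also have "\<dots> = (\<Sum>i\<in>I. a j i * u i) * v None + (\<Sum>l\<in>J. (\<Sum>i\<in>I. a j i * g l i) * v (Some l))"
      by (simp add: distrib_left sum.distrib sum_distrib_left sum_distrib_right mult.assoc)
        (rule sum.swap)
    also have "\<dots> = (\<Sum>l\<in>J. (if j = l then 1 else 0) * v (Some l))"
      using u(2) g j by simp
    also have "\<dots> = v (Some j)" using fin j by (simp add: if_distrib[of "\<lambda>x. x * _"] cong: if_cong)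
    finally show ?thesis by simp
  qed
  then have "u i * v None = 0" if "i \<in> I" for i using eq[OF that] by simp
  then have "v None = 0" using u(1) by auto
  then show False using v(1) vj by auto
qed

text \<open>
  The system \<open>a x = v w\<close>, \<open>x i0 = 0\<close> in the unknowns \<open>x\<close> and \<open>v\<close> has fewer equations than unknowns, and a
  solution with \<open>v = 0\<close> would lie in the kernel, hence vanish.
\<close>

lemma one_dim_kernel_surjective:
  fixes a :: "'j \<Rightarrow> 'i \<Rightarrow> 'k::field"
  assumes fin: "finite J" "finite I" and card: "card I = card J + 1"
    and u: "i0 \<in> I" "u i0 \<noteq> 0"
    and ker: "\<And>x. \<forall>j\<in>J. (\<Sum>i\<in>I. a j i * x i) = 0 \<Longrightarrow> \<exists>c. \<forall>i\<in>I. x i = c * u i"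
  shows "\<exists>x. \<forall>j\<in>J. (\<Sum>i\<in>I. a j i * x i) = w j"
proof -
  define b where "b j i = (case j of None \<Rightarrow> (case i of None \<Rightarrow> 0 | Some i \<Rightarrow> if i = i0 then 1 else 0)
    | Some j \<Rightarrow> (case i of None \<Rightarrow> - w j | Some i \<Rightarrow> a j i))" for j i
  have "card (insert None (Some ` J)) < card (insert None (Some ` I))"
    using fin card by (simp add: card_insert_if card_image)
  then obtain v where v: "\<exists>i\<in>insert None (Some ` I). v i \<noteq> 0"
    "\<forall>j\<in>insert None (Some ` J). (\<Sum>i\<in>insert None (Some ` I). b j i * v i) = 0"
    using homogeneous_system_solution[of "insert None (Some ` J)" "insert None (Some ` I)" b] fin
    by auto
  have eq: "(\<Sum>i\<in>I. a j i * v (Some i)) = w j * v None" if "j \<in> J" for j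
    using v(2) that fin by (simp add: sum.reindex b_def)
  have "(\<Sum>i\<in>I. (if i = i0 then 1 else 0) * v (Some i)) = 0"
    using v(2) fin by (simp add: sum.reindex b_def)
  then have vi0: "v (Some i0) = 0"
    using fin u(1) by (simp add: if_distrib[of "\<lambda>x. x * _"] cong: if_cong)
  have "v None \<noteq> 0"
  proof
    assume n: "v None = 0"
    then obtain c where c: "\<forall>i\<in>I. v (Some i) = c * u i"
      using ker[of "\<lambda>i. v (Some i)"] eq by auto
    then have "c = 0" using vi0 u by auto
    then show False using c v(1) n by auto
  qed
  then have "\<forall>j\<in>J. (\<Sum>i\<in>I. a j i * (v (Some i) / v None)) = w j"
    using eq by (simp add: sum_divide_distrib[symmetric])
  then show ?thesis by (rule exI[of _ "\<lambda>i. v (Some i) / v None"])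
qed

text \<open>
  The columns of \<open>K\<close> are a basis of the kernel of \<open>S\<close>. The last clause is the dual statement that a
  linear form which vanishes on the kernel is a combination of the rows of \<open>S\<close>.
\<close>

definition kernel_matrix ::
  "'i set \<Rightarrow> 'j set \<Rightarrow> ('i \<Rightarrow> 'j \<Rightarrow> 'k::field) \<Rightarrow> 'j set \<Rightarrow> ('j \<Rightarrow> 'j \<Rightarrow> 'k) \<Rightarrow> bool" where
  "kernel_matrix I J S C K \<longleftrightarrow> C \<subseteq> J \<and> card I + card C = card J \<and>
    (\<forall>i\<in>I. \<forall>c\<in>C. (\<Sum>j\<in>J. S i j * K j c) = 0) \<and>
    (\<forall>z. (\<forall>j\<in>J. (\<Sum>c\<in>C. K j c * z c) = 0) \<longrightarrow> (\<forall>c\<in>C. z c = 0)) \<and>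
    (\<forall>g. (\<forall>c\<in>C. (\<Sum>j\<in>J. g j * K j c) = 0) \<longrightarrow> (\<exists>y. \<forall>j\<in>J. g j = (\<Sum>i\<in>I. y i * S i j)))"

lemma kernel_matrixD:
  assumes "kernel_matrix I J S C K"
  shows "C \<subseteq> J" "card I + card C = card J"
    "\<And>i c. i \<in> I \<Longrightarrow> c \<in> C \<Longrightarrow> (\<Sum>j\<in>J. S i j * K j c) = 0"
    "\<And>z. \<forall>j\<in>J. (\<Sum>c\<in>C. K j c * z c) = 0 \<Longrightarrow> \<forall>c\<in>C. z c = 0"
    "\<And>g. \<forall>c\<in>C. (\<Sum>j\<in>J. g j * K j c) = 0 \<Longrightarrow> \<exists>y. \<forall>j\<in>J. g j = (\<Sum>i\<in>I. y i * S i j)"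
proof -
  note k = assms[unfolded kernel_matrix_def]
  show "C \<subseteq> J" "card I + card C = card J"
    by (rule k[THEN conjunct1], rule k[THEN conjunct2, THEN conjunct1])
  show "(\<Sum>j\<in>J. S i j * K j c) = 0" if "i \<in> I" "c \<in> C" for i c
    by (rule k[THEN conjunct2, THEN conjunct2, THEN conjunct1, THEN bspec, THEN bspec, OF that])
  note k' = k[THEN conjunct2, THEN conjunct2, THEN conjunct2]
  fix z :: "'b \<Rightarrow> 'c"
  show "\<forall>j\<in>J. (\<Sum>c\<in>C. K j c * z c) = 0 \<Longrightarrow> \<forall>c\<in>C. z c = 0"
    by (rule k'[THEN conjunct1, THEN spec, THEN mp])
  show "\<forall>c\<in>C. (\<Sum>j\<in>J. z j * K j c) = 0 \<Longrightarrow> \<exists>y. \<forall>j\<in>J. z j = (\<Sum>i\<in>I. y i * S i j)"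
    by (rule k'[THEN conjunct2, THEN spec, THEN mp])
qed

text \<open>
  The rows are added one at a time. A new row does not vanish on the old kernel, for else it would be
  a combination of the old rows; subtracting multiples of a basis vector on which it does not vanish
  from the others gives a basis of the new kernel.
\<close>

lemma kernel_matrix_exists:
  fixes S :: "'i \<Rightarrow> 'j \<Rightarrow> 'k::field"
  assumes "finite I" "finite J"
    and "\<And>y. \<forall>j\<in>J. (\<Sum>i\<in>I. y i * S i j) = 0 \<Longrightarrow> \<forall>i\<in>I. y i = 0"
  shows "\<exists>C K. kernel_matrix I J S C K"
  using assms(1,3)
proof (induction I rule: finite_induct)
  case empty
  have "(\<Sum>j\<in>J. g j * (if j = c then 1 else 0)) = g c" if "c \<in> J" for g :: "'j \<Rightarrow> 'k" and c
    using assms(2) that by (simp add: if_distrib[of "\<lambda>x. _ * x"] cong: if_cong)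
  moreover have "(\<Sum>c\<in>J. (if j = c then 1 else 0) * z c) = z j" if "j \<in> J" for z :: "'j \<Rightarrow> 'k" and j
    using assms(2) that by (simp add: if_distrib[of "\<lambda>x. x * _"] cong: if_cong)
  ultimately show ?case
    unfolding kernel_matrix_def
    by (intro exI[of _ J] exI[of _ "\<lambda>j c. if j = c then 1 else 0"]) auto
next
  case (insert i0 I)
  have ind: "\<forall>i\<in>I. y i = 0" if "\<forall>j\<in>J. (\<Sum>i\<in>I. y i * S i j) = 0" for y
  proof -
    have "(\<Sum>i\<in>insert i0 I. (y(i0 := 0)) i * S i j) = (\<Sum>i\<in>I. y i * S i j)" for j
      using insert.hyps by (auto intro!: sum.cong)
    then have "\<forall>i\<in>insert i0 I. (y(i0 := 0)) i = 0"
      using that by (intro insert.prems) simp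
    then show ?thesis using insert.hyps by (metis fun_upd_other insertCI)
  qed
  have "\<exists>C K. kernel_matrix I J S C K" by (rule insert.IH) (rule ind)
  then obtain C K where "kernel_matrix I J S C K" by (elim exE)
  note CK = kernel_matrixD[OF this]
  define r where "r c = (\<Sum>j\<in>J. S i0 j * K j c)" for c
  have finC: "finite C" using CK(1) assms(2) finite_subset by blast
  have "\<exists>c0\<in>C. r c0 \<noteq> 0"
  proof (rule ccontr)
    assume "\<not> ?thesis"
    then obtain y where y: "\<forall>j\<in>J. S i0 j = (\<Sum>i\<in>I. y i * S i j)"
      using CK(5)[of "S i0"] by (auto simp: r_def)
    define y' where "y' = (\<lambda>i. if i = i0 then - 1 else y i)"
    have "(\<Sum>i\<in>insert i0 I. y' i * S i j) = 0" if "j \<in> J" for j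
    proof -
      have "(\<Sum>i\<in>I. y' i * S i j) = (\<Sum>i\<in>I. y i * S i j)"
        using insert.hyps by (intro sum.cong) (auto simp: y'_def)
      then show ?thesis using insert.hyps y that by (simp add: y'_def)
    qed
    then have "y' i0 = 0" using insert.prems by blast
    then show False by (simp add: y'_def)
  qed
  then obtain c0 where c0: "c0 \<in> C" "r c0 \<noteq> 0" by blast
  define K' where "K' j c = K j c - r c / r c0 * K j c0" for j c
  have K'sum: "(\<Sum>j\<in>J. g j * K' j c) = (\<Sum>j\<in>J. g j * K j c) - r c / r c0 * (\<Sum>j\<in>J. g j * K j c0)" for g c
    by (simp add: K'_def right_diff_distrib sum_subtractf sum_distrib_left mult.left_commute)
  show ?case
    unfolding kernel_matrix_def
  proof (intro exI[of _ "C - {c0}"] exI[of _ K'] conjI ballI allI impI)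
    show "C - {c0} \<subseteq> J" using CK(1) by blast
    show "card (insert i0 I) + card (C - {c0}) = card J"
      using CK(2) insert.hyps card.remove[OF finC c0(1)] by simp
  next
    fix i c assume "i \<in> insert i0 I" "c \<in> C - {c0}"
    then show "(\<Sum>j\<in>J. S i j * K' j c) = 0"
      unfolding K'sum using CK(3) c0 by (auto simp: r_def[symmetric])
  next
    fix z c assume z: "\<forall>j\<in>J. (\<Sum>c\<in>C - {c0}. K' j c * z c) = 0" and c: "c \<in> C - {c0}"
    define z' where "z' = z(c0 := - (\<Sum>c\<in>C - {c0}. r c / r c0 * z c))"
    have "(\<Sum>c\<in>C. K j c * z' c) = (\<Sum>c\<in>C - {c0}. K' j c * z c)" for j
    proof -
      have "(\<Sum>c\<in>C. K j c * z' c) = K j c0 * z' c0 + (\<Sum>c\<in>C - {c0}. K j c * z' c)"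
        using sum.remove[OF finC c0(1)] .
      also have "(\<Sum>c\<in>C - {c0}. K j c * z' c) = (\<Sum>c\<in>C - {c0}. K j c * z c)"
        by (intro sum.cong) (auto simp: z'_def)
      finally show ?thesis
        by (simp add: K'_def z'_def left_diff_distrib right_diff_distrib sum_subtractf sum_distrib_left mult_ac
            del: fun_upd_apply add: fun_upd_same)
    qed
    then have "\<forall>c\<in>C. z' c = 0" using z by (intro CK(4)) simp
    then show "z c = 0" using c by (auto simp: z'_def)
  next
    fix g assume g: "\<forall>c\<in>C - {c0}. (\<Sum>j\<in>J. g j * K' j c) = 0"
    define h where "h c = (\<Sum>j\<in>J. g j * K j c)" for c
    define m where "m = h c0 / r c0"
    have h: "h c = r c * m" if "c \<in> C" for c
      using g that c0 unfolding K'sum h_def[symmetric] by (cases "c = c0") (auto simp: m_def)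
    have g': "\<forall>c\<in>C. (\<Sum>j\<in>J. (g j - m * S i0 j) * K j c) = 0"
    proof
      fix c assume "c \<in> C"
      have "(\<Sum>j\<in>J. (g j - m * S i0 j) * K j c) = h c - m * r c"
        by (simp add: h_def r_def left_diff_distrib sum_subtractf sum_distrib_left mult.assoc)
      then show "(\<Sum>j\<in>J. (g j - m * S i0 j) * K j c) = 0" using h[OF \<open>c \<in> C\<close>] by simp
    qed
    obtain y where y: "\<forall>j\<in>J. g j - m * S i0 j = (\<Sum>i\<in>I. y i * S i j)"
      using CK(5)[of "\<lambda>j. g j - m * S i0 j", OF g'] by (elim exE)
    have "g j = (\<Sum>i\<in>insert i0 I. (y(i0 := m)) i * S i j)" if "j \<in> J" for j
    proof -
      have "(\<Sum>i\<in>I. (y(i0 := m)) i * S i j) = (\<Sum>i\<in>I. y i * S i j)"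
        using insert.hyps by (intro sum.cong) auto
      then show ?thesis using y that insert.hyps by (simp add: algebra_simps)
    qed
    then show "\<exists>y. \<forall>j\<in>J. g j = (\<Sum>i\<in>insert i0 I. y i * S i j)" by blast
  qed
qed

section \<open>Tuples of matrices\<close>

text \<open>
  A representation of the quiver with arrows \<open>E\<close>, all from one vertex to the other, with spaces of
  dimensions \<open>p\<close> and \<open>q\<close>.
\<close>

definition is_tuple :: "'a set \<Rightarrow> nat \<Rightarrow> nat \<Rightarrow> ('a \<Rightarrow> 'k::field mat) \<Rightarrow> bool" where
  "is_tuple E p q A \<longleftrightarrow> (\<forall>e\<in>E. A e \<in> carrier_mat q p)"

definition endo :: "'a set \<Rightarrow> nat \<Rightarrow> nat \<Rightarrow> ('a \<Rightarrow> 'k::field mat) \<Rightarrow> 'k mat \<Rightarrow> 'k mat \<Rightarrow> bool" where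
  "endo E p q A X Y \<longleftrightarrow> X \<in> carrier_mat p p \<and> Y \<in> carrier_mat q q \<and> (\<forall>e\<in>E. A e * X = Y * A e)"

definition indecomposable_tuple :: "'a set \<Rightarrow> nat \<Rightarrow> nat \<Rightarrow> ('a \<Rightarrow> 'k::field mat) \<Rightarrow> bool" where
  "indecomposable_tuple E p q A \<longleftrightarrow> is_tuple E p q A \<and> p + q > 0 \<and>
    (\<forall>X Y. endo E p q A X Y \<and> X * X = X \<and> Y * Y = Y \<longrightarrow>
      X = 0\<^sub>m p p \<and> Y = 0\<^sub>m q q \<or> X = 1\<^sub>m p \<and> Y = 1\<^sub>m q)"

definition brick :: "'a set \<Rightarrow> nat \<Rightarrow> nat \<Rightarrow> ('a \<Rightarrow> 'k::field mat) \<Rightarrow> bool" where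
  "brick E p q A \<longleftrightarrow> is_tuple E p q A \<and> p + q > 0 \<and>
    (\<forall>X Y. endo E p q A X Y \<longrightarrow> (\<exists>c. X = c \<cdot>\<^sub>m 1\<^sub>m p \<and> Y = c \<cdot>\<^sub>m 1\<^sub>m q))"

text \<open>
  The map \<open>(k\<^sup>p)\<^sup>E \<rightarrow> k\<^sup>q\<close> with the components \<open>A e\<close> is onto. Testing this against square matrices
  \<open>Y\<close> amounts to testing it against their rows.
\<close>

definition jointly_surjective :: "'a set \<Rightarrow> nat \<Rightarrow> ('a \<Rightarrow> 'k::field mat) \<Rightarrow> nat \<Rightarrow> bool" where
  "jointly_surjective E q A p \<longleftrightarrow>
    (\<forall>Y \<in> carrier_mat q q. (\<forall>e\<in>E. Y * A e = 0\<^sub>m q p) \<longrightarrow> Y = 0\<^sub>m q q)"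

lemma mult_mat_entry:
  assumes "A \<in> carrier_mat r k" "B \<in> carrier_mat k c" "i < r" "j < c"
  shows "(A * B) $$ (i, j) = (\<Sum>l<k. A $$ (i, l) * B $$ (l, j))"
  using assms by (simp add: scalar_prod_def atLeast0LessThan)

lemma brick_imp_indecomposable:
  assumes "brick E p q A"
  shows "indecomposable_tuple E p q A"
  unfolding indecomposable_tuple_def
proof (intro conjI allI impI)
  show "is_tuple E p q A" "p + q > 0" using assms by (auto simp: brick_def)
  fix X Y assume XY: "endo E p q A X Y \<and> X * X = X \<and> Y * Y = Y"
  then obtain c where c: "X = c \<cdot>\<^sub>m 1\<^sub>m p" "Y = c \<cdot>\<^sub>m 1\<^sub>m q"
    using assms unfolding brick_def by blast
  have idem: "r = 0 \<or> c * c = c" if "(c \<cdot>\<^sub>m 1\<^sub>m r) * (c \<cdot>\<^sub>m 1\<^sub>m r) = c \<cdot>\<^sub>m 1\<^sub>m r" for r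
  proof (cases "r = 0")
    case False
    have "((c \<cdot>\<^sub>m 1\<^sub>m r) * (c \<cdot>\<^sub>m 1\<^sub>m r)) $$ (0, 0) = (c \<cdot>\<^sub>m 1\<^sub>m r) $$ (0, 0)" using that by simp
    then show ?thesis using False by (simp add: mult_smult_distrib[of _ r r] mult_smult_assoc_mat[of _ r r])
  qed simp
  have "c * c = c"
    using idem[of p] idem[of q] XY \<open>p + q > 0\<close> unfolding c by auto
  then have "c = 0 \<or> c = 1" by (simp add: mult_cancel_left1)
  then show "X = 0\<^sub>m p p \<and> Y = 0\<^sub>m q q \<or> X = 1\<^sub>m p \<and> Y = 1\<^sub>m q"
    unfolding c by (auto intro!: eq_matI)
qed

text \<open>
  A tuple that is not jointly surjective splits off a one-dimensional space at the sink: if the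
  row \<open>y\<close> kills the tuple and \<open>y u = 1\<close>, then \<open>u y\<close> is an idempotent.
\<close>

lemma not_jointly_surjective_idempotent:
  assumes A: "is_tuple E p q A" and nz: "\<not> jointly_surjective E q A p"
  obtains Y where "endo E p q A (0\<^sub>m p p) Y" "Y * Y = Y" "Y \<noteq> 0\<^sub>m q q"
proof -
  obtain Y where Y: "Y \<in> carrier_mat q q" "\<And>e. e \<in> E \<Longrightarrow> Y * A e = 0\<^sub>m q p" "Y \<noteq> 0\<^sub>m q q"
    using nz unfolding jointly_surjective_def by blast
  have "\<exists>i<q. \<exists>j<q. Y $$ (i, j) \<noteq> 0"
  proof (rule ccontr)
    assume "\<not> ?thesis"
    then have "Y = 0\<^sub>m q q" using Y(1) by (intro eq_matI) auto
    then show False using Y(3) by simp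
  qed
  then obtain i j where ij: "i < q" "j < q" "Y $$ (i, j) \<noteq> 0" by blast
  define U where "U = mat q q (\<lambda>(k, l). if k = j \<and> l = i then 1 / Y $$ (i, j) else 0)"
  have U: "U \<in> carrier_mat q q" by (simp add: U_def)
  have UY: "(U * Y) $$ (k, l) = (if k = j then Y $$ (i, l) / Y $$ (i, j) else 0)" if "k < q" "l < q" for k l
  proof -
    have "(U * Y) $$ (k, l) = (\<Sum>m<q. if m = i then (if k = j then Y $$ (i, l) / Y $$ (i, j) else 0) else 0)"
      unfolding mult_mat_entry[OF U Y(1) that] using that
      by (intro sum.cong) (auto simp: U_def)
    then show ?thesis using ij by simp
  qed
  define F where "F = U * Y"
  have F: "F \<in> carrier_mat q q" using U Y by (simp add: F_def)
  have "F * F = F"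
  proof (rule eq_matI)
    fix k l assume kl: "k < dim_row F" "l < dim_col F"
    then have kl': "k < q" "l < q" using F by auto
    have "(F * F) $$ (k, l) = (\<Sum>m<q. if m = j then F $$ (k, j) * F $$ (j, l) else 0)"
      unfolding mult_mat_entry[OF F F kl'] using kl' by (intro sum.cong) (auto simp: F_def UY)
    also have "\<dots> = F $$ (k, j) * F $$ (j, l)" using ij by simp
    also have "\<dots> = F $$ (k, l)" using kl' ij by (simp add: F_def UY)
    finally show "(F * F) $$ (k, l) = F $$ (k, l)" .
  qed (use F in auto)
  moreover have "endo E p q A (0\<^sub>m p p) F"
    unfolding endo_def
  proof (intro conjI ballI)
    fix e assume e: "e \<in> E"
    then have Ae: "A e \<in> carrier_mat q p" using A by (simp add: is_tuple_def)
    have "F * A e = U * (Y * A e)" unfolding F_def by (rule assoc_mult_mat[OF U Y(1) Ae])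
    also have "\<dots> = 0\<^sub>m q p" using Y(2)[OF e] U by simp
    finally show "A e * 0\<^sub>m p p = F * A e" using Ae by simp
  qed (use F in auto)
  moreover have "F $$ (j, j) = 1" using ij by (simp add: F_def UY)
  then have "F \<noteq> 0\<^sub>m q q" using ij by auto
  ultimately show ?thesis using that by blast
qed

lemma indecomposable_jointly_surjective:
  assumes "indecomposable_tuple E p q A" "p > 0"
  shows "jointly_surjective E q A p"
proof (rule ccontr)
  assume "\<not> ?thesis"
  moreover have "is_tuple E p q A" using assms by (simp add: indecomposable_tuple_def)
  ultimately obtain Y where Y: "endo E p q A (0\<^sub>m p p) Y" "Y * Y = Y" "Y \<noteq> 0\<^sub>m q q"
    using not_jointly_surjective_idempotent by blast
  have "0\<^sub>m p p * 0\<^sub>m p p = (0\<^sub>m p p :: 'b mat)" by simp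
  then have "0\<^sub>m p p = (1\<^sub>m p :: 'b mat)"
    using assms(1) Y unfolding indecomposable_tuple_def by blast
  then have "(0\<^sub>m p p :: 'b mat) $$ (0, 0) = 1\<^sub>m p $$ (0, 0)" by simp
  then show False using assms(2) by simp
qed

text \<open>
  The reflection functor at the sink. The new space is the kernel of the map
  \<open>(k\<^sup>p)\<^sup>E \<rightarrow> k\<^sup>q\<close> given by the tuple, and an endomorphism of the new tuple
  extends to the old one because \<open>k\<^sup>q\<close> is the cokernel of the inclusion of this kernel.
\<close>

lemma reflect_tuple:
  fixes A :: "'a \<Rightarrow> 'k::field mat"
  assumes fin: "finite E" and A: "is_tuple E p q A" and surj: "jointly_surjective E q A p"
  obtains c and B :: "'a \<Rightarrow> 'k mat" where "q + c = card E * p" "is_tuple E c p B"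
    "\<forall>Z X. endo E c p B Z X \<longrightarrow> (\<exists>Y. endo E p q A X Y)"
    "\<forall>Z \<in> carrier_mat c c. \<forall>Z' \<in> carrier_mat c c. (\<forall>e\<in>E. B e * Z = B e * Z') \<longrightarrow> Z = Z'"
proof -
  define J where "J = E \<times> {..<p}"
  define S where "S i = (\<lambda>(e, j). A e $$ (i, j))" for i
  have finJ: "finite J" using fin by (simp add: J_def)
  have Ae: "A e \<in> carrier_mat q p" if "e \<in> E" for e using A that by (simp add: is_tuple_def)
  have "\<exists>C K. kernel_matrix {..<q} J S C K"
  proof (rule kernel_matrix_exists)
    fix y assume y: "\<forall>j\<in>J. (\<Sum>i<q. y i * S i j) = 0"
    define Y where "Y = mat q q (\<lambda>(k, i). y i)"
    have Y: "Y \<in> carrier_mat q q" by (simp add: Y_def)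
    have "Y * A e = 0\<^sub>m q p" if e: "e \<in> E" for e
    proof (rule eq_matI)
      fix k j assume "k < dim_row (0\<^sub>m q p)" "j < dim_col (0\<^sub>m q p)"
      then have kj: "k < q" "j < p" by auto
      have "(Y * A e) $$ (k, j) = (\<Sum>i<q. y i * S i (e, j))"
        unfolding mult_mat_entry[OF Y Ae[OF e] kj] using kj by (simp add: Y_def S_def)
      also have "\<dots> = 0" using y e kj by (simp add: J_def)
      finally show "(Y * A e) $$ (k, j) = 0\<^sub>m q p $$ (k, j)" using kj by simp
    qed (use Y Ae[OF e] in auto)
    then have "Y = 0\<^sub>m q q" using surj Y unfolding jointly_surjective_def by blast
    moreover have "y i = Y $$ (i, i)" if "i < q" for i using that by (simp add: Y_def)
    ultimately show "\<forall>i\<in>{..<q}. y i = 0" by simp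
  qed (use finJ in auto)
  then obtain C K where "kernel_matrix {..<q} J S C K" by (elim exE)
  note CK = kernel_matrixD[OF this]
  define c where "c = card C"
  have finC: "finite C" using CK(1) finJ finite_subset by blast
  obtain f where f: "bij_betw f {..<c} C"
    using ex_bij_betw_nat_finite[OF finC] by (auto simp: c_def atLeast0LessThan)
  have fC: "f l \<in> C" if "l < c" for l using f that by (auto simp: bij_betw_def)
  have sum_f: "(\<Sum>l<c. g (f l)) = (\<Sum>x\<in>C. g x)" for g :: "_ \<Rightarrow> 'k"
    by (rule sum.reindex_bij_betw[OF f])
  define B where "B e = mat p c (\<lambda>(j, l). K (e, j) (f l))" for e
  have B: "B e \<in> carrier_mat p c" for e by (simp add: B_def)
  have sum_J: "(\<Sum>x\<in>J. g x) = (\<Sum>e\<in>E. \<Sum>j<p. g (e, j))" for g :: "_ \<Rightarrow> 'k"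
    by (simp add: J_def sum.cartesian_product)
  show ?thesis
  proof (rule that; (intro allI ballI impI)?)
    show "q + c = card E * p" using CK(2) by (simp add: c_def J_def card_cartesian_product)
    show "is_tuple E c p B" using B by (simp add: is_tuple_def)
  next
    fix Z Z' assume Z: "Z \<in> carrier_mat c c" "Z' \<in> carrier_mat c c"
      and eq: "\<forall>e\<in>E. B e * Z = B e * Z'"
    show "Z = Z'"
    proof (rule eq_matI)
      fix i j assume "i < dim_row Z'" "j < dim_col Z'"
      then have ij: "i < c" "j < c" using Z by auto
      define g where "g = inv_into {..<c} f"
      have gf: "g (f l) = l" if "l < c" for l
        using f that by (simp add: g_def bij_betw_def)
      have "\<forall>x\<in>J. (\<Sum>y\<in>C. K x y * (Z $$ (g y, j) - Z' $$ (g y, j))) = 0"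
      proof
        fix x assume "x \<in> J"
        then obtain e k where x: "x = (e, k)" "e \<in> E" "k < p" by (auto simp: J_def)
        have "(\<Sum>y\<in>C. K x y * (Z $$ (g y, j) - Z' $$ (g y, j))) =
            (\<Sum>l<c. B e $$ (k, l) * (Z $$ (l, j) - Z' $$ (l, j)))"
          unfolding sum_f[symmetric] using x gf by (intro sum.cong) (auto simp: B_def)
        also have "\<dots> = (B e * Z) $$ (k, j) - (B e * Z') $$ (k, j)"
          unfolding mult_mat_entry[OF B Z(1) x(3) ij(2)] mult_mat_entry[OF B Z(2) x(3) ij(2)]
          by (simp add: right_diff_distrib sum_subtractf)
        finally show "(\<Sum>y\<in>C. K x y * (Z $$ (g y, j) - Z' $$ (g y, j))) = 0"
          using eq x(2) by simp
      qed
      from CK(4)[of "\<lambda>y. Z $$ (g y, j) - Z' $$ (g y, j)", OF this]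
      have "Z $$ (g (f i), j) - Z' $$ (g (f i), j) = 0" using fC[OF ij(1)] by blast
      then show "Z $$ (i, j) = Z' $$ (i, j)" using gf ij by simp
    qed (use Z in auto)
  next
    fix Z X assume ZX: "endo E c p B Z X"
    then have X: "X \<in> carrier_mat p p" and Z: "Z \<in> carrier_mat c c"
      and eq: "\<And>e. e \<in> E \<Longrightarrow> B e * Z = X * B e" by (auto simp: endo_def)
    have row: "\<exists>y. \<forall>x\<in>J. (case x of (e, j) \<Rightarrow> (A e * X) $$ (i, j)) = (\<Sum>k<q. y k * S k x)"
      if i: "i < q" for i
    proof (rule CK(5), rule ballI)
      fix x assume "x \<in> C"
      then obtain l where l: "l < c" "x = f l" using f by (auto simp: bij_betw_def)
      have "(\<Sum>j\<in>J. (case j of (e, j) \<Rightarrow> (A e * X) $$ (i, j)) * K j x) =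
          (\<Sum>e\<in>E. \<Sum>j<p. (A e * X) $$ (i, j) * B e $$ (j, l))"
        unfolding sum_J using l by (intro sum.cong) (auto simp: B_def)
      also have "\<dots> = (\<Sum>e\<in>E. ((A e * X) * B e) $$ (i, l))"
      proof (intro sum.cong refl)
        fix e assume e: "e \<in> E"
        have AX: "A e * X \<in> carrier_mat q p" by (rule mult_carrier_mat[OF Ae[OF e] X])
        show "(\<Sum>j<p. (A e * X) $$ (i, j) * B e $$ (j, l)) = (A e * X * B e) $$ (i, l)"
          by (rule mult_mat_entry[OF AX B i l(1), symmetric])
      qed
      also have "\<dots> = (\<Sum>e\<in>E. (A e * (B e * Z)) $$ (i, l))"
        using assoc_mult_mat[OF Ae X B] eq by (intro sum.cong) auto
      also have "\<dots> = (\<Sum>e\<in>E. ((A e * B e) * Z) $$ (i, l))"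
        using assoc_mult_mat[OF Ae B Z] by (intro sum.cong) auto
      also have "\<dots> = (\<Sum>e\<in>E. \<Sum>m<c. (\<Sum>j<p. S i (e, j) * K (e, j) (f m)) * Z $$ (m, l))"
      proof (intro sum.cong refl)
        fix e assume e: "e \<in> E"
        have AB: "A e * B e \<in> carrier_mat q c" using Ae[OF e] B by auto
        show "((A e * B e) * Z) $$ (i, l) = (\<Sum>m<c. (\<Sum>j<p. S i (e, j) * K (e, j) (f m)) * Z $$ (m, l))"
          unfolding mult_mat_entry[OF AB Z i l(1)]
        proof (intro sum.cong refl arg_cong2[where f = "(*)"])
          fix m assume "m \<in> {..<c}"
          then have m: "m < c" by simp
          show "(A e * B e) $$ (i, m) = (\<Sum>j<p. S i (e, j) * K (e, j) (f m))"
            unfolding mult_mat_entry[OF Ae[OF e] B i m] using m by (simp add: S_def B_def)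
        qed
      qed
      also have "\<dots> = (\<Sum>m<c. (\<Sum>j\<in>J. S i j * K j (f m)) * Z $$ (m, l))"
        unfolding sum_J sum_distrib_right by (subst sum.swap) simp
      also have "\<dots> = 0" using CK(3) i fC by simp
      finally show "(\<Sum>j\<in>J. (case j of (e, j) \<Rightarrow> (A e * X) $$ (i, j)) * K j x) = 0" .
    qed
    define y where "y i = (SOME y. \<forall>x\<in>J. (case x of (e, j) \<Rightarrow> (A e * X) $$ (i, j)) = (\<Sum>k<q. y k * S k x))" for i
    have y: "\<forall>x\<in>J. (case x of (e, j) \<Rightarrow> (A e * X) $$ (i, j)) = (\<Sum>k<q. y i k * S k x)" if "i < q" for i
      unfolding y_def using row[OF that] by (rule someI_ex)
    define Y where "Y = mat q q (\<lambda>(i, k). y i k)"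
    have Y: "Y \<in> carrier_mat q q" by (simp add: Y_def)
    have "A e * X = Y * A e" if e: "e \<in> E" for e
    proof (rule eq_matI)
      fix i j assume "i < dim_row (Y * A e)" "j < dim_col (Y * A e)"
      then have ij: "i < q" "j < p" using Y Ae[OF e] by auto
      have "(A e * X) $$ (i, j) = (\<Sum>k<q. y i k * S k (e, j))"
        using y[OF ij(1)] e ij by (auto simp: J_def)
      also have "\<dots> = (Y * A e) $$ (i, j)"
        unfolding mult_mat_entry[OF Y Ae[OF e] ij] using ij by (simp add: Y_def S_def)
      finally show "(A e * X) $$ (i, j) = (Y * A e) $$ (i, j)" .
    qed (use X Y Ae[OF e] in auto)
    then show "\<exists>Y. endo E p q A X Y" using X Y by (auto simp: endo_def)
  qed
qed


text \<open>
  The second component of an endomorphism is determined by the first one, because the tuple can be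
  cancelled on the right.
\<close>

lemma idempotent_lift:
  assumes A: "is_tuple E p q A" and surj: "jointly_surjective E q A p"
    and XY: "endo E p q A X Y" and X: "X * X = X"
  shows "Y * Y = Y"
proof -
  have c: "X \<in> carrier_mat p p" "Y \<in> carrier_mat q q" using XY by (auto simp: endo_def)
  have "(Y * Y - Y) * A e = 0\<^sub>m q p" if e: "e \<in> E" for e
  proof -
    have Ae: "A e \<in> carrier_mat q p" using A e by (simp add: is_tuple_def)
    have eq: "A e * X = Y * A e" using XY e by (simp add: endo_def)
    have "(Y * Y) * A e = Y * (A e * X)" unfolding eq by (rule assoc_mult_mat[OF c(2) c(2) Ae])
    also have "\<dots> = (Y * A e) * X" by (rule assoc_mult_mat[OF c(2) Ae c(1), symmetric])
    also have "\<dots> = A e * (X * X)" unfolding eq[symmetric] by (rule assoc_mult_mat[OF Ae c(1) c(1)])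
    also have "\<dots> = Y * A e" unfolding X by (rule eq)
    finally have "(Y * Y) * A e = Y * A e" .
    moreover have "(Y * Y - Y) * A e = (Y * Y) * A e - Y * A e"
      by (rule minus_mult_distrib_mat[OF mult_carrier_mat[OF c(2) c(2)] c(2) Ae])
    ultimately show ?thesis using c(2) Ae by (auto intro!: eq_matI)
  qed
  moreover have YY: "Y * Y - Y \<in> carrier_mat q q" using c(2) by (simp add: minus_carrier_mat)
  ultimately have z: "Y * Y - Y = 0\<^sub>m q q"
    using surj unfolding jointly_surjective_def by blast
  show ?thesis
  proof (rule eq_matI)
    fix i j assume "i < dim_row Y" "j < dim_col Y"
    then have ij: "i < q" "j < q" using c by auto
    have "(Y * Y - Y) $$ (i, j) = 0" unfolding z using ij by simp
    then show "(Y * Y) $$ (i, j) = Y $$ (i, j)" using ij c by simp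
  qed (use c in auto)
qed

lemma reflect_indecomposable:
  fixes A :: "'a \<Rightarrow> 'k::field mat"
  assumes fin: "finite E" and A: "indecomposable_tuple E p q A" and p: "p > 0"
  obtains c and B :: "'a \<Rightarrow> 'k mat" where "q + c = card E * p" "indecomposable_tuple E c p B"
proof -
  have tA: "is_tuple E p q A" using A by (simp add: indecomposable_tuple_def)
  have surj: "jointly_surjective E q A p" by (rule indecomposable_jointly_surjective[OF A p])
  obtain c and B :: "'a \<Rightarrow> 'k mat" where B: "q + c = card E * p" "is_tuple E c p B"
    "\<forall>Z X. endo E c p B Z X \<longrightarrow> (\<exists>Y. endo E p q A X Y)"
    "\<forall>Z \<in> carrier_mat c c. \<forall>Z' \<in> carrier_mat c c. (\<forall>e\<in>E. B e * Z = B e * Z') \<longrightarrow> Z = Z'"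
    by (rule reflect_tuple[OF fin tA surj])
  note cancel = B(4)[rule_format]
  have "indecomposable_tuple E c p B"
    unfolding indecomposable_tuple_def
  proof (intro conjI allI impI)
    show "is_tuple E c p B" "c + p > 0" using B p by auto
    fix Z X assume ZX: "endo E c p B Z X \<and> Z * Z = Z \<and> X * X = X"
    then obtain Y where Y: "endo E p q A X Y" using B(3) by blast
    have "Y * Y = Y" using idempotent_lift[OF tA surj Y] ZX by simp
    then have cases: "X = 0\<^sub>m p p \<or> X = 1\<^sub>m p"
      using A Y ZX unfolding indecomposable_tuple_def by blast
    have eq: "B e * Z = X * B e" if "e \<in> E" for e
      using ZX that by (auto simp: endo_def)
    have Zc: "Z \<in> carrier_mat c c" using ZX by (simp add: endo_def)
    have Be: "B e \<in> carrier_mat p c" if "e \<in> E" for e using B(2) that by (simp add: is_tuple_def)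
    from cases show "Z = 0\<^sub>m c c \<and> X = 0\<^sub>m p p \<or> Z = 1\<^sub>m c \<and> X = 1\<^sub>m p"
    proof
      assume X: "X = 0\<^sub>m p p"
      have "Z = 0\<^sub>m c c"
      proof (rule cancel)
        fix e assume e: "e \<in> E"
        show "B e * Z = B e * 0\<^sub>m c c" unfolding eq[OF e] X using Be[OF e] by simp
      qed (use Zc in auto)
      then show ?thesis using X by simp
    next
      assume X: "X = 1\<^sub>m p"
      have "Z = 1\<^sub>m c"
      proof (rule cancel)
        fix e assume e: "e \<in> E"
        show "B e * Z = B e * 1\<^sub>m c" unfolding eq[OF e] X using Be[OF e] by simp
      qed (use Zc in auto)
      then show ?thesis using X by simp
    qed
  qed
  then show ?thesis by (rule that[OF B(1)])
qed

lemma reflect_brick: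
  fixes A :: "'a \<Rightarrow> 'k::field mat"
  assumes fin: "finite E" and A: "brick E p q A" and p: "p > 0"
  obtains c and B :: "'a \<Rightarrow> 'k mat" where "q + c = card E * p" "brick E c p B"
proof -
  have tA: "is_tuple E p q A" using A by (simp add: brick_def)
  have surj: "jointly_surjective E q A p"
    by (rule indecomposable_jointly_surjective[OF brick_imp_indecomposable[OF A] p])
  obtain c and B :: "'a \<Rightarrow> 'k mat" where B: "q + c = card E * p" "is_tuple E c p B"
    "\<forall>Z X. endo E c p B Z X \<longrightarrow> (\<exists>Y. endo E p q A X Y)"
    "\<forall>Z \<in> carrier_mat c c. \<forall>Z' \<in> carrier_mat c c. (\<forall>e\<in>E. B e * Z = B e * Z') \<longrightarrow> Z = Z'"
    by (rule reflect_tuple[OF fin tA surj])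
  note cancel = B(4)[rule_format]
  have "brick E c p B"
    unfolding brick_def
  proof (intro conjI allI impI)
    show "is_tuple E c p B" "c + p > 0" using B p by auto
    fix Z X assume ZX: "endo E c p B Z X"
    then obtain Y where Y: "endo E p q A X Y" using B(3) by blast
    then obtain l where X: "X = l \<cdot>\<^sub>m 1\<^sub>m p" using A unfolding brick_def by blast
    have Zc: "Z \<in> carrier_mat c c" using ZX by (simp add: endo_def)
    have "Z = l \<cdot>\<^sub>m 1\<^sub>m c"
    proof (rule cancel)
      fix e assume e: "e \<in> E"
      have Be: "B e \<in> carrier_mat p c" using B(2) e by (simp add: is_tuple_def)
      have "B e * Z = X * B e" using ZX e by (simp add: endo_def)
      also have "\<dots> = l \<cdot>\<^sub>m B e" unfolding X using Be by (simp add: mult_smult_assoc_mat[of _ p p])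
      also have "\<dots> = B e * (l \<cdot>\<^sub>m 1\<^sub>m c)" using Be by (simp add: mult_smult_distrib[OF Be one_carrier_mat])
      finally show "B e * Z = B e * (l \<cdot>\<^sub>m 1\<^sub>m c)" .
    qed (use Zc in auto)
    then show "\<exists>l. Z = l \<cdot>\<^sub>m 1\<^sub>m c \<and> X = l \<cdot>\<^sub>m 1\<^sub>m p" using X by blast
  qed
  then show ?thesis by (rule that[OF B(1)])
qed

lemma endo_transpose:
  assumes A: "is_tuple E p q A" and XY: "endo E q p (\<lambda>e. transpose_mat (A e)) X Y"
  shows "endo E p q A (transpose_mat Y) (transpose_mat X)"
  unfolding endo_def
proof (intro conjI ballI)
  have c: "X \<in> carrier_mat q q" "Y \<in> carrier_mat p p" using XY by (auto simp: endo_def)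
  then show "transpose_mat Y \<in> carrier_mat p p" "transpose_mat X \<in> carrier_mat q q" by auto
  fix e assume e: "e \<in> E"
  have Ae: "A e \<in> carrier_mat q p" using A e by (simp add: is_tuple_def)
  then have At: "transpose_mat (A e) \<in> carrier_mat p q" by simp
  have "transpose_mat (transpose_mat (A e) * X) = transpose_mat (Y * transpose_mat (A e))"
    using XY e by (simp add: endo_def)
  then show "A e * transpose_mat Y = transpose_mat X * A e"
    unfolding transpose_mult[OF At c(1)] transpose_mult[OF c(2) At] by simp
qed

lemma transpose_eq_iff: "transpose_mat X = Y \<longleftrightarrow> X = transpose_mat Y"
  by auto

lemma transpose_smult_one: "transpose_mat (c \<cdot>\<^sub>m 1\<^sub>m n) = c \<cdot>\<^sub>m 1\<^sub>m n"
  by (auto intro!: eq_matI)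

lemma is_tuple_transpose: "is_tuple E p q A \<Longrightarrow> is_tuple E q p (\<lambda>e. transpose_mat (A e))"
  by (auto simp: is_tuple_def)

lemma transpose_indecomposable:
  assumes A: "indecomposable_tuple E p q A"
  shows "indecomposable_tuple E q p (\<lambda>e. transpose_mat (A e))"
  unfolding indecomposable_tuple_def
proof (intro conjI allI impI)
  have tA: "is_tuple E p q A" using A by (simp add: indecomposable_tuple_def)
  then show "is_tuple E q p (\<lambda>e. transpose_mat (A e))" by (rule is_tuple_transpose)
  show "q + p > 0" using A by (auto simp: indecomposable_tuple_def)
  fix X Y assume XY: "endo E q p (\<lambda>e. transpose_mat (A e)) X Y \<and> X * X = X \<and> Y * Y = Y"
  then have c: "X \<in> carrier_mat q q" "Y \<in> carrier_mat p p" by (auto simp: endo_def)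
  have "transpose_mat Y * transpose_mat Y = transpose_mat Y" "transpose_mat X * transpose_mat X = transpose_mat X"
    using transpose_mult[OF c(1) c(1)] transpose_mult[OF c(2) c(2)] XY by simp_all
  then have "transpose_mat Y = 0\<^sub>m p p \<and> transpose_mat X = 0\<^sub>m q q \<or>
      transpose_mat Y = 1\<^sub>m p \<and> transpose_mat X = 1\<^sub>m q"
    using A endo_transpose[OF tA, of X Y] XY unfolding indecomposable_tuple_def by blast
  then show "X = 0\<^sub>m q q \<and> Y = 0\<^sub>m p p \<or> X = 1\<^sub>m q \<and> Y = 1\<^sub>m p"
    by (auto simp: transpose_eq_iff)
qed

lemma transpose_brick:
  assumes A: "brick E p q A"
  shows "brick E q p (\<lambda>e. transpose_mat (A e))"
  unfolding brick_def
proof (intro conjI allI impI)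
  have tA: "is_tuple E p q A" using A by (simp add: brick_def)
  then show "is_tuple E q p (\<lambda>e. transpose_mat (A e))" by (rule is_tuple_transpose)
  show "q + p > 0" using A by (auto simp: brick_def)
  fix X Y assume XY: "endo E q p (\<lambda>e. transpose_mat (A e)) X Y"
  then obtain c where "transpose_mat Y = c \<cdot>\<^sub>m 1\<^sub>m p" "transpose_mat X = c \<cdot>\<^sub>m 1\<^sub>m q"
    using A endo_transpose[OF tA XY] unfolding brick_def by blast
  then show "\<exists>c. X = c \<cdot>\<^sub>m 1\<^sub>m q \<and> Y = c \<cdot>\<^sub>m 1\<^sub>m p"
    by (intro exI[of _ c]) (simp add: transpose_eq_iff transpose_smult_one)
qed

definition tits :: "nat \<Rightarrow> nat \<Rightarrow> nat \<Rightarrow> int" where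
  "tits n p q = (int p)\<^sup>2 + (int q)\<^sup>2 - int n * int p * int q"

lemma tits_commute: "tits n p q = tits n q p"
  by (simp add: tits_def algebra_simps)

lemma tits_reflect:
  assumes "q + c = n * p"
  shows "tits n c p = tits n p q"
proof -
  have "int c = int n * int p - int q"
    using assms by (metis add_diff_cancel_left' of_nat_add of_nat_mult)
  show ?thesis unfolding tits_def \<open>int c = _\<close> by (simp add: power2_eq_square algebra_simps)
qed

text \<open>A decomposition of \<open>k\<^sup>q\<close> is a decomposition of the tuple if the other space is zero.\<close>

lemma indecomposable_one_vertex:
  assumes "indecomposable_tuple E 0 q (A :: 'a \<Rightarrow> 'k::field mat)"
  shows "q = 1"
proof (rule ccontr)
  assume "q \<noteq> 1"
  then have q: "q > 1" using assms by (auto simp: indecomposable_tuple_def)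
  define F where "F = mat q q (\<lambda>(i, j). if i = 0 \<and> j = 0 then 1 else 0 :: 'k)"
  have F: "F \<in> carrier_mat q q" by (simp add: F_def)
  have "F * F = F"
  proof (rule eq_matI)
    fix i j assume "i < dim_row F" "j < dim_col F"
    then have ij: "i < q" "j < q" using F by auto
    have "(F * F) $$ (i, j) = (\<Sum>l<q. if l = 0 then F $$ (i, j) else 0)"
      unfolding mult_mat_entry[OF F F ij] using ij q by (intro sum.cong) (auto simp: F_def)
    then show "(F * F) $$ (i, j) = F $$ (i, j)" using q by simp
  qed (use F in auto)
  moreover have "endo E 0 q A (0\<^sub>m 0 0) F"
    using assms F by (auto simp: endo_def indecomposable_tuple_def is_tuple_def intro!: eq_matI)
  moreover have "0\<^sub>m 0 0 * 0\<^sub>m 0 0 = (0\<^sub>m 0 0 :: 'k mat)" by simp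
  ultimately have "F = 0\<^sub>m q q \<or> F = 1\<^sub>m q"
    using assms unfolding indecomposable_tuple_def by blast
  moreover have "F $$ (0, 0) = 1" "F $$ (1, 1) = 0" using q by (auto simp: F_def)
  ultimately show False using q by auto
qed

text \<open>
  This is Kac's theorem on real roots for two vertices. As long as both spaces are nonzero, a
  reflection at the vertex with the larger space preserves indecomposability and the form and lowers
  the total dimension. The reflection at the source is the reflection at the sink of the transpose.
\<close>

lemma indecomposable_tits:
  fixes A :: "'a \<Rightarrow> 'k::field mat"
  assumes "finite E" "indecomposable_tuple E p q A" "tits (card E) p q > 0"
  shows "tits (card E) p q = 1"
  using assms(2,3)
proof (induction "p + q" arbitrary: p q A rule: less_induct)
  case less
  have main: "tits (card E) p q = 1"
    if A: "indecomposable_tuple E p q A" and t: "tits (card E) p q > 0" and pq: "p \<le> q"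
      and IH: "\<And>p' q' (A' :: 'a \<Rightarrow> 'k mat). p' + q' < p + q \<Longrightarrow> indecomposable_tuple E p' q' A' \<Longrightarrow>
        tits (card E) p' q' > 0 \<Longrightarrow> tits (card E) p' q' = 1" for p q and A :: "'a \<Rightarrow> 'k mat"
  proof (cases "p = 0")
    case True
    then have "q = 1" using indecomposable_one_vertex A by blast
    then show ?thesis using True by (simp add: tits_def)
  next
    case False
    then obtain c and B :: "'a \<Rightarrow> 'k mat" where B: "q + c = card E * p" "indecomposable_tuple E c p B"
      using reflect_indecomposable[OF assms(1) A] by blast
    have "int (card E) * int p - int q < int q"
      by (rule tits_descent) (use t pq False in \<open>auto simp: tits_def algebra_simps\<close>)
    moreover have "int c = int (card E) * int p - int q"
      using B(1) by (metis add_diff_cancel_left' of_nat_add of_nat_mult)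
    ultimately have "c + p < p + q" by linarith
    then show ?thesis using IH[of c p B] B t by (simp add: tits_reflect)
  qed
  show ?case
  proof (cases "p \<le> q")
    case True
    show ?thesis
      by (rule main[OF less.prems True]) (rule less.hyps)
  next
    case False
    have "tits (card E) q p = 1"
    proof (rule main[OF transpose_indecomposable[OF less.prems(1)]])
      show "tits (card E) q p > 0" using less.prems(2) by (simp add: tits_commute)
      show "q \<le> p" using False by simp
      show "tits (card E) p' q' = 1"
        if "p' + q' < q + p" "indecomposable_tuple E p' q' A'" "tits (card E) p' q' > 0"
        for p' q' and A' :: "'a \<Rightarrow> 'k mat"
        using that less.hyps[of p' q' A'] by (simp add: add.commute)
    qed
    then show ?thesis by (simp add: tits_commute)
  qed
qed

lemma brick_zero_one:
  "\<exists>A :: 'a \<Rightarrow> 'k::field mat. brick E 0 1 A"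
proof (intro exI[of _ "\<lambda>_. 0\<^sub>m 1 0"])
  have "\<exists>c. X = c \<cdot>\<^sub>m 1\<^sub>m 0 \<and> Y = c \<cdot>\<^sub>m 1\<^sub>m 1"
    if "X \<in> carrier_mat 0 0" "Y \<in> carrier_mat 1 1" for X Y :: "'k mat"
    using that by (intro exI[of _ "Y $$ (0, 0)"]) (auto intro!: eq_matI)
  then show "brick E 0 1 (\<lambda>_. 0\<^sub>m 1 0 :: 'k mat)"
    by (auto simp: brick_def is_tuple_def endo_def)
qed

text \<open>
  The same reflections in the opposite direction, starting from a one-dimensional space. The
  reflection at the sink leads from \<open>(p, c)\<close> with \<open>c = n p - q\<close> to \<open>(q, p)\<close>, and the transpose to
  \<open>(p, q)\<close>.
\<close>

lemma brick_exists:
  assumes "finite E" "tits (card E) p q = 1"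
  shows "\<exists>A :: 'a \<Rightarrow> 'k::field mat. brick E p q A"
  using assms(2)
proof (induction "p + q" arbitrary: p q rule: less_induct)
  case less
  have main: "\<exists>A :: 'a \<Rightarrow> 'k mat. brick E p q A"
    if t: "tits (card E) p q = 1" and pq: "p \<le> q"
      and IH: "\<And>p' q'. p' + q' < p + q \<Longrightarrow> tits (card E) p' q' = 1 \<Longrightarrow>
        \<exists>A :: 'a \<Rightarrow> 'k mat. brick E p' q' A" for p q
  proof (cases "p = 0")
    case True
    then have "(int q)\<^sup>2 = 1" using t by (simp add: tits_def)
    then have "q = 1" by (simp add: power2_eq_1_iff)
    then show ?thesis using True brick_zero_one by blast
  next
    case False
    define d where "d = int (card E) * int p - int q"
    have "d < int q"
      unfolding d_def by (rule tits_descent) (use t pq False in \<open>auto simp: tits_def algebra_simps\<close>)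
    have "d * int q = (int p)\<^sup>2 - 1"
      using t by (simp add: d_def tits_def algebra_simps power2_eq_square)
    moreover have "(int p)\<^sup>2 \<ge> 1" using False by simp
    ultimately have "d * int q \<ge> 0" by linarith
    moreover have "int q > 0" using pq False by simp
    ultimately have "d \<ge> 0" by (simp add: zero_le_mult_iff)
    define c where "c = nat d"
    have c: "q + c = card E * p"
    proof -
      have "int (q + c) = int (card E * p)" using \<open>d \<ge> 0\<close> by (simp add: c_def d_def)
      then show ?thesis by (simp only: of_nat_eq_iff)
    qed
    have "tits (card E) p c = 1" using tits_reflect[OF c] t tits_commute by simp
    moreover have "p + c < p + q" using \<open>d < int q\<close> \<open>d \<ge> 0\<close> by (simp add: c_def)
    ultimately obtain C :: "'a \<Rightarrow> 'k mat" where C: "brick E p c C" using IH by blast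
    obtain c' and B :: "'a \<Rightarrow> 'k mat" where B: "c + c' = card E * p" "brick E c' p B"
      using reflect_brick[OF assms(1) C] False by blast
    then have "c' = q" using c by simp
    then show ?thesis using transpose_brick[OF B(2)] by (intro exI) simp
  qed
  show ?case
  proof (cases "p \<le> q")
    case True
    show ?thesis by (rule main[OF less.prems True]) (rule less.hyps)
  next
    case False
    have "\<exists>A :: 'a \<Rightarrow> 'k mat. brick E q p A"
    proof (rule main)
      show "tits (card E) q p = 1" using less.prems by (simp add: tits_commute)
      show "q \<le> p" using False by simp
      show "\<exists>A :: 'a \<Rightarrow> 'k mat. brick E p' q' A"
        if "p' + q' < q + p" "tits (card E) p' q' = 1" for p' q'
        using that less.hyps[of p' q'] by (simp add: add.commute)
    qed
    then show ?thesis using transpose_brick by blast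
  qed
qed

section \<open>Self-extensions of tuples\<close>

definition rigid_tuple :: "'a set \<Rightarrow> nat \<Rightarrow> nat \<Rightarrow> ('a \<Rightarrow> 'k::field mat) \<Rightarrow> bool" where
  "rigid_tuple E p q A \<longleftrightarrow> (\<forall>C. is_tuple E p q C \<longrightarrow>
    (\<exists>X \<in> carrier_mat p p. \<exists>Y \<in> carrier_mat q q. \<forall>e\<in>E. C e = A e * X - Y * A e))"

text \<open>
  The map \<open>(X, Y) \<mapsto> (A\<^sub>e X - Y A\<^sub>e)\<^sub>e\<close> as a system of linear
  equations: its kernel is the endomorphism ring and its cokernel is \<open>Ext\<^sup>1\<close>.
\<close>

definition ext_unknowns :: "nat \<Rightarrow> nat \<Rightarrow> (nat \<times> nat + nat \<times> nat) set" where
  "ext_unknowns p q = ({..<p} \<times> {..<p}) <+> ({..<q} \<times> {..<q})"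

fun ext_coeff :: "('a \<Rightarrow> 'k::field mat) \<Rightarrow> 'a \<times> nat \<times> nat \<Rightarrow> nat \<times> nat + nat \<times> nat \<Rightarrow> 'k" where
  "ext_coeff A (e, r, s) (Inl (k, l)) = (if l = s then A e $$ (r, k) else 0)"
| "ext_coeff A (e, r, s) (Inr (k, l)) = (if k = r then - A e $$ (l, s) else 0)"

lemma ext_system:
  assumes Ae: "A e \<in> carrier_mat q p" and rs: "r < q" "s < p"
  shows "(\<Sum>i\<in>ext_unknowns p q. ext_coeff A (e, r, s) i * x i) =
    (A e * mat p p (\<lambda>(k, l). x (Inl (k, l))) - mat q q (\<lambda>(k, l). x (Inr (k, l))) * A e) $$ (r, s)"
proof -
  define X Y where "X = mat p p (\<lambda>(k, l). x (Inl (k, l)))" and "Y = mat q q (\<lambda>(k, l). x (Inr (k, l)))"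
  have XY: "X \<in> carrier_mat p p" "Y \<in> carrier_mat q q" by (simp_all add: X_def Y_def)
  have "(\<Sum>i\<in>ext_unknowns p q. ext_coeff A (e, r, s) i * x i) =
      (\<Sum>k<p. \<Sum>l<p. ext_coeff A (e, r, s) (Inl (k, l)) * x (Inl (k, l))) +
      (\<Sum>k<q. \<Sum>l<q. ext_coeff A (e, r, s) (Inr (k, l)) * x (Inr (k, l)))"
    by (simp add: ext_unknowns_def sum.Plus sum.cartesian_product comp_def case_prod_unfold
        del: ext_coeff.simps)
  also have "(\<Sum>k<p. \<Sum>l<p. ext_coeff A (e, r, s) (Inl (k, l)) * x (Inl (k, l))) =
      (\<Sum>k<p. \<Sum>l<p. if l = s then A e $$ (r, k) * x (Inl (k, l)) else 0)"
    by (intro sum.cong refl) auto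
  also have "\<dots> = (\<Sum>k<p. A e $$ (r, k) * X $$ (k, s))"
    using rs by (intro sum.cong refl) (simp add: X_def)
  also have "(\<Sum>k<q. \<Sum>l<q. ext_coeff A (e, r, s) (Inr (k, l)) * x (Inr (k, l))) =
      (\<Sum>k<q. if k = r then (\<Sum>l<q. - A e $$ (l, s) * x (Inr (k, l))) else 0)"
    by (intro sum.cong refl) auto
  also have "\<dots> = - (\<Sum>l<q. Y $$ (r, l) * A e $$ (l, s))"
    using rs by (simp add: Y_def sum_negf mult.commute)
  finally show ?thesis
    unfolding X_def[symmetric] Y_def[symmetric]
    using mult_mat_entry[OF Ae XY(1) rs] mult_mat_entry[OF XY(2) Ae rs] rs Ae XY by simp
qed

lemma ext_unknowns_card: "finite (ext_unknowns p q)" "card (ext_unknowns p q) = p * p + q * q"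
  by (simp_all add: ext_unknowns_def card_Plus card_cartesian_product)

text \<open>
  The system is solvable for every right hand side and has the identity in its kernel, so it has more
  unknowns than equations.
\<close>

lemma rigid_tuple_tits:
  fixes A :: "'a \<Rightarrow> 'k::field mat"
  assumes fin: "finite E" and A: "is_tuple E p q A" and rigid: "rigid_tuple E p q A" and pq: "p + q > 0"
  shows "tits (card E) p q > 0"
proof -
  define J where "J = E \<times> {..<q} \<times> {..<p}"
  have Ae: "A e \<in> carrier_mat q p" if "e \<in> E" for e using A that by (simp add: is_tuple_def)
  have finJ: "finite J" using fin by (simp add: J_def)
  have "card J < card (ext_unknowns p q)"
  proof (rule surjective_with_kernel_card[OF finJ ext_unknowns_card(1)])
    fix w :: "'a \<times> nat \<times> nat \<Rightarrow> 'k"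
    have "is_tuple E p q (\<lambda>e. mat q p (\<lambda>(r, s). w (e, r, s)))" by (simp add: is_tuple_def)
    then obtain X Y where XY: "X \<in> carrier_mat p p" "Y \<in> carrier_mat q q"
      "\<forall>e\<in>E. mat q p (\<lambda>(r, s). w (e, r, s)) = A e * X - Y * A e"
      using rigid unfolding rigid_tuple_def by blast
    define x where "x i = (case i of Inl (k, l) \<Rightarrow> X $$ (k, l) | Inr (k, l) \<Rightarrow> Y $$ (k, l))" for i
    have XY_x: "mat p p (\<lambda>(k, l). x (Inl (k, l))) = X" "mat q q (\<lambda>(k, l). x (Inr (k, l))) = Y"
      using XY by (auto simp: x_def intro!: eq_matI)
    have "(\<Sum>i\<in>ext_unknowns p q. ext_coeff A j i * x i) = w j" if jJ: "j \<in> J" for j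
    proof -
      obtain e r s where j: "j = (e, r, s)" "e \<in> E" "r < q" "s < p" using jJ by (auto simp: J_def)
      have "(\<Sum>i\<in>ext_unknowns p q. ext_coeff A j i * x i) = (A e * X - Y * A e) $$ (r, s)"
        unfolding j(1) ext_system[where A = A, OF Ae[OF j(2)] j(3,4)] XY_x ..
      also have "A e * X - Y * A e = mat q p (\<lambda>(r, s). w (e, r, s))" using XY(3) j(2) by simp
      also have "mat q p (\<lambda>(r, s). w (e, r, s)) $$ (r, s) = w j" using j by simp
      finally show ?thesis .
    qed
    then show "\<exists>x. \<forall>j\<in>J. (\<Sum>i\<in>ext_unknowns p q. ext_coeff A j i * x i) = w j"
      by (intro exI[of _ x]) simp
  next
    define u :: "nat \<times> nat + nat \<times> nat \<Rightarrow> 'k"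
      where "u i = (case i of Inl (k, l) \<Rightarrow> (if k = l then 1 else 0) | Inr (k, l) \<Rightarrow> (if k = l then 1 else 0))" for i
    have u: "mat p p (\<lambda>(k, l). u (Inl (k, l))) = 1\<^sub>m p" "mat q q (\<lambda>(k, l). u (Inr (k, l))) = 1\<^sub>m q"
      by (auto simp: u_def intro!: eq_matI)
    show "\<exists>i\<in>ext_unknowns p q. u i \<noteq> 0"
    proof (cases "p > 0")
      case True
      then show ?thesis by (intro bexI[of _ "Inl (0, 0)"]) (auto simp: u_def ext_unknowns_def)
    next
      case False
      then show ?thesis using pq by (intro bexI[of _ "Inr (0, 0)"]) (auto simp: u_def ext_unknowns_def)
    qed
    show "\<forall>j\<in>J. (\<Sum>i\<in>ext_unknowns p q. ext_coeff A j i * u i) = 0"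
    proof
      fix j assume "j \<in> J"
      then obtain e r s where j: "j = (e, r, s)" "e \<in> E" "r < q" "s < p" by (auto simp: J_def)
      show "(\<Sum>i\<in>ext_unknowns p q. ext_coeff A j i * u i) = 0"
        unfolding j(1) ext_system[where A = A, OF Ae[OF j(2)] j(3,4)] u using Ae[OF j(2)] j by simp
    qed
  qed
  then have "card E * (q * p) < p * p + q * q"
    by (simp add: ext_unknowns_card J_def card_cartesian_product)
  then have "int (card E * (q * p)) < int (p * p + q * q)" by (simp only: of_nat_less_iff)
  then show ?thesis by (simp add: tits_def power2_eq_square algebra_simps)
qed

text \<open>
  The kernel of the system consists of the scalars, and the value of the form says that there is
  exactly one unknown more than there are equations.
\<close>

lemma brick_rigid:
  fixes A :: "'a \<Rightarrow> 'k::field mat"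
  assumes fin: "finite E" and A: "brick E p q A" and t: "tits (card E) p q = 1"
  shows "rigid_tuple E p q A"
  unfolding rigid_tuple_def
proof (intro allI impI)
  fix C :: "'a \<Rightarrow> 'k mat"
  assume C: "is_tuple E p q C"
  define J where "J = E \<times> {..<q} \<times> {..<p}"
  have Ae: "A e \<in> carrier_mat q p" if "e \<in> E" for e using A that by (simp add: brick_def is_tuple_def)
  have Ce: "C e \<in> carrier_mat q p" if "e \<in> E" for e using C that by (simp add: is_tuple_def)
  have finJ: "finite J" using fin by (simp add: J_def)
  have "int (p * p + q * q) = int (card E * (q * p) + 1)"
    using t by (simp add: tits_def power2_eq_square algebra_simps)
  then have card: "card (ext_unknowns p q) = card J + 1"
    unfolding of_nat_eq_iff by (simp add: ext_unknowns_card J_def card_cartesian_product)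
  define u :: "nat \<times> nat + nat \<times> nat \<Rightarrow> 'k"
    where "u i = (case i of Inl (k, l) \<Rightarrow> (if k = l then 1 else 0) | Inr (k, l) \<Rightarrow> (if k = l then 1 else 0))" for i
  define i0 :: "nat \<times> nat + nat \<times> nat" where "i0 = (if p > 0 then Inl (0, 0) else Inr (0, 0))"
  have i0: "i0 \<in> ext_unknowns p q" "u i0 \<noteq> 0"
    using A by (auto simp: i0_def ext_unknowns_def u_def brick_def)
  have "\<exists>x. \<forall>j\<in>J. (\<Sum>i\<in>ext_unknowns p q. ext_coeff A j i * x i) = (case j of (e, r, s) \<Rightarrow> C e $$ (r, s))"
  proof (rule one_dim_kernel_surjective[where u = u and a = "ext_coeff A", OF finJ ext_unknowns_card(1) card i0])
    fix x assume x: "\<forall>j\<in>J. (\<Sum>i\<in>ext_unknowns p q. ext_coeff A j i * x i) = 0"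
    define X Y where "X = mat p p (\<lambda>(k, l). x (Inl (k, l)))" and "Y = mat q q (\<lambda>(k, l). x (Inr (k, l)))"
    have "endo E p q A X Y"
      unfolding endo_def
    proof (intro conjI ballI)
      show "X \<in> carrier_mat p p" "Y \<in> carrier_mat q q" by (simp_all add: X_def Y_def)
      fix e assume e: "e \<in> E"
      show "A e * X = Y * A e"
      proof (rule eq_matI)
        fix r s assume "r < dim_row (Y * A e)" "s < dim_col (Y * A e)"
        then have rs: "r < q" "s < p" using Ae[OF e] by (auto simp: Y_def)
        have "(A e * X - Y * A e) $$ (r, s) = 0"
          using x e rs ext_system[where A = A and x = x, OF Ae[OF e] rs] by (auto simp: X_def Y_def J_def)
        then show "(A e * X) $$ (r, s) = (Y * A e) $$ (r, s)"
          using rs Ae[OF e] by (simp add: Y_def X_def)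
      qed (use Ae[OF e] in \<open>auto simp: X_def Y_def\<close>)
    qed
    then obtain c where c: "X = c \<cdot>\<^sub>m 1\<^sub>m p" "Y = c \<cdot>\<^sub>m 1\<^sub>m q" using A unfolding brick_def by blast
    have "x i = c * u i" if "i \<in> ext_unknowns p q" for i
    proof -
      have "x (Inl (k, l)) = X $$ (k, l)" if "k < p" "l < p" for k l using that by (simp add: X_def)
      moreover have "x (Inr (k, l)) = Y $$ (k, l)" if "k < q" "l < q" for k l using that by (simp add: Y_def)
      ultimately show ?thesis using that unfolding ext_unknowns_def c by (auto simp: u_def)
    qed
    then show "\<exists>c. \<forall>i\<in>ext_unknowns p q. x i = c * u i" by blast
  qed
  then obtain x where x: "\<forall>j\<in>J. (\<Sum>i\<in>ext_unknowns p q. ext_coeff A j i * x i) = (case j of (e, r, s) \<Rightarrow> C e $$ (r, s))"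
    by (elim exE)
  define X Y where "X = mat p p (\<lambda>(k, l). x (Inl (k, l)))" and "Y = mat q q (\<lambda>(k, l). x (Inr (k, l)))"
  have XY: "X \<in> carrier_mat p p" "Y \<in> carrier_mat q q" by (simp_all add: X_def Y_def)
  have "C e = A e * X - Y * A e" if e: "e \<in> E" for e
  proof (rule eq_matI)
    fix r s assume "r < dim_row (A e * X - Y * A e)" "s < dim_col (A e * X - Y * A e)"
    then have rs: "r < q" "s < p" using Ae[OF e] XY by auto
    then show "C e $$ (r, s) = (A e * X - Y * A e) $$ (r, s)"
      using x e ext_system[where A = A and x = x, OF Ae[OF e] rs] by (auto simp: J_def X_def Y_def)
  qed (use Ae[OF e] Ce[OF e] XY in auto)
  then show "\<exists>X\<in>carrier_mat p p. \<exists>Y\<in>carrier_mat q q. \<forall>e\<in>E. C e = A e * X - Y * A e"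
    using XY by blast
qed


section \<open>Idempotent matrices\<close>

lemma left_right_inverse_dims_le:
  fixes A :: "'k::field mat"
  assumes A: "A \<in> carrier_mat r p" and B: "B \<in> carrier_mat p r" and AB: "A * B = 1\<^sub>m r"
  shows "r \<le> p"
proof (rule ccontr)
  assume "\<not> r \<le> p"
  then obtain x where x: "\<exists>i\<in>{..<r}. x i \<noteq> 0" "\<forall>j\<in>{..<p}. (\<Sum>i<r. B $$ (j, i) * x i) = 0"
    using homogeneous_system_solution[of "{..<p}" "{..<r}" "\<lambda>j i. B $$ (j, i)"] by auto
  define X where "X = mat r 1 (\<lambda>(i, j). x i)"
  have X: "X \<in> carrier_mat r 1" by (simp add: X_def)
  have "B * X = 0\<^sub>m p 1"
  proof (rule eq_matI)
    fix j k assume "j < dim_row (0\<^sub>m p 1)" "k < dim_col (0\<^sub>m p 1)"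
    then have jk: "j < p" "k < 1" by auto
    show "(B * X) $$ (j, k) = 0\<^sub>m p 1 $$ (j, k)"
      unfolding mult_mat_entry[OF B X jk] using x(2) jk by (simp add: X_def)
  qed (use B X in auto)
  then have "(A * B) * X = 0\<^sub>m r 1" unfolding assoc_mult_mat[OF A B X] using A by simp
  then have "X = 0\<^sub>m r 1" unfolding AB using X by simp
  moreover obtain i where "i < r" "x i \<noteq> 0" using x(1) by auto
  then have "X $$ (i, 0) \<noteq> 0" by (simp add: X_def)
  ultimately show False using \<open>i < r\<close> by simp
qed

text \<open>
  The columns of \<open>U\<close> are a maximal independent set of columns of the idempotent matrix \<open>M\<close>. They
  are fixed by \<open>M = U V\<close>, so \<open>U (V U) = U\<close>, and \<open>U\<close> can be cancelled.
\<close>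

lemma idempotent_factorization:
  fixes M :: "'k::field mat"
  assumes M: "M \<in> carrier_mat n n" "M * M = M"
  obtains U V where "U \<in> carrier_mat n (vec_space.rank n M)" "V \<in> carrier_mat (vec_space.rank n M) n"
    "U * V = M" "V * U = 1\<^sub>m (vec_space.rank n M)"
proof -
  interpret vec_space "TYPE('k)" n .
  have "lin_indpt {}" using finite_lin_indpt2[of "{}"] by auto
  then have "\<exists>S. finite S \<and> maximal S (\<lambda>T. T \<subseteq> set (cols M) \<and> lin_indpt T) \<and> {} \<subseteq> S"
    by (intro maximal_exists_superset[of "set (cols M)"]) auto
  then obtain S where S: "maximal S (\<lambda>T. T \<subseteq> set (cols M) \<and> lin_indpt T)" by (elim exE conjE)
  have rank: "rank M = card S" by (rule rank_card_indpt[OF M(1) S])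
  have SM: "S \<subseteq> set (cols M)" and indpt: "lin_indpt S"
    by (rule S[unfolded maximal_def, THEN conjunct1, THEN conjunct1],
        rule S[unfolded maximal_def, THEN conjunct1, THEN conjunct2])
  have max: "T = S" if "S \<subseteq> T" "T \<subseteq> set (cols M)" "lin_indpt T" for T
    by (rule S[unfolded maximal_def, THEN conjunct2, THEN spec, THEN mp]) (intro conjI that)
  have finS: "finite S" using SM finite_subset by blast
  obtain us where us: "distinct us" "set us = S" using finite_distinct_list[OF finS] by blast
  have len: "length us = rank M" using us rank distinct_card by fastforce
  have Mc: "set (cols M) \<subseteq> carrier_vec n" using M(1) cols_dim by blast
  then have Sc: "S \<subseteq> carrier_vec n" using SM by blast
  define U where "U = mat_of_cols n us"
  have U: "U \<in> carrier_mat n (rank M)" using mat_of_cols_carrier(1)[of n us] unfolding U_def len .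
  have colsU: "cols U = us" unfolding U_def by (rule cols_mat_of_cols) (use us Sc in auto)
  have dU: "distinct (cols U)" "set (cols U) = S" using us colsU by auto
  have cancel: "z = 0\<^sub>v (rank M)" if "z \<in> carrier_vec (rank M)" "U *\<^sub>v z = 0\<^sub>v n" for z
  proof (rule ccontr)
    assume "z \<noteq> 0\<^sub>v (rank M)"
    from lin_depI[OF U that(1) this that(2) dU(1)] show False using indpt unfolding dU(2) by (rule notE[rotated])
  qed
  have comb: "\<exists>z \<in> carrier_vec (rank M). U *\<^sub>v z = x" if x: "x \<in> set (cols M)" for x
  proof -
    have xc: "x \<in> carrier_vec n" using x Mc by blast
    have "x \<in> span S"
    proof (cases "x \<in> S")
      case True
      then show ?thesis using in_own_span[OF Sc] by (rule subsetD[rotated])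
    next
      case False
      have "lin_dep (S \<union> {x})"
      proof (rule ccontr)
        assume "\<not> lin_dep (S \<union> {x})"
        then have "S \<union> {x} = S" using SM x by (intro max) auto
        then show False using False by auto
      qed
      then show ?thesis unfolding lin_dep_iff_in_span[OF Sc indpt xc False] .
    qed
    from finite_in_span[OF finS Sc this] obtain a where "lincomb a S = x" by (elim exE conjE)
    then have "U *\<^sub>v vec (rank M) (\<lambda>i. a (col U i)) = x"
      using mat_mult_eq_lincomb[OF U dU(1)] dU(2) by simp
    then show ?thesis by (intro bexI[of _ "vec (rank M) (\<lambda>i. a (col U i))"]) auto
  qed
  have set_cols: "set (cols A) = col A ` {..<dim_col A}" for A :: "'k mat"
    by (auto simp: cols_def)
  define z where "z j = (SOME z. z \<in> carrier_vec (rank M) \<and> U *\<^sub>v z = col M j)" for j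
  have z: "z j \<in> carrier_vec (rank M)" "U *\<^sub>v z j = col M j" if "j < n" for j
  proof -
    have "col M j \<in> set (cols M)" using that M(1) by (auto simp: set_cols)
    then have "\<exists>z. z \<in> carrier_vec (rank M) \<and> U *\<^sub>v z = col M j" using comb by blast
    then have "z j \<in> carrier_vec (rank M) \<and> U *\<^sub>v z j = col M j" unfolding z_def by (rule someI_ex)
    then show "z j \<in> carrier_vec (rank M)" "U *\<^sub>v z j = col M j" by auto
  qed
  define V where "V = mat (rank M) n (\<lambda>(i, j). z j $ i)"
  have V: "V \<in> carrier_mat (rank M) n" by (simp add: V_def)
  have colV: "col V j = z j" if "j < n" for j
    using z(1)[OF that] that by (intro eq_vecI) (auto simp: V_def)
  have UV: "U * V = M"
  proof (rule mat_col_eqI)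
    fix j assume "j < dim_col M"
    then have j: "j < n" using M by simp
    show "col (U * V) j = col M j" using col_mult2[OF U V j] colV z(2) j by simp
  qed (use U V M in auto)
  have MU: "M *\<^sub>v col U j = col U j" if j: "j < rank M" for j
  proof -
    have "col U j \<in> set (cols U)" using U j by (auto simp: set_cols)
    then have "col U j \<in> set (cols M)" using SM dU(2) by blast
    then obtain k where k: "k < n" "col U j = col M k"
      using M(1) by (auto simp: set_cols)
    have "col (M * M) k = M *\<^sub>v col M k" by (rule col_mult2[OF M(1) M(1) k(1)])
    then show ?thesis using k M(2) by simp
  qed
  have "V * U = 1\<^sub>m (rank M)"
  proof (rule mat_col_eqI)
    fix j assume "j < dim_col (1\<^sub>m (rank M))"
    then have j: "j < rank M" by simp
    define y where "y = col (V * U) j - unit_vec (rank M) j"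
    have c: "col (V * U) j \<in> carrier_vec (rank M)"
      unfolding carrier_vec_def mem_Collect_eq dim_col index_mult_mat(2) by (rule carrier_matD(1)[OF V])
    have cu: "col U j \<in> carrier_vec n"
      unfolding carrier_vec_def mem_Collect_eq dim_col by (rule carrier_matD(1)[OF U])
    have "U *\<^sub>v col (V * U) j = col U j"
      unfolding col_mult2[OF V U j] assoc_mult_mat_vec[OF U V cu, symmetric] UV by (rule MU[OF j])
    moreover have "U *\<^sub>v unit_vec (rank M) j = col U j" 
      using col_mult2[OF U one_carrier_mat j] U j by simp
    ultimately have "U *\<^sub>v y = 0\<^sub>v n"
      unfolding y_def using mult_minus_distrib_mat_vec[OF U c, of "unit_vec (rank M) j"] cu by simp
    then have "y = 0\<^sub>v (rank M)" using cancel c by (simp add: y_def)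
    then have y0: "y $ i = 0" if "i < rank M" for i using that by simp
    show "col (V * U) j = col (1\<^sub>m (rank M)) j"
    proof (rule eq_vecI)
      fix i assume "i < dim_vec (col (1\<^sub>m (rank M)) j)"
      then have i: "i < rank M" by simp
      have "col (V * U) j $ i - unit_vec (rank M) j $ i = 0"
        using y0[OF i] i unfolding y_def by (subst (asm) index_minus_vec) auto
      then show "col (V * U) j $ i = col (1\<^sub>m (rank M)) j $ i" using j i by (simp del: index_mult_mat index_col)
    qed (use V in auto)
  qed (use U V in auto)
  then show ?thesis using that U V UV by blast
qed

text \<open>
  The factorization of \<open>M\<close> through its rank is related to the given one by the matrices \<open>V' U\<close> and
  \<open>V U'\<close>, which are inverse to each other.
\<close>

lemma rank_eqI:
  fixes M :: "'k::field mat"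
  assumes U: "U \<in> carrier_mat n p" and V: "V \<in> carrier_mat p n" and UV: "U * V = M" and VU: "V * U = 1\<^sub>m p"
  shows "vec_space.rank n M = p"
proof -
  define r where "r = vec_space.rank n M"
  have M: "M \<in> carrier_mat n n" using U V UV by auto
  have "M * M = U * (V * (U * V))" unfolding UV[symmetric] by (rule assoc_mult_mat[OF U V mult_carrier_mat[OF U V]])
  also have "V * (U * V) = (V * U) * V" by (rule assoc_mult_mat[OF V U V, symmetric])
  finally have idem: "M * M = M" unfolding VU using V UV by simp
  obtain U' V' where W: "U' \<in> carrier_mat n r" "V' \<in> carrier_mat r n" "U' * V' = M" "V' * U' = 1\<^sub>m r"
    by (rule idempotent_factorization[OF M idem, folded r_def])
  have *: "(V' * U) * (V * U') = 1\<^sub>m r"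
    if "U \<in> carrier_mat n p" "V \<in> carrier_mat p n" "U' \<in> carrier_mat n r" "V' \<in> carrier_mat r n"
      "U * V = U' * V'" "V' * U' = 1\<^sub>m r" for U V U' V' :: "'k mat" and p r
  proof -
    note c = that(1-4)
    have "(V' * U) * (V * U') = V' * (U * (V * U'))"
      by (rule assoc_mult_mat[OF c(4) c(1) mult_carrier_mat[OF c(2) c(3)]])
    also have "U * (V * U') = (U * V) * U'" by (rule assoc_mult_mat[OF c(1) c(2) c(3), symmetric])
    also have "\<dots> = U' * (V' * U')" unfolding that(5) by (rule assoc_mult_mat[OF c(3) c(4) c(3)])
    finally show ?thesis unfolding that(6) using c that(6) by simp
  qed
  have "(V' * U) * (V * U') = 1\<^sub>m r" by (rule *[OF U V W(1,2) _ W(4)]) (simp add: UV W)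
  moreover have "(V * U') * (V' * U) = 1\<^sub>m p" by (rule *[OF W(1,2) U V _ VU]) (simp add: UV W)
  ultimately have "r \<le> p" "p \<le> r"
    using left_right_inverse_dims_le[of "V' * U" r p "V * U'"] left_right_inverse_dims_le[of "V * U'" p r "V' * U"]
      U V W by simp_all
  then show ?thesis by (simp add: r_def)
qed


section \<open>Modules over the path algebra\<close>

text \<open>
  The matrix laws with side conditions on dimensions only, which makes them usable as rewrite rules.
\<close>

lemma mat_assoc:
  "dim_col A = dim_row B \<Longrightarrow> dim_col B = dim_row C \<Longrightarrow> (A * B) * C = A * (B * (C :: 'k::field mat))"
  by (rule assoc_mult_mat[of A "dim_row A" "dim_row B" B "dim_row C" C "dim_col C"]) auto

lemma mat_add_distrib:
  fixes A B C :: "'k::field mat"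
  shows "dim_row B = dim_row C \<Longrightarrow> dim_col B = dim_col C \<Longrightarrow> dim_col A = dim_row B \<Longrightarrow> A * (B + C) = A * B + A * C"
    and "dim_row A = dim_row B \<Longrightarrow> dim_col A = dim_col B \<Longrightarrow> dim_col A = dim_row C \<Longrightarrow> (A + B) * C = A * C + B * C"
  by (rule mult_add_distrib_mat[of A "dim_row A" "dim_row C" B "dim_col C" C]; auto)
    (rule add_mult_distrib_mat[of A "dim_row B" "dim_row C" B C "dim_col C"]; auto)

lemma mat_minus_distrib:
  fixes A B C :: "'k::field mat"
  shows "dim_row B = dim_row C \<Longrightarrow> dim_col B = dim_col C \<Longrightarrow> dim_col A = dim_row B \<Longrightarrow> A * (B - C) = A * B - A * C"
    and "dim_row A = dim_row B \<Longrightarrow> dim_col A = dim_col B \<Longrightarrow> dim_col A = dim_row C \<Longrightarrow> (A - B) * C = A * C - B * C"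
  by (rule mult_minus_distrib_mat[of A "dim_row A" "dim_row C" B "dim_col C" C]; auto)
    (rule minus_mult_distrib_mat[of A "dim_row B" "dim_row C" B C "dim_col C"]; auto)

lemma mat_smult_mult:
  fixes A B :: "'k::field mat"
  shows "dim_col A = dim_row B \<Longrightarrow> A * (c \<cdot>\<^sub>m B) = c \<cdot>\<^sub>m (A * B)"
    and "dim_col A = dim_row B \<Longrightarrow> (c \<cdot>\<^sub>m A) * B = c \<cdot>\<^sub>m (A * B)"
  by (rule mult_smult_distrib[of A "dim_row A" "dim_row B" B "dim_col B"]; auto)
    (rule mult_smult_assoc_mat[of A "dim_row A" "dim_row B" B "dim_col B"]; auto)

lemma mat_dim_simps:
  fixes A :: "'k::field mat"
  shows "dim_row A = m \<Longrightarrow> 1\<^sub>m m * A = A" "dim_col A = m \<Longrightarrow> A * 1\<^sub>m m = A"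
    "dim_row A = m \<Longrightarrow> 0\<^sub>m k m * A = 0\<^sub>m k (dim_col A)" "dim_col A = m \<Longrightarrow> A * 0\<^sub>m m k = 0\<^sub>m (dim_row A) k"
    "dim_row A = m \<Longrightarrow> dim_col A = k \<Longrightarrow> 0\<^sub>m m k + A = A" "dim_row A = m \<Longrightarrow> dim_col A = k \<Longrightarrow> A + 0\<^sub>m m k = A"
  by (auto intro!: eq_matI)

lemma is_moduleD:
  fixes \<rho> :: "(('v, 'a) path \<Rightarrow> 'k::field) \<Rightarrow> 'k mat"
  assumes "is_module Q n \<rho>"
  shows "f \<in> carrier (path_algebra Q) \<Longrightarrow> \<rho> f \<in> carrier_mat n n"
    "f \<in> carrier (path_algebra Q) \<Longrightarrow> g \<in> carrier (path_algebra Q) \<Longrightarrow>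
      \<rho> (f \<otimes>\<^bsub>path_algebra Q\<^esub> g) = \<rho> f * \<rho> g"
    "f \<in> carrier (path_algebra Q) \<Longrightarrow> g \<in> carrier (path_algebra Q) \<Longrightarrow>
      \<rho> (\<lambda>x. f x + g x) = \<rho> f + \<rho> g"
    "\<rho> \<one>\<^bsub>path_algebra Q\<^esub> = 1\<^sub>m n"
    "f \<in> carrier (path_algebra Q) \<Longrightarrow> \<rho> (\<lambda>x. c * f x) = c \<cdot>\<^sub>m \<rho> f"
proof -
  have h: "\<rho> \<in> Ring.ring_hom (path_algebra Q) (ring_mat TYPE('k) n ())"
    using assms by (simp add: is_module_def)
  show "f \<in> carrier (path_algebra Q) \<Longrightarrow> \<rho> f \<in> carrier_mat n n"
    using ring_hom_closed[OF h] by (simp add: ring_mat_simps)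
  show "f \<in> carrier (path_algebra Q) \<Longrightarrow> g \<in> carrier (path_algebra Q) \<Longrightarrow>
      \<rho> (f \<otimes>\<^bsub>path_algebra Q\<^esub> g) = \<rho> f * \<rho> g"
    using ring_hom_mult[OF h] by (simp add: ring_mat_simps)
  show "f \<in> carrier (path_algebra Q) \<Longrightarrow> g \<in> carrier (path_algebra Q) \<Longrightarrow>
      \<rho> (\<lambda>x. f x + g x) = \<rho> f + \<rho> g"
    using ring_hom_add[OF h, of f g] by (simp add: ring_mat_simps path_algebra_def)
  show "\<rho> \<one>\<^bsub>path_algebra Q\<^esub> = 1\<^sub>m n"
    using ring_hom_one[OF h] by (simp add: ring_mat_simps)
  show "f \<in> carrier (path_algebra Q) \<Longrightarrow> \<rho> (\<lambda>x. c * f x) = c \<cdot>\<^sub>m \<rho> f"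
    using assms by (simp add: is_module_def)
qed

lemma is_moduleI:
  fixes \<rho> :: "(('v, 'a) path \<Rightarrow> 'k::field) \<Rightarrow> 'k mat"
  assumes "\<And>f. f \<in> carrier (path_algebra Q) \<Longrightarrow> \<rho> f \<in> carrier_mat n n"
    "\<And>f g. f \<in> carrier (path_algebra Q) \<Longrightarrow> g \<in> carrier (path_algebra Q) \<Longrightarrow>
      \<rho> (f \<otimes>\<^bsub>path_algebra Q\<^esub> g) = \<rho> f * \<rho> g"
    "\<And>f g. f \<in> carrier (path_algebra Q) \<Longrightarrow> g \<in> carrier (path_algebra Q) \<Longrightarrow>
      \<rho> (\<lambda>x. f x + g x) = \<rho> f + \<rho> g"
    "\<rho> \<one>\<^bsub>path_algebra Q\<^esub> = 1\<^sub>m n"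
    "\<And>c f. f \<in> carrier (path_algebra Q) \<Longrightarrow> \<rho> (\<lambda>x. c * f x) = c \<cdot>\<^sub>m \<rho> f"
  shows "is_module Q n \<rho>"
  unfolding is_module_def
proof (intro conjI allI ballI)
  show "\<rho> \<in> Ring.ring_hom (path_algebra Q) (ring_mat TYPE('k) n ())"
    by (rule ring_hom_memI) (use assms in \<open>simp_all add: ring_mat_simps\<close>, simp add: path_algebra_def assms)
qed (use assms in auto)

lemma one_minus_idempotent:
  fixes F :: "'k::field mat"
  assumes F: "F \<in> carrier_mat n n" "F * F = F"
  shows "(1\<^sub>m n - F) * (1\<^sub>m n - F) = 1\<^sub>m n - F"
proof -
  have "(1\<^sub>m n - F) * (1\<^sub>m n - F) = (1\<^sub>m n - F) - (F - F)"
    using F by (simp add: mat_minus_distrib)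
  then show ?thesis using F by (auto intro!: eq_matI)
qed

text \<open>
  The image of an idempotent endomorphism, as a module on \<open>k\<^sup>r\<close>: if \<open>F = U V\<close> with
  \<open>V U = 1\<close>, the element \<open>f\<close> acts by \<open>V \<rho>(f) U\<close>.
\<close>

lemma image_of_idempotent_is_module:
  fixes \<rho> :: "(('v, 'a) path \<Rightarrow> 'k::field) \<Rightarrow> 'k mat"
  assumes mod: "is_module Q n \<rho>" and U: "U \<in> carrier_mat n r" and V: "V \<in> carrier_mat r n"
    and VU: "V * U = 1\<^sub>m r"
    and comm: "\<And>f. f \<in> carrier (path_algebra Q) \<Longrightarrow> (U * V) * \<rho> f = \<rho> f * (U * V)"
  shows "is_module Q r (\<lambda>f. V * \<rho> f * U)"
    "\<And>f. f \<in> carrier (path_algebra Q) \<Longrightarrow> V * \<rho> f = (V * \<rho> f * U) * V"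
    "\<And>f. f \<in> carrier (path_algebra Q) \<Longrightarrow> \<rho> f * U = U * (V * \<rho> f * U)"
proof -
  note D = is_moduleD[OF mod]
  have d: "dim_row U = n" "dim_col U = r" "dim_row V = r" "dim_col V = n" using U V by auto
  have dr: "dim_row (\<rho> f) = n" "dim_col (\<rho> f) = n" if "f \<in> carrier (path_algebra Q)" for f
    using D(1)[OF that] by auto
  show l: "V * \<rho> f = (V * \<rho> f * U) * V" if f: "f \<in> carrier (path_algebra Q)" for f
  proof -
    have "(V * \<rho> f * U) * V = V * (\<rho> f * (U * V))" using d dr[OF f] by (simp add: mat_assoc)
    also have "\<dots> = (V * U) * (V * \<rho> f)" unfolding comm[OF f, symmetric] using d dr[OF f] by (simp add: mat_assoc)
    finally show ?thesis unfolding VU using d dr[OF f] D(1)[OF f] V by simp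
  qed
  show r: "\<rho> f * U = U * (V * \<rho> f * U)" if f: "f \<in> carrier (path_algebra Q)" for f
  proof -
    have "U * (V * \<rho> f * U) = ((U * V) * \<rho> f) * U" using d dr[OF f] by (simp add: mat_assoc)
    also have "\<dots> = (\<rho> f * U) * (V * U)" unfolding comm[OF f] using d dr[OF f] by (simp add: mat_assoc)
    finally show ?thesis unfolding VU using d dr[OF f] D(1)[OF f] U by simp
  qed
  show "is_module Q r (\<lambda>f. V * \<rho> f * U)"
  proof (rule is_moduleI)
    fix f g :: "('v, 'a) path \<Rightarrow> 'k"
    assume f: "f \<in> carrier (path_algebra Q)" and g: "g \<in> carrier (path_algebra Q)"
    have "(V * \<rho> f * U) * (V * \<rho> g * U) = ((V * \<rho> f * U) * V) * (\<rho> g * U)"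
      using d dr[OF f] dr[OF g] by (simp add: mat_assoc)
    also have "\<dots> = V * (\<rho> f * \<rho> g) * U"
      unfolding l[OF f, symmetric] using d dr[OF f] dr[OF g] by (simp add: mat_assoc)
    finally show "V * \<rho> (f \<otimes>\<^bsub>path_algebra Q\<^esub> g) * U = V * \<rho> f * U * (V * \<rho> g * U)"
      using D(2)[OF f g] by simp
    show "V * \<rho> (\<lambda>x. f x + g x) * U = V * \<rho> f * U + V * \<rho> g * U"
      unfolding D(3)[OF f g] using d dr[OF f] dr[OF g] by (simp add: mat_add_distrib)
  next
    fix f :: "('v, 'a) path \<Rightarrow> 'k" and c :: 'k
    assume f: "f \<in> carrier (path_algebra Q)"
    show "V * \<rho> (\<lambda>x. c * f x) * U = c \<cdot>\<^sub>m (V * \<rho> f * U)"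
      unfolding D(5)[OF f] using d dr[OF f] by (simp add: mat_smult_mult)
    show "V * \<rho> f * U \<in> carrier_mat r r" using d by (intro carrier_matI) auto
  next
    show "V * \<rho> \<one>\<^bsub>path_algebra Q\<^esub> * U = 1\<^sub>m r" unfolding D(4) using V VU by simp
  qed
qed

text \<open>
  The images of \<open>F\<close> and \<open>1 - F\<close> are submodules, and the two factorizations side by side form the
  isomorphism to their direct sum.
\<close>

lemma module_decomposes:
  fixes \<rho> :: "(('v, 'a) path \<Rightarrow> 'k::field) \<Rightarrow> 'k mat"
  assumes mod: "is_module Q n \<rho>" and F: "is_module_hom Q n \<rho> n \<rho> F" "F * F = F"
    "F \<noteq> 0\<^sub>m n n" "F \<noteq> 1\<^sub>m n"
  shows "\<not> indecomposable Q n \<rho>"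
proof -
  note D = is_moduleD[OF mod]
  have Fc: "F \<in> carrier_mat n n" and comm: "\<And>f. f \<in> carrier (path_algebra Q) \<Longrightarrow> F * \<rho> f = \<rho> f * F"
    using F(1) by (auto simp: is_module_hom_def)
  define F' where "F' = 1\<^sub>m n - F"
  have F'c: "F' \<in> carrier_mat n n" using Fc by (simp add: F'_def minus_carrier_mat)
  have F'id: "F' * F' = F'" unfolding F'_def by (rule one_minus_idempotent[OF Fc F(2)])
  have dr: "dim_row (\<rho> f) = n" "dim_col (\<rho> f) = n" if "f \<in> carrier (path_algebra Q)" for f
    using D(1)[OF that] by auto
  have comm': "F' * \<rho> f = \<rho> f * F'" if f: "f \<in> carrier (path_algebra Q)" for f
    using comm[OF f] dr[OF f] D(1)[OF f] Fc by (simp add: F'_def mat_minus_distrib)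
  obtain r U V where UV: "U \<in> carrier_mat n r" "V \<in> carrier_mat r n" "U * V = F" "V * U = 1\<^sub>m r"
    by (rule idempotent_factorization[OF Fc F(2)])
  obtain r' U' V' where UV': "U' \<in> carrier_mat n r'" "V' \<in> carrier_mat r' n" "U' * V' = F'" "V' * U' = 1\<^sub>m r'"
    by (rule idempotent_factorization[OF F'c F'id])
  note I = image_of_idempotent_is_module[OF mod UV(1,2,4), unfolded UV(3), OF comm]
  note I' = image_of_idempotent_is_module[OF mod UV'(1,2,4), unfolded UV'(3), OF comm']
  have d: "dim_row U = n" "dim_col U = r" "dim_row V = r" "dim_col V = n"
    "dim_row U' = n" "dim_col U' = r'" "dim_row V' = r'" "dim_col V' = n" using UV UV' by auto
  have FF': "F * F' = 0\<^sub>m n n" "F' * F = 0\<^sub>m n n"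
    using Fc F(2) by (auto simp: F'_def mat_minus_distrib)
  have z: "V * U' = 0\<^sub>m r r'"
  proof -
    have "V * U' = (V * U) * ((V * U') * (V' * U'))" unfolding UV UV' using UV UV' d by simp
    also have "\<dots> = V * ((U * V) * (U' * V')) * U'" using d by (simp add: mat_assoc)
    finally show ?thesis unfolding UV(3) UV'(3) FF' using UV UV' by simp
  qed
  have z': "V' * U = 0\<^sub>m r' r"
  proof -
    have "V' * U = (V' * U') * ((V' * U) * (V * U))" unfolding UV UV' using UV UV' d by simp
    also have "\<dots> = V' * ((U' * V') * (U * V)) * U" using d by (simp add: mat_assoc)
    finally show ?thesis unfolding UV(3) UV'(3) FF' using UV UV' by simp
  qed
  define \<rho>1 \<rho>2 where "\<rho>1 = (\<lambda>f. V * \<rho> f * U)" and "\<rho>2 = (\<lambda>f. V' * \<rho> f * U')"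
  define X where "X = four_block_mat V (0\<^sub>m r 0) V' (0\<^sub>m r' 0)"
  define Y where "Y = four_block_mat U U' (0\<^sub>m 0 r) (0\<^sub>m 0 r')"
  have Xc: "X \<in> carrier_mat (r + r') n" and Yc: "Y \<in> carrier_mat n (r + r')"
    using UV UV' by (auto simp: X_def Y_def)
  have XY: "X * Y = 1\<^sub>m (r + r')"
  proof -
    have "X * Y = four_block_mat (V * U + 0\<^sub>m r 0 * 0\<^sub>m 0 r) (V * U' + 0\<^sub>m r 0 * 0\<^sub>m 0 r')
        (V' * U + 0\<^sub>m r' 0 * 0\<^sub>m 0 r) (V' * U' + 0\<^sub>m r' 0 * 0\<^sub>m 0 r')"
      unfolding X_def Y_def by (rule mult_four_block_mat) (use UV UV' in auto)
    also have "\<dots> = four_block_mat (1\<^sub>m r) (0\<^sub>m r r') (0\<^sub>m r' r) (1\<^sub>m r')"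
      unfolding z z' UV(4) UV'(4) by simp
    finally show ?thesis by simp
  qed
  have YX: "Y * X = 1\<^sub>m n"
  proof -
    have "Y * X = four_block_mat (U * V + U' * V') (U * 0\<^sub>m r 0 + U' * 0\<^sub>m r' 0)
        (0\<^sub>m 0 r * V + 0\<^sub>m 0 r' * V') (0\<^sub>m 0 r * 0\<^sub>m r 0 + 0\<^sub>m 0 r' * 0\<^sub>m r' 0)"
      unfolding X_def Y_def by (rule mult_four_block_mat) (use UV UV' in auto)
    also have "U * V + U' * V' = 1\<^sub>m n"
      unfolding UV(3) UV'(3) F'_def using Fc by (auto intro!: eq_matI)
    finally show ?thesis using Fc d by (auto intro!: eq_matI)
  qed
  have rho_c: "\<rho>1 f \<in> carrier_mat r r" "\<rho>2 f \<in> carrier_mat r' r'" for f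
    unfolding \<rho>1_def \<rho>2_def using d by (auto intro!: carrier_matI)
  have homX: "is_module_hom Q n \<rho> (r + r') (direct_sum r \<rho>1 r' \<rho>2) X"
    unfolding is_module_hom_def
  proof (intro conjI ballI)
    fix f :: "('v, 'a) path \<Rightarrow> 'k"
    assume f: "f \<in> carrier (path_algebra Q)"
    \<comment> \<open>Padding by empty blocks makes \<open>\<rho> f\<close> a factor of the same block shape as \<open>X\<close>.\<close>
    have one: "four_block_mat (\<rho> f) (0\<^sub>m n 0) (0\<^sub>m 0 n) (0\<^sub>m 0 0) = \<rho> f"
      using dr[OF f] by (auto intro!: eq_matI)
    have "X * four_block_mat (\<rho> f) (0\<^sub>m n 0) (0\<^sub>m 0 n) (0\<^sub>m 0 0) =
        four_block_mat (V * \<rho> f + 0\<^sub>m r 0 * 0\<^sub>m 0 n) (V * 0\<^sub>m n 0 + 0\<^sub>m r 0 * 0\<^sub>m 0 0)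
          (V' * \<rho> f + 0\<^sub>m r' 0 * 0\<^sub>m 0 n) (V' * 0\<^sub>m n 0 + 0\<^sub>m r' 0 * 0\<^sub>m 0 0)"
      unfolding X_def by (rule mult_four_block_mat) (use UV UV' D(1)[OF f] in auto)
    moreover have "direct_sum r \<rho>1 r' \<rho>2 f * X =
        four_block_mat (\<rho>1 f * V + 0\<^sub>m r r' * V') (\<rho>1 f * 0\<^sub>m r 0 + 0\<^sub>m r r' * 0\<^sub>m r' 0)
          (0\<^sub>m r' r * V + \<rho>2 f * V') (0\<^sub>m r' r * 0\<^sub>m r 0 + \<rho>2 f * 0\<^sub>m r' 0)"
      unfolding X_def direct_sum_def
      by (rule mult_four_block_mat[OF rho_c(1) zero_carrier_mat zero_carrier_mat rho_c(2)]) (use UV UV' in auto)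
    moreover have "V * \<rho> f + 0\<^sub>m r 0 * 0\<^sub>m 0 n = \<rho>1 f * V + 0\<^sub>m r r' * V'"
    proof -
      have "V * \<rho> f + 0\<^sub>m r 0 * 0\<^sub>m 0 n = V * \<rho> f" using d dr[OF f] by (auto intro!: eq_matI)
      also have "\<dots> = \<rho>1 f * V" unfolding \<rho>1_def by (rule I(2)[OF _ f])
      also have "\<dots> = \<rho>1 f * V + 0\<^sub>m r r' * V'"
        using left_mult_zero_mat[OF UV'(2), of r] mult_carrier_mat[OF rho_c(1) UV(2)] by simp
      finally show ?thesis .
    qed
    moreover have "V' * \<rho> f + 0\<^sub>m r' 0 * 0\<^sub>m 0 n = 0\<^sub>m r' r * V + \<rho>2 f * V'"
    proof -
      have "V' * \<rho> f + 0\<^sub>m r' 0 * 0\<^sub>m 0 n = V' * \<rho> f" using d dr[OF f] by (auto intro!: eq_matI)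
      also have "\<dots> = \<rho>2 f * V'" unfolding \<rho>2_def by (rule I'(2)[OF _ f])
      also have "\<dots> = 0\<^sub>m r' r * V + \<rho>2 f * V'"
        using left_mult_zero_mat[OF UV(2), of r'] mult_carrier_mat[OF rho_c(2) UV'(2)] by simp
      finally show ?thesis .
    qed
    moreover have "V * 0\<^sub>m n 0 + 0\<^sub>m r 0 * 0\<^sub>m 0 0 = \<rho>1 f * 0\<^sub>m r 0 + 0\<^sub>m r r' * 0\<^sub>m r' 0"
      "V' * 0\<^sub>m n 0 + 0\<^sub>m r' 0 * 0\<^sub>m 0 0 = 0\<^sub>m r' r * 0\<^sub>m r 0 + \<rho>2 f * 0\<^sub>m r' 0"
      using d rho_c[of f] by (auto intro!: eq_matI)
    ultimately show "X * \<rho> f = direct_sum r \<rho>1 r' \<rho>2 f * X"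
      unfolding one by simp
  qed (rule Xc)
  have homY: "is_module_hom Q (r + r') (direct_sum r \<rho>1 r' \<rho>2) n \<rho> Y"
    unfolding is_module_hom_def
  proof (intro conjI ballI)
    fix f :: "('v, 'a) path \<Rightarrow> 'k"
    assume f: "f \<in> carrier (path_algebra Q)"
    have dsc: "direct_sum r \<rho>1 r' \<rho>2 f \<in> carrier_mat (r + r') (r + r')"
      unfolding direct_sum_def using rho_c by auto
    have "Y * direct_sum r \<rho>1 r' \<rho>2 f = Y * direct_sum r \<rho>1 r' \<rho>2 f * (X * Y)"
      unfolding XY using Yc dsc by simp
    also have "\<dots> = Y * (direct_sum r \<rho>1 r' \<rho>2 f * X) * Y"
      using Xc Yc dsc by (simp add: mat_assoc)
    also have "direct_sum r \<rho>1 r' \<rho>2 f * X = X * \<rho> f"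
      using homX f by (simp add: is_module_hom_def)
    also have "Y * (X * \<rho> f) * Y = (Y * X) * \<rho> f * Y"
      using Xc Yc dr[OF f] by (simp add: mat_assoc)
    finally show "Y * direct_sum r \<rho>1 r' \<rho>2 f = \<rho> f * Y"
      unfolding YX using D(1)[OF f] by simp
  qed (rule Yc)
  have "r > 0"
  proof (rule ccontr)
    assume "\<not> r > 0"
    then have "U * V = 0\<^sub>m n n" using d by (auto intro!: eq_matI simp: scalar_prod_def)
    then show False using F(3) UV(3) by simp
  qed
  moreover have "r' > 0"
  proof (rule ccontr)
    assume "\<not> r' > 0"
    then have "U' * V' = 0\<^sub>m n n" using d by (auto intro!: eq_matI simp: scalar_prod_def)
    then have "1\<^sub>m n - F = 0\<^sub>m n n" using UV'(3) by (simp add: F'_def)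
    then have "F $$ (i, j) = 1\<^sub>m n $$ (i, j)" if "i < n" "j < n" for i j
      using that Fc by (metis carrier_matD eq_iff_diff_eq_0 index_minus_mat(1) index_zero_mat(1))
    then have "F = 1\<^sub>m n" using Fc by (intro eq_matI) auto
    then show False using F(4) by simp
  qed
  moreover have "is_module Q r \<rho>1" "is_module Q r' \<rho>2"
    unfolding \<rho>1_def \<rho>2_def by (rule I(1), simp) (rule I'(1), simp)
  ultimately show ?thesis
    using homX homY XY YX unfolding indecomposable_def module_iso_def by blast
qed

lemma is_module_hom_smult_add:
  fixes \<rho> :: "(('v, 'a) path \<Rightarrow> 'k::field) \<Rightarrow> 'k mat"
  assumes mod: "is_module Q n \<rho>" and mod': "is_module Q n' \<rho>'" and X: "X \<in> carrier_mat n' n"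
    and f: "f \<in> carrier (path_algebra Q)" "X * \<rho> f = \<rho>' f * X"
    and g: "g \<in> carrier (path_algebra Q)" "X * \<rho> g = \<rho>' g * X"
  shows "X * \<rho> (\<lambda>x. f x + g x) = \<rho>' (\<lambda>x. f x + g x) * X"
    "X * \<rho> (\<lambda>x. c * f x) = \<rho>' (\<lambda>x. c * f x) * X"
proof -
  note D = is_moduleD[OF mod] and D' = is_moduleD[OF mod']
  have d: "dim_row (\<rho> f) = n" "dim_col (\<rho> f) = n" "dim_row (\<rho> g) = n" "dim_col (\<rho> g) = n"
    "dim_row (\<rho>' f) = n'" "dim_col (\<rho>' f) = n'" "dim_row (\<rho>' g) = n'" "dim_col (\<rho>' g) = n'"
    "dim_row X = n'" "dim_col X = n"
    using D(1)[OF f(1)] D(1)[OF g(1)] D'(1)[OF f(1)] D'(1)[OF g(1)] X by auto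
  show "X * \<rho> (\<lambda>x. f x + g x) = \<rho>' (\<lambda>x. f x + g x) * X"
    unfolding D(3)[OF f(1) g(1)] D'(3)[OF f(1) g(1)] using d f g by (simp add: mat_add_distrib)
  show "X * \<rho> (\<lambda>x. c * f x) = \<rho>' (\<lambda>x. c * f x) * X"
    unfolding D(5)[OF f(1)] D'(5)[OF f(1)] using d f by (simp add: mat_smult_mult)
qed

subsection \<open>The path algebra of a generalized Kronecker quiver\<close>

definition path_elem :: "('v, 'a) path \<Rightarrow> ('v, 'a) path \<Rightarrow> 'k::field" where
  "path_elem x = (\<lambda>y. if y = x then 1 else 0)"

lemma vertex_idem_eq: "vertex_idem i = path_elem (i, [], i)"
  by (simp add: vertex_idem_def path_elem_def fun_eq_iff)

context kronecker_quiver
begin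

lemma quiver_paths_eq: "quiver_paths Q = {(s, [], s), (t, [], t)} \<union> (\<lambda>e. (s, [e], t)) ` arcs Q"
proof (intro subset_antisym subsetI)
  fix x assume "x \<in> quiver_paths Q"
  then obtain u p v where x: "x = (u, p, v)" and w: "awalk u p v" by (auto simp: quiver_paths_def)
  show "x \<in> {(s, [], s), (t, [], t)} \<union> (\<lambda>e. (s, [e], t)) ` arcs Q"
  proof (cases p)
    case Nil
    then show ?thesis using w x by (auto simp: awalk_def verts_Q)
  next
    case (Cons e es)
    then have e: "e \<in> arcs Q" "u = s" "set es \<subseteq> arcs Q" "cas t es v"
      using w arcs_Q[of e] by (auto simp: awalk_def)
    have "es = []"
    proof (cases es)
      case (Cons e' es')
      then show ?thesis using e arcs_Q[of e'] s_neq_t by auto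
    qed simp
    then show ?thesis using e x Cons by auto
  qed
next
  fix x assume "x \<in> {(s, [], s), (t, [], t)} \<union> (\<lambda>e. (s, [e], t)) ` arcs Q"
  then show "x \<in> quiver_paths Q" using arcs_Q by (auto simp: quiver_paths_def awalk_def verts_Q)
qed

lemma finite_quiver_paths: "finite (quiver_paths Q)"
  by (simp add: quiver_paths_eq)

lemma carrier_path_algebra: "f \<in> carrier (path_algebra Q) \<longleftrightarrow> (\<forall>x. x \<notin> quiver_paths Q \<longrightarrow> f x = 0)"
proof -
  have "f \<in> carrier (path_algebra Q) \<longleftrightarrow> {x. f x \<noteq> 0} \<subseteq> quiver_paths Q"
    using finite_subset[OF _ finite_quiver_paths, of "{x. f x \<noteq> 0}"]
    by (auto simp: path_algebra_def simp del: split_paired_All)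
  then show ?thesis by blast
qed

lemma path_elem_carrier: "x \<in> quiver_paths Q \<Longrightarrow> path_elem x \<in> carrier (path_algebra Q)"
  by (auto simp: carrier_path_algebra path_elem_def)

lemma paths_in_quiver:
  "(s, [], s) \<in> quiver_paths Q" "(t, [], t) \<in> quiver_paths Q" "e \<in> arcs Q \<Longrightarrow> (s, [e], t) \<in> quiver_paths Q"
  by (auto simp: quiver_paths_eq)

lemma mult_path_algebra:
  fixes f g :: "('v, 'a) path \<Rightarrow> 'k::field"
  shows "(f \<otimes>\<^bsub>path_algebra Q\<^esub> g) (s, [], s) = f (s, [], s) * g (s, [], s)"
    "(f \<otimes>\<^bsub>path_algebra Q\<^esub> g) (t, [], t) = f (t, [], t) * g (t, [], t)"
    "e \<in> arcs Q \<Longrightarrow> (f \<otimes>\<^bsub>path_algebra Q\<^esub> g) (s, [e], t) = f (t, [], t) * g (s, [e], t) + f (s, [e], t) * g (s, [], s)"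
    "x \<notin> quiver_paths Q \<Longrightarrow> (f \<otimes>\<^bsub>path_algebra Q\<^esub> g) x = 0"
proof -
  define D where "D u p v = {(q, w, r). p = q @ r \<and> (u, q, w) \<in> quiver_paths Q \<and> (w, r, v) \<in> quiver_paths Q}" for u p v
  have m: "(f \<otimes>\<^bsub>path_algebra Q\<^esub> g) (u, p, v) = (\<Sum>(q, w, r)\<in>D u p v. f (w, r, v) * g (u, q, w))" for u p v
    by (simp add: path_algebra_def D_def)
  have "D s [] s = {([], s, [])}" using s_neq_t by (auto simp: D_def quiver_paths_eq)
  then show "(f \<otimes>\<^bsub>path_algebra Q\<^esub> g) (s, [], s) = f (s, [], s) * g (s, [], s)" by (simp add: m)
  have "D t [] t = {([], t, [])}" using s_neq_t by (auto simp: D_def quiver_paths_eq)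
  then show "(f \<otimes>\<^bsub>path_algebra Q\<^esub> g) (t, [], t) = f (t, [], t) * g (t, [], t)" by (simp add: m)
  show "(f \<otimes>\<^bsub>path_algebra Q\<^esub> g) (s, [e], t) = f (t, [], t) * g (s, [e], t) + f (s, [e], t) * g (s, [], s)"
    if "e \<in> arcs Q"
  proof -
    have "D s [e] t = {([], s, [e]), ([e], t, [])}"
      using s_neq_t that by (auto simp: D_def quiver_paths_eq Cons_eq_append_conv)
    then show ?thesis by (simp add: m)
  qed
  show "(f \<otimes>\<^bsub>path_algebra Q\<^esub> g) x = 0" if x: "x \<notin> quiver_paths Q"
  proof -
    obtain u p v where upv: "x = (u, p, v)" by (cases x)
    have "D u p v = {}"
      using x upv awalk_appendI by (auto simp: D_def quiver_paths_def)
    then show ?thesis unfolding upv m by simp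
  qed
qed

lemma path_algebra_ext:
  fixes f g :: "('v, 'a) path \<Rightarrow> 'k::field"
  assumes "f (s, [], s) = g (s, [], s)" "f (t, [], t) = g (t, [], t)"
    "\<And>e. e \<in> arcs Q \<Longrightarrow> f (s, [e], t) = g (s, [e], t)"
    "\<And>x. x \<notin> quiver_paths Q \<Longrightarrow> f x = g x"
  shows "f = g"
proof
  fix x show "f x = g x"
  proof (cases "x \<in> quiver_paths Q")
    case True
    then show ?thesis using assms(1-3) by (auto simp: quiver_paths_eq)
  qed (rule assms(4))
qed

lemma path_elem_values:
  "path_elem (s, [], s) (s, [], s) = 1" "path_elem (s, [], s) (t, [], t) = 0" "path_elem (s, [], s) (s, [e], t) = 0"
  "path_elem (t, [], t) (s, [], s) = 0" "path_elem (t, [], t) (t, [], t) = 1" "path_elem (t, [], t) (s, [e], t) = 0"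
  "path_elem (s, [e], t) (s, [], s) = 0" "path_elem (s, [e], t) (t, [], t) = 0"
  "path_elem (s, [e], t) (s, [e'], t) = (if e' = e then 1 else 0)"
  using s_neq_t by (auto simp: path_elem_def)

lemma path_elem_outside: "x \<in> quiver_paths Q \<Longrightarrow> y \<notin> quiver_paths Q \<Longrightarrow> path_elem x y = 0"
  by (auto simp: path_elem_def)

lemma vertex_mult_left:
  assumes "g \<in> carrier (path_algebra Q)"
  shows "path_elem (s, [], s) \<otimes>\<^bsub>path_algebra Q\<^esub> g = (\<lambda>x. g (s, [], s) * path_elem (s, [], s) x)"
  by (rule path_algebra_ext)
    (simp_all add: mult_path_algebra path_elem_values path_elem_outside paths_in_quiver)

lemma vertex_mult_right:
  assumes "f \<in> carrier (path_algebra Q)"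
  shows "f \<otimes>\<^bsub>path_algebra Q\<^esub> path_elem (t, [], t) = (\<lambda>x. f (t, [], t) * path_elem (t, [], t) x)"
  by (rule path_algebra_ext)
    (simp_all add: mult_path_algebra path_elem_values path_elem_outside paths_in_quiver)

lemma arrow_mult:
  assumes "e \<in> arcs Q"
  shows "path_elem (t, [], t) \<otimes>\<^bsub>path_algebra Q\<^esub> path_elem (s, [e], t) = path_elem (s, [e], t)"
    "path_elem (s, [e], t) \<otimes>\<^bsub>path_algebra Q\<^esub> path_elem (s, [], s) = path_elem (s, [e], t)"
  by (rule path_algebra_ext;
      use assms in \<open>simp add: mult_path_algebra path_elem_values path_elem_outside paths_in_quiver\<close>)+

lemma one_path_algebra:
  "\<one>\<^bsub>path_algebra Q\<^esub> = (\<lambda>x. path_elem (s, [], s) x + path_elem (t, [], t) x)"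
proof -
  have one: "\<one>\<^bsub>path_algebra Q\<^esub> x = (if x = (s, [], s) \<or> x = (t, [], t) then 1 else 0)" for x :: "('v, 'a) path"
    by (cases x) (auto simp: path_algebra_def verts_Q)
  show ?thesis unfolding fun_eq_iff one using s_neq_t by (auto simp: path_elem_def)
qed

text \<open>
  The two idempotents and the arrows span the path algebra.
\<close>

lemma is_module_homI:
  fixes \<rho> :: "(('v, 'a) path \<Rightarrow> 'k::field) \<Rightarrow> 'k mat"
  assumes mod: "is_module Q n \<rho>" and mod': "is_module Q n' \<rho>'" and X: "X \<in> carrier_mat n' n"
    and s: "X * \<rho> (path_elem (s, [], s)) = \<rho>' (path_elem (s, [], s)) * X"
    and t: "X * \<rho> (path_elem (t, [], t)) = \<rho>' (path_elem (t, [], t)) * X"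
    and arrow: "\<And>e. e \<in> arcs Q \<Longrightarrow> X * \<rho> (path_elem (s, [e], t)) = \<rho>' (path_elem (s, [e], t)) * X"
  shows "is_module_hom Q n \<rho> n' \<rho>' X"
  unfolding is_module_hom_def
proof (intro conjI ballI X)
  note add = is_module_hom_smult_add(1)[OF mod mod' X] and smult = is_module_hom_smult_add(2)[OF mod mod' X]
  have gen: "path_elem x \<in> carrier (path_algebra Q)" "X * \<rho> (path_elem x) = \<rho>' (path_elem x) * X"
    if "x \<in> quiver_paths Q" for x
    using that path_elem_carrier s t arrow by (auto simp: quiver_paths_eq)
  have "\<forall>f \<in> carrier (path_algebra Q). {x. f x \<noteq> 0} \<subseteq> F \<longrightarrow> X * \<rho> f = \<rho>' f * X"
    if "finite F" "F \<subseteq> quiver_paths Q" for F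
    using that
  proof (induction F rule: finite_induct)
    case empty
    have g: "path_elem (s, [], s) \<in> carrier (path_algebra Q)" "X * \<rho> (path_elem (s, [], s)) = \<rho>' (path_elem (s, [], s)) * X"
      using gen paths_in_quiver(1) by auto
    have "X * \<rho> f = \<rho>' f * X" if "{x. f x \<noteq> 0} \<subseteq> {}" for f
    proof -
      have "f = (\<lambda>x. 0 * path_elem (s, [], s) x)" using that by (auto simp: fun_eq_iff)
      then show ?thesis using smult[OF g g, of 0] by simp
    qed
    then show ?case by blast
  next
    case (insert x F)
    show ?case
    proof (intro ballI impI)
      fix f :: "('v, 'a) path \<Rightarrow> 'k"
      assume f: "f \<in> carrier (path_algebra Q)" and F: "{y. f y \<noteq> 0} \<subseteq> insert x F"
      have x: "x \<in> quiver_paths Q" using insert.prems by simp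
      define g where "g = f(x := 0)"
      have g: "g \<in> carrier (path_algebra Q)" using f by (auto simp: g_def carrier_path_algebra)
      moreover have "{y. g y \<noteq> 0} \<subseteq> F" using F by (auto simp: g_def)
      ultimately have Xg: "X * \<rho> g = \<rho>' g * X" using insert.IH insert.prems by blast
      have h: "(\<lambda>y. f x * path_elem x y) \<in> carrier (path_algebra Q)"
        by (simp add: carrier_path_algebra path_elem_outside[OF x] del: split_paired_All)
      have "f = (\<lambda>y. f x * path_elem x y + g y)" by (auto simp: g_def path_elem_def)
      then show "X * \<rho> f = \<rho>' f * X"
        using add[OF h smult[OF gen[OF x] gen[OF x]] g Xg] by simp
    qed
  qed
  then show "X * \<rho> f = \<rho>' f * X" if "f \<in> carrier (path_algebra Q)" for f
    using that finite_quiver_paths carrier_path_algebra by blast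
qed

lemma module_relations:
  fixes \<rho> :: "(('v, 'a) path \<Rightarrow> 'k::field) \<Rightarrow> 'k mat"
  assumes mod: "is_module Q n \<rho>"
  shows "\<rho> (path_elem (s, [], s)) * \<rho> (path_elem (s, [], s)) = \<rho> (path_elem (s, [], s))"
    "\<rho> (path_elem (t, [], t)) * \<rho> (path_elem (t, [], t)) = \<rho> (path_elem (t, [], t))"
    "\<rho> (path_elem (s, [], s)) * \<rho> (path_elem (t, [], t)) = 0\<^sub>m n n"
    "\<rho> (path_elem (t, [], t)) * \<rho> (path_elem (s, [], s)) = 0\<^sub>m n n"
    "\<rho> (path_elem (s, [], s)) + \<rho> (path_elem (t, [], t)) = 1\<^sub>m n"
    "e \<in> arcs Q \<Longrightarrow> \<rho> (path_elem (t, [], t)) * \<rho> (path_elem (s, [e], t)) = \<rho> (path_elem (s, [e], t))"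
    "e \<in> arcs Q \<Longrightarrow> \<rho> (path_elem (s, [e], t)) * \<rho> (path_elem (s, [], s)) = \<rho> (path_elem (s, [e], t))"
    "e \<in> arcs Q \<Longrightarrow> \<rho> (path_elem (s, [], s)) * \<rho> (path_elem (s, [e], t)) = 0\<^sub>m n n"
    "e \<in> arcs Q \<Longrightarrow> \<rho> (path_elem (s, [e], t)) * \<rho> (path_elem (t, [], t)) = 0\<^sub>m n n"
proof -
  note D = is_moduleD[OF mod]
  have g: "(path_elem (s, [], s) :: _ \<Rightarrow> 'k) \<in> carrier (path_algebra Q)"
    "(path_elem (t, [], t) :: _ \<Rightarrow> 'k) \<in> carrier (path_algebra Q)"
    "\<And>e. e \<in> arcs Q \<Longrightarrow> (path_elem (s, [e], t) :: _ \<Rightarrow> 'k) \<in> carrier (path_algebra Q)"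
    using path_elem_carrier paths_in_quiver by auto
  have zero: "\<rho> (\<lambda>x. 0 * f x) = 0\<^sub>m n n" if "f \<in> carrier (path_algebra Q)" for f
    unfolding D(5)[OF that] using D(1)[OF that] by (auto intro!: eq_matI)
  have ts: "path_elem (t, [], t) \<otimes>\<^bsub>path_algebra Q\<^esub> path_elem (s, [], s) = (\<lambda>x. 0 * path_elem (s, [], s) x :: 'k)"
    by (rule path_algebra_ext; simp add: mult_path_algebra path_elem_values path_elem_outside paths_in_quiver)
  show "\<rho> (path_elem (s, [], s)) * \<rho> (path_elem (s, [], s)) = \<rho> (path_elem (s, [], s))"
    "\<rho> (path_elem (s, [], s)) * \<rho> (path_elem (t, [], t)) = 0\<^sub>m n n"
    "e \<in> arcs Q \<Longrightarrow> \<rho> (path_elem (s, [], s)) * \<rho> (path_elem (s, [e], t)) = 0\<^sub>m n n"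
    using zero[OF g(1)] g by (simp_all add: D(2)[symmetric] vertex_mult_left path_elem_values)
  show "\<rho> (path_elem (t, [], t)) * \<rho> (path_elem (t, [], t)) = \<rho> (path_elem (t, [], t))"
    "e \<in> arcs Q \<Longrightarrow> \<rho> (path_elem (s, [e], t)) * \<rho> (path_elem (t, [], t)) = 0\<^sub>m n n"
    using zero[OF g(2)] g by (simp_all add: D(2)[symmetric] vertex_mult_right path_elem_values)
  show "\<rho> (path_elem (t, [], t)) * \<rho> (path_elem (s, [], s)) = 0\<^sub>m n n"
    unfolding D(2)[OF g(2,1), symmetric] ts by (rule zero[OF g(1)])
  show "\<rho> (path_elem (s, [], s)) + \<rho> (path_elem (t, [], t)) = 1\<^sub>m n"
    using D(3)[OF g(1,2)] D(4) by (simp add: one_path_algebra)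
  show "e \<in> arcs Q \<Longrightarrow> \<rho> (path_elem (t, [], t)) * \<rho> (path_elem (s, [e], t)) = \<rho> (path_elem (s, [e], t))"
    "e \<in> arcs Q \<Longrightarrow> \<rho> (path_elem (s, [e], t)) * \<rho> (path_elem (s, [], s)) = \<rho> (path_elem (s, [e], t))"
    using g by (simp_all add: D(2)[symmetric] arrow_mult)
qed

end


section \<open>Modules in coordinates\<close>

text \<open>
  Bases of \<open>e\<^sub>s M\<close> and \<open>e\<^sub>t M\<close>: the columns of \<open>U\<close> and \<open>U'\<close>, with the coordinate maps \<open>V\<close> and \<open>V'\<close>.
  In these bases an arrow is the matrix \<open>tuple e\<close>.
\<close>

locale framed_module = kronecker_quiver Q s t for Q :: "('v, 'a) pre_digraph" and s t +
  fixes n p q :: nat and \<rho> :: "(('v, 'a) path \<Rightarrow> 'k::field) \<Rightarrow> 'k mat" and U V U' V' :: "'k mat"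
  assumes mod: "is_module Q n \<rho>"
    and frame_carrier: "U \<in> carrier_mat n p" "V \<in> carrier_mat p n" "U' \<in> carrier_mat n q" "V' \<in> carrier_mat q n"
    and idem_s: "\<rho> (path_elem (s, [], s)) = U * V" and VU: "V * U = 1\<^sub>m p"
    and idem_t: "\<rho> (path_elem (t, [], t)) = U' * V'" and VU': "V' * U' = 1\<^sub>m q"
begin

definition tuple :: "'a \<Rightarrow> 'k mat" where
  "tuple e = V' * (\<rho> (path_elem (s, [e], t)) * U)"

lemmas rho = is_moduleD[OF mod]

lemma dims [simp]:
  "dim_row U = n" "dim_col U = p" "dim_row V = p" "dim_col V = n"
  "dim_row U' = n" "dim_col U' = q" "dim_row V' = q" "dim_col V' = n"
  using frame_carrier by auto

lemma dims_rho: "f \<in> carrier (path_algebra Q) \<Longrightarrow> dim_row (\<rho> f) = n"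
  "f \<in> carrier (path_algebra Q) \<Longrightarrow> dim_col (\<rho> f) = n"
  using rho(1) by auto

lemma gens: "path_elem (s, [], s) \<in> carrier (path_algebra Q)" "path_elem (t, [], t) \<in> carrier (path_algebra Q)"
  "e \<in> arcs Q \<Longrightarrow> path_elem (s, [e], t) \<in> carrier (path_algebra Q)"
  using path_elem_carrier paths_in_quiver by auto

lemma idem_sum: "U * V + U' * V' = 1\<^sub>m n"
  using rho(3)[OF gens(1,2)] rho(4) by (simp add: one_path_algebra idem_s idem_t)

lemma V_U': "V * U' = 0\<^sub>m p q" and V'_U: "V' * U = 0\<^sub>m q p"
proof -
  have z: "(U * V) * (U' * V') = 0\<^sub>m n n" "(U' * V') * (U * V) = 0\<^sub>m n n"
    using module_relations(3,4)[OF mod] by (simp_all add: idem_s idem_t)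
  have "V * U' = (V * U) * ((V * U') * (V' * U'))" unfolding VU VU' by (simp add: mat_dim_simps)
  also have "\<dots> = V * ((U * V) * (U' * V')) * U'" by (simp add: mat_assoc)
  finally show "V * U' = 0\<^sub>m p q" unfolding z by (simp add: mat_dim_simps)
  have "V' * U = (V' * U') * ((V' * U) * (V * U))" unfolding VU VU' by (simp add: mat_dim_simps)
  also have "\<dots> = V' * ((U' * V') * (U * V)) * U" by (simp add: mat_assoc)
  finally show "V' * U = 0\<^sub>m q p" unfolding z by (simp add: mat_dim_simps)
qed

text \<open>With products associated to the right, these rules cancel coordinates against bases.\<close>

lemma cancel:
  "V * U = 1\<^sub>m p" "V' * U' = 1\<^sub>m q" "V * U' = 0\<^sub>m p q" "V' * U = 0\<^sub>m q p"
  "dim_row Z = p \<Longrightarrow> V * (U * Z) = Z" "dim_row Z = q \<Longrightarrow> V' * (U' * Z) = Z"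
  "dim_row Z = q \<Longrightarrow> V * (U' * Z) = 0\<^sub>m p (dim_col Z)" "dim_row Z = p \<Longrightarrow> V' * (U * Z) = 0\<^sub>m q (dim_col Z)"
  by (simp_all add: VU VU' V_U' V'_U mat_assoc[symmetric] mat_dim_simps)

lemma V_rho:
  assumes g: "g \<in> carrier (path_algebra Q)"
  shows "V * \<rho> g = g (s, [], s) \<cdot>\<^sub>m V"
proof -
  have "V * \<rho> g = (V * U) * (V * \<rho> g)" unfolding VU using dims_rho[OF g] by (simp add: mat_dim_simps)
  also have "\<dots> = V * ((U * V) * \<rho> g)" using dims_rho[OF g] by (simp add: mat_assoc)
  also have "(U * V) * \<rho> g = g (s, [], s) \<cdot>\<^sub>m (U * V)"
    unfolding idem_s[symmetric] rho(2)[OF gens(1) g, symmetric] vertex_mult_left[OF g] rho(5)[OF gens(1)] ..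
  also have "V * (g (s, [], s) \<cdot>\<^sub>m (U * V)) = g (s, [], s) \<cdot>\<^sub>m V"
    by (simp add: mat_smult_mult cancel)
  finally show ?thesis .
qed

lemma rho_U':
  assumes f: "f \<in> carrier (path_algebra Q)"
  shows "\<rho> f * U' = f (t, [], t) \<cdot>\<^sub>m U'"
proof -
  have "\<rho> f * U' = (\<rho> f * U') * (V' * U')" unfolding VU' using dims_rho[OF f] by (simp add: mat_dim_simps)
  also have "\<dots> = (\<rho> f * (U' * V')) * U'" using dims_rho[OF f] by (simp add: mat_assoc)
  also have "\<rho> f * (U' * V') = f (t, [], t) \<cdot>\<^sub>m (U' * V')"
    unfolding idem_t[symmetric] rho(2)[OF f gens(2), symmetric] vertex_mult_right[OF f] rho(5)[OF gens(2)] ..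
  also have "(f (t, [], t) \<cdot>\<^sub>m (U' * V')) * U' = f (t, [], t) \<cdot>\<^sub>m U'"
    by (simp add: mat_smult_mult mat_assoc cancel mat_dim_simps)
  finally show ?thesis .
qed

lemma rho_arrow: "e \<in> arcs Q \<Longrightarrow> \<rho> (path_elem (s, [e], t)) = U' * (tuple e * V)"
proof -
  assume e: "e \<in> arcs Q"
  note g = gens(3)[OF e]
  have "\<rho> (path_elem (s, [e], t)) = (U' * V') * (\<rho> (path_elem (s, [e], t)) * (U * V))"
    unfolding idem_s[symmetric] idem_t[symmetric] rho(2)[OF g gens(1), symmetric] arrow_mult(2)[OF e]
      rho(2)[OF gens(2) g, symmetric] arrow_mult(1)[OF e] ..
  then show ?thesis using dims_rho[OF g] by (simp add: tuple_def mat_assoc)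
qed

lemma dims_tuple [simp]: "dim_row (tuple e) = q" "dim_col (tuple e) = p"
  by (simp_all add: tuple_def)

lemma tuple_is_tuple: "is_tuple (arcs Q) p q tuple"
  unfolding is_tuple_def by (auto intro: carrier_matI)

lemma is_module_hom_endI:
  assumes "X \<in> carrier_mat n n" "X * (U * V) = (U * V) * X" "X * (U' * V') = (U' * V') * X"
    "\<And>e. e \<in> arcs Q \<Longrightarrow> X * (U' * (tuple e * V)) = (U' * (tuple e * V)) * X"
  shows "is_module_hom Q n \<rho> n \<rho> X"
  by (rule is_module_homI[OF mod mod assms(1)]) (simp_all add: idem_s idem_t rho_arrow assms)

text \<open>
  This lemma and the next one identify the endomorphisms of the module with those of the tuple.
\<close>

lemma endo_lift:
  assumes "endo (arcs Q) p q tuple X Y"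
  shows "is_module_hom Q n \<rho> n \<rho> (U * (X * V) + U' * (Y * V'))"
proof -
  have d: "dim_row X = p" "dim_col X = p" "dim_row Y = q" "dim_col Y = q"
    using assms by (auto simp: endo_def)
  have e: "tuple e * (X * V) = Y * (tuple e * V)" if "e \<in> arcs Q" for e
    using assms that d by (simp add: endo_def mat_assoc[symmetric])
  show ?thesis
    by (rule is_module_hom_endI)
      (auto simp: d e mat_add_distrib mat_assoc cancel mat_dim_simps intro!: carrier_matI)
qed

lemma endo_coordinates:
  assumes "is_module_hom Q n \<rho> n \<rho> F"
  shows "endo (arcs Q) p q tuple (V * (F * U)) (V' * (F * U'))"
    "F = U * ((V * (F * U)) * V) + U' * ((V' * (F * U')) * V')"
proof -
  have F: "dim_row F = n" "dim_col F = n" and c: "\<And>f. f \<in> carrier (path_algebra Q) \<Longrightarrow> F * \<rho> f = \<rho> f * F"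
    using assms by (auto simp: is_module_hom_def)
  note cs = c[OF gens(1), unfolded idem_s] and ct = c[OF gens(2), unfolded idem_t]
  show "endo (arcs Q) p q tuple (V * (F * U)) (V' * (F * U'))"
    unfolding endo_def
  proof (intro conjI ballI)
    fix e assume e: "e \<in> arcs Q"
    have ce: "F * (U' * (tuple e * V)) = (U' * (tuple e * V)) * F"
      using c[OF gens(3)[OF e]] unfolding rho_arrow[OF e] .
    have "tuple e * (V * (F * U)) = V' * (((U' * (tuple e * V)) * F) * U)"
      by (simp add: F mat_assoc cancel)
    also have "\<dots> = V' * (F * U') * tuple e"
      unfolding ce[symmetric] by (simp add: F mat_assoc cancel mat_dim_simps)
    finally show "tuple e * (V * (F * U)) = V' * (F * U') * tuple e" .
  qed (auto intro!: carrier_matI simp: F)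
  have "F = F * (U * V + U' * V')" unfolding idem_sum by (simp add: F mat_dim_simps)
  also have "\<dots> = F * (U * V) * (U * V) + F * (U' * V') * (U' * V')"
    by (simp add: F mat_assoc cancel mat_add_distrib)
  also have "\<dots> = U * ((V * (F * U)) * V) + U' * ((V' * (F * U')) * V')"
    unfolding cs ct by (simp add: F mat_assoc)
  finally show "F = U * ((V * (F * U)) * V) + U' * ((V' * (F * U')) * V')" .
qed

lemma dimension_vector_eq:
  "dimension_vector Q n \<rho> = (\<lambda>i. if i = s then int p else if i = t then int q else 0)"
  using s_neq_t rank_eqI[OF frame_carrier(1,2) idem_s[symmetric] VU] rank_eqI[OF frame_carrier(3,4) idem_t[symmetric] VU']
  by (auto simp: dimension_vector_def verts_Q vertex_idem_eq fun_eq_iff)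

lemma dims_pos: "n > 0 \<longleftrightarrow> p + q > 0"
proof
  assume n: "n > 0"
  show "p + q > 0"
  proof (rule ccontr)
    assume "\<not> p + q > 0"
    then have "(U * V + U' * V') $$ (0, 0) = 0" using n by (simp add: scalar_prod_def)
    then show False using n by (simp add: idem_sum)
  qed
next
  assume "p + q > 0"
  moreover have "p \<le> n" by (rule left_right_inverse_dims_le[OF frame_carrier(2,1) VU])
  moreover have "q \<le> n" by (rule left_right_inverse_dims_le[OF frame_carrier(4,3) VU'])
  ultimately show "n > 0" by linarith
qed

lemma indecomposable_tuple_if_indecomposable:
  assumes "indecomposable Q n \<rho>"
  shows "indecomposable_tuple (arcs Q) p q tuple"
  unfolding indecomposable_tuple_def
proof (intro conjI allI impI)
  show "is_tuple (arcs Q) p q tuple" by (rule tuple_is_tuple)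
  show "p + q > 0" using assms dims_pos by (simp add: indecomposable_def)
  fix X Y assume XY: "endo (arcs Q) p q tuple X Y \<and> X * X = X \<and> Y * Y = Y"
  have d: "dim_row X = p" "dim_col X = p" "dim_row Y = q" "dim_col Y = q"
    using XY by (auto simp: endo_def)
  define F where "F = U * (X * V) + U' * (Y * V')"
  have hom: "is_module_hom Q n \<rho> n \<rho> F" unfolding F_def using endo_lift XY by blast
  have "X * (X * V) = X * V" "Y * (Y * V') = Y * V'"
    using XY d by (simp_all add: mat_assoc[symmetric])
  then have "F * F = F"
    unfolding F_def by (simp add: d mat_add_distrib mat_assoc cancel mat_dim_simps)
  then have "F = 0\<^sub>m n n \<or> F = 1\<^sub>m n"
    using module_decomposes[OF mod hom] assms by blast
  moreover have X: "V * (F * U) = X" and Y: "V' * (F * U') = Y"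
    unfolding F_def by (simp_all add: d mat_add_distrib mat_assoc cancel mat_dim_simps)
  ultimately show "X = 0\<^sub>m p p \<and> Y = 0\<^sub>m q q \<or> X = 1\<^sub>m p \<and> Y = 1\<^sub>m q"
  proof (elim disjE)
    assume F: "F = 0\<^sub>m n n"
    show ?thesis unfolding X[symmetric] Y[symmetric] F by (simp add: mat_dim_simps)
  next
    assume F: "F = 1\<^sub>m n"
    show ?thesis unfolding X[symmetric] Y[symmetric] F by (simp add: mat_dim_simps cancel)
  qed
qed

text \<open>
  The projection onto a direct summand is an endomorphism, which here has to be a scalar. It is
  neither zero nor one.
\<close>

lemma indecomposable_if_brick:
  assumes brick: "brick (arcs Q) p q tuple"
  shows "indecomposable Q n \<rho>"
  unfolding indecomposable_def
proof (intro conjI notI)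
  show n: "n > 0" using brick dims_pos by (simp add: brick_def)
  assume "\<exists>n1 \<rho>1 n2 \<rho>2. n1 > 0 \<and> n2 > 0 \<and> is_module Q n1 \<rho>1 \<and> is_module Q n2 \<rho>2 \<and>
    module_iso Q n \<rho> (n1 + n2) (direct_sum n1 \<rho>1 n2 \<rho>2)"
  then obtain n1 n2 X Y and \<rho>1 \<rho>2 :: "(('v, 'a) path \<Rightarrow> 'k) \<Rightarrow> 'k mat"
    where pos: "n1 > 0" "n2 > 0" and mods: "is_module Q n1 \<rho>1" "is_module Q n2 \<rho>2"
    and X: "is_module_hom Q n \<rho> (n1 + n2) (direct_sum n1 \<rho>1 n2 \<rho>2) X"
    and Y: "is_module_hom Q (n1 + n2) (direct_sum n1 \<rho>1 n2 \<rho>2) n \<rho> Y"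
    and YX: "Y * X = 1\<^sub>m n" and XY: "X * Y = 1\<^sub>m (n1 + n2)"
    unfolding module_iso_def by (elim exE conjE) (rule that)
  have d: "dim_row X = n1 + n2" "dim_col X = n" "dim_row Y = n" "dim_col Y = n1 + n2"
    using X Y by (auto simp: is_module_hom_def)
  define E where "E = four_block_mat (1\<^sub>m n1) (0\<^sub>m n1 n2) (0\<^sub>m n2 n1) (0\<^sub>m n2 n2 :: 'k mat)"
  have dE: "dim_row E = n1 + n2" "dim_col E = n1 + n2" by (simp_all add: E_def)
  have EE: "E * E = E"
    unfolding E_def by (subst mult_four_block_mat[of _ n1 n1 _ n2 _ n2]) auto
  define F where "F = Y * (E * X)"
  have dF: "dim_row F = n" "dim_col F = n" by (simp_all add: F_def d)
  have XYZ: "X * (Y * Z) = Z" if "dim_row Z = n1 + n2" for Z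
    using that by (simp add: mat_assoc[symmetric] d XY mat_dim_simps)
  have EEZ: "E * (E * Z) = E * Z" if "dim_row Z = n1 + n2" for Z
    using that by (simp add: mat_assoc[symmetric] dE EE)
  have FF: "F * F = F"
    unfolding F_def by (simp add: mat_assoc d dE XYZ EEZ)
  have XFY: "X * (F * Y) = E"
    unfolding F_def by (simp add: mat_assoc d dE XYZ XY mat_dim_simps)
  have "is_module_hom Q n \<rho> n \<rho> F"
    unfolding is_module_hom_def
  proof (intro conjI ballI)
    fix f :: "('v, 'a) path \<Rightarrow> 'k"
    assume f: "f \<in> carrier (path_algebra Q)"
    define R where "R = direct_sum n1 \<rho>1 n2 \<rho>2 f"
    have r: "\<rho>1 f \<in> carrier_mat n1 n1" "\<rho>2 f \<in> carrier_mat n2 n2"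
      using is_moduleD(1)[OF mods(1) f] is_moduleD(1)[OF mods(2) f] .
    have dR: "dim_row R = n1 + n2" "dim_col R = n1 + n2" using r by (auto simp: R_def direct_sum_def)
    have "E * R = four_block_mat (\<rho>1 f) (0\<^sub>m n1 n2) (0\<^sub>m n2 n1) (0\<^sub>m n2 n2)"
      unfolding E_def R_def direct_sum_def
      by (subst mult_four_block_mat[OF one_carrier_mat zero_carrier_mat zero_carrier_mat zero_carrier_mat
            r(1) zero_carrier_mat zero_carrier_mat r(2)]) (use r in auto)
    moreover have "R * E = four_block_mat (\<rho>1 f) (0\<^sub>m n1 n2) (0\<^sub>m n2 n1) (0\<^sub>m n2 n2)"
      unfolding E_def R_def direct_sum_def
      by (subst mult_four_block_mat[OF r(1) zero_carrier_mat zero_carrier_mat r(2)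
            one_carrier_mat zero_carrier_mat zero_carrier_mat zero_carrier_mat]) (use r in auto)
    ultimately have ER: "E * R = R * E" by simp
    have XR: "X * \<rho> f = R * X" and YR: "Y * R = \<rho> f * Y"
      using X Y f by (simp_all add: is_module_hom_def R_def)
    have "F * \<rho> f = Y * (E * (X * \<rho> f))" using dims_rho[OF f] by (simp add: F_def mat_assoc d dE)
    also have "\<dots> = Y * ((E * R) * X)" unfolding XR by (simp add: mat_assoc d dE dR)
    also have "\<dots> = (Y * R) * (E * X)" unfolding ER by (simp add: mat_assoc d dE dR)
    also have "\<dots> = \<rho> f * F" unfolding YR using dims_rho[OF f] by (simp add: F_def mat_assoc d dE)
    finally show "F * \<rho> f = \<rho> f * F" .
  qed (rule carrier_matI; simp add: dF)
  note F = endo_coordinates[OF this]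
  obtain c where c: "V * (F * U) = c \<cdot>\<^sub>m 1\<^sub>m p" "V' * (F * U') = c \<cdot>\<^sub>m 1\<^sub>m q"
    using brick F(1) unfolding brick_def by blast
  have "F = c \<cdot>\<^sub>m (U * V) + c \<cdot>\<^sub>m (U' * V')"
    using F(2) unfolding c by (simp add: mat_smult_mult mat_dim_simps)
  also have "\<dots> = c \<cdot>\<^sub>m (U * V + U' * V')" by (auto intro!: eq_matI simp: distrib_left)
  finally have Fc: "F = c \<cdot>\<^sub>m 1\<^sub>m n" unfolding idem_sum .
  then have "E = c \<cdot>\<^sub>m 1\<^sub>m (n1 + n2)"
    using XFY by (simp add: mat_smult_mult mat_dim_simps d XY)
  then have "E $$ (0, 0) = c" "E $$ (n1, n1) = c" using pos by simp_all
  then show False using pos by (simp add: E_def)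
qed

end


section \<open>Self-extensions of modules\<close>

lemma minus_mat_exchange:
  fixes A B C D :: "'k::field mat"
  assumes "A \<in> carrier_mat r c" "B \<in> carrier_mat r c" "C \<in> carrier_mat r c" "D \<in> carrier_mat r c" "A - B = C - D"
  shows "A - C = B - D"
proof (rule eq_matI)
  fix i j assume "i < dim_row (B - D)" "j < dim_col (B - D)"
  then have ij: "i < r" "j < c" using assms by auto
  have "(A - B) $$ (i, j) = (C - D) $$ (i, j)" using assms by simp
  then show "(A - C) $$ (i, j) = (B - D) $$ (i, j)" using ij assms(1-4) by (simp add: algebra_simps)
qed (use assms in auto)

lemma mult_mat_vec_zero:
  fixes A :: "'k::field mat"
  shows "dim_col A = n \<Longrightarrow> A *\<^sub>v 0\<^sub>v n = 0\<^sub>v (dim_row A)"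
    and "dim_vec v = n \<Longrightarrow> 0\<^sub>m m n *\<^sub>v v = 0\<^sub>v m"
  by (auto intro!: eq_vecI simp: scalar_prod_def)

lemma factor_through_columns:
  fixes X D :: "'k::field mat"
  assumes X: "X \<in> carrier_mat m n" and D: "D \<in> carrier_mat m c"
    and cols: "\<And>j. j < c \<Longrightarrow> col D j \<in> (*\<^sub>v) X ` carrier_vec n"
  shows "\<exists>C \<in> carrier_mat n c. D = X * C"
proof -
  define v where "v j = (SOME v. v \<in> carrier_vec n \<and> X *\<^sub>v v = col D j)" for j
  have v: "v j \<in> carrier_vec n" "X *\<^sub>v v j = col D j" if "j < c" for j
  proof -
    have "\<exists>v. v \<in> carrier_vec n \<and> X *\<^sub>v v = col D j" using cols[OF that] by auto
    then have "v j \<in> carrier_vec n \<and> X *\<^sub>v v j = col D j" unfolding v_def by (rule someI_ex)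
    then show "v j \<in> carrier_vec n" "X *\<^sub>v v j = col D j" by auto
  qed
  define C where "C = mat n c (\<lambda>(i, j). v j $ i)"
  have C: "C \<in> carrier_mat n c" by (simp add: C_def)
  have colC: "col C j = v j" if "j < c" for j
    using v(1)[OF that] that by (intro eq_vecI) (auto simp: C_def)
  have "D = X * C"
  proof (rule mat_col_eqI)
    fix j assume "j < dim_col (X * C)"
    then have j: "j < c" using C by simp
    show "col D j = col (X * C) j" unfolding col_mult2[OF X C j] colC[OF j] v(2)[OF j] ..
  qed (use X C D in auto)
  then show ?thesis using C by blast
qed

lemma short_exact_matrices:
  fixes X Y :: "'k::field mat"
  assumes X: "X \<in> carrier_mat m n'" and Y: "Y \<in> carrier_mat n'' m"
    and ker: "(*\<^sub>v) X ` carrier_vec n' = {v \<in> carrier_vec m. Y *\<^sub>v v = 0\<^sub>v n''}"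
    and surj: "(*\<^sub>v) Y ` carrier_vec m = carrier_vec n''"
  shows "Y * X = 0\<^sub>m n'' n'" "\<exists>S \<in> carrier_mat m n''. Y * S = 1\<^sub>m n''"
    "\<And>D c. D \<in> carrier_mat m c \<Longrightarrow> Y * D = 0\<^sub>m n'' c \<Longrightarrow> \<exists>C \<in> carrier_mat n' c. D = X * C"
proof -
  show "Y * X = 0\<^sub>m n'' n'"
  proof (rule mat_col_eqI)
    fix j assume "j < dim_col (0\<^sub>m n'' n')"
    then have j: "j < n'" by simp
    have "X *\<^sub>v unit_vec n' j \<in> (*\<^sub>v) X ` carrier_vec n'" by auto
    then have "Y *\<^sub>v (X *\<^sub>v unit_vec n' j) = 0\<^sub>v n''" unfolding ker by simp
    moreover have "X *\<^sub>v unit_vec n' j = col X j"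
      using col_mult2[OF X one_carrier_mat j] X j by simp
    ultimately show "col (Y * X) j = col (0\<^sub>m n'' n') j"
      using col_mult2[OF Y X j] j by simp
  qed (use X Y in auto)
  have "\<exists>S \<in> carrier_mat m n''. 1\<^sub>m n'' = Y * S"
    by (rule factor_through_columns[OF Y one_carrier_mat]) (auto simp: surj)
  then show "\<exists>S \<in> carrier_mat m n''. Y * S = 1\<^sub>m n''" by auto
  show "\<exists>C \<in> carrier_mat n' c. D = X * C" if D: "D \<in> carrier_mat m c" and YD: "Y * D = 0\<^sub>m n'' c" for D c
  proof (rule factor_through_columns[OF X D])
    fix j assume j: "j < c"
    have "Y *\<^sub>v col D j = col (0\<^sub>m n'' c) j" unfolding YD[symmetric] by (rule col_mult2[OF Y D j, symmetric])
    also have "\<dots> = 0\<^sub>v n''" using j by (rule col_zero)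
    finally have "Y *\<^sub>v col D j = 0\<^sub>v n''" .
    moreover have "col D j \<in> carrier_vec m"
      unfolding carrier_vec_def mem_Collect_eq dim_col by (rule carrier_matD(1)[OF D])
    ultimately show "col D j \<in> (*\<^sub>v) X ` carrier_vec n'" unfolding ker by simp
  qed
qed

lemma short_exact_if_split:
  fixes L X Y R :: "'k::field mat"
  assumes X: "is_module_hom Q n' \<rho>' m \<epsilon> X" and Y: "is_module_hom Q m \<epsilon> n'' \<rho>'' Y"
    and L: "L \<in> carrier_mat n' m" and R: "R \<in> carrier_mat m n''"
    and eqs: "L * X = 1\<^sub>m n'" "Y * R = 1\<^sub>m n''" "Y * X = 0\<^sub>m n'' n'" "X * L + R * Y = 1\<^sub>m m"
  shows "short_exact Q n' \<rho>' m \<epsilon> n'' \<rho>'' X Y"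
  unfolding short_exact_def
proof (intro conjI X Y)
  have Xc: "X \<in> carrier_mat m n'" and Yc: "Y \<in> carrier_mat n'' m"
    using X Y by (auto simp: is_module_hom_def)
  have LX: "L *\<^sub>v (X *\<^sub>v x) = x" if "x \<in> carrier_vec n'" for x
    using assoc_mult_mat_vec[OF L Xc that] that by (simp add: eqs)
  then show "inj_on ((*\<^sub>v) X) (carrier_vec n')" by (rule inj_on_inverseI)
  show "(*\<^sub>v) X ` carrier_vec n' = {v \<in> carrier_vec m. Y *\<^sub>v v = 0\<^sub>v n''}"
  proof (intro subset_antisym subsetI)
    fix v assume "v \<in> (*\<^sub>v) X ` carrier_vec n'"
    then obtain x where x: "x \<in> carrier_vec n'" "v = X *\<^sub>v x" by blast
    have "Y *\<^sub>v v = 0\<^sub>v n''" using assoc_mult_mat_vec[OF Yc Xc x(1)] x by (simp add: eqs mult_mat_vec_zero)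
    then show "v \<in> {v \<in> carrier_vec m. Y *\<^sub>v v = 0\<^sub>v n''}"
      using x(2) mult_mat_vec_carrier[OF Xc x(1)] by simp
  next
    fix v assume "v \<in> {v \<in> carrier_vec m. Y *\<^sub>v v = 0\<^sub>v n''}"
    then have v: "v \<in> carrier_vec m" "Y *\<^sub>v v = 0\<^sub>v n''" by auto
    have "v = (X * L + R * Y) *\<^sub>v v" using v by (simp add: eqs)
    also have "\<dots> = (X * L) *\<^sub>v v + (R * Y) *\<^sub>v v"
      by (rule add_mult_distrib_mat_vec[OF mult_carrier_mat[OF Xc L] mult_carrier_mat[OF R Yc] v(1)])
    also have "(X * L) *\<^sub>v v = X *\<^sub>v (L *\<^sub>v v)" by (rule assoc_mult_mat_vec[OF Xc L v(1)])
    also have "(R * Y) *\<^sub>v v = 0\<^sub>v m"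
      unfolding assoc_mult_mat_vec[OF R Yc v(1)] v(2) using R by (simp add: mult_mat_vec_zero)
    also have "X *\<^sub>v (L *\<^sub>v v) + 0\<^sub>v m = X *\<^sub>v (L *\<^sub>v v)"
      by (rule right_zero_vec[OF mult_mat_vec_carrier[OF Xc mult_mat_vec_carrier[OF L v(1)]]])
    finally show "v \<in> (*\<^sub>v) X ` carrier_vec n'"
      using mult_mat_vec_carrier[OF L v(1)] by (rule image_eqI)
  qed
  show "(*\<^sub>v) Y ` carrier_vec m = carrier_vec n''"
  proof (intro subset_antisym subsetI)
    fix y :: "'k vec" assume y: "y \<in> carrier_vec n''"
    have "y = Y *\<^sub>v (R *\<^sub>v y)" using assoc_mult_mat_vec[OF Yc R y] y by (simp add: eqs)
    then show "y \<in> (*\<^sub>v) Y ` carrier_vec m" using mult_mat_vec_carrier[OF R y] by (rule image_eqI)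
  qed (use mult_mat_vec_carrier[OF Yc] in auto)
qed

context kronecker_quiver
begin

lemma frame_exists:
  fixes \<rho> :: "(('v, 'a) path \<Rightarrow> 'k::field) \<Rightarrow> 'k mat"
  assumes mod: "is_module Q n \<rho>"
  obtains p q U V U' V' where "framed_module Q s t n p q \<rho> U V U' V'"
proof -
  note D = is_moduleD[OF mod] and R = module_relations[OF mod]
  have c: "\<rho> (path_elem (s, [], s)) \<in> carrier_mat n n" "\<rho> (path_elem (t, [], t)) \<in> carrier_mat n n"
    using D(1) path_elem_carrier paths_in_quiver by auto
  obtain p U V where UV: "U \<in> carrier_mat n p" "V \<in> carrier_mat p n"
    "U * V = \<rho> (path_elem (s, [], s))" "V * U = 1\<^sub>m p"
    by (rule idempotent_factorization[OF c(1) R(1)])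
  obtain q U' V' where UV': "U' \<in> carrier_mat n q" "V' \<in> carrier_mat q n"
    "U' * V' = \<rho> (path_elem (t, [], t))" "V' * U' = 1\<^sub>m q"
    by (rule idempotent_factorization[OF c(2) R(2)])
  show ?thesis
    by (rule that[of p q U V U' V'], unfold_locales) (use mod UV UV' in auto)
qed

end

context framed_module
begin

text \<open>
  A linear section \<open>S1\<close> of the extension that is compatible with the idempotents fails to commute with
  the arrows by \<open>X C\<^sub>e\<close> for some matrices \<open>C\<^sub>e\<close>. A solution of \<open>C\<^sub>e = A\<^sub>e x - y A\<^sub>e\<close> in coordinates,
  put together to \<open>T\<close>, corrects it to \<open>S1 - X T\<close>.
\<close>

lemma Ext1_vanishes_if_rigid:
  assumes rigid: "rigid_tuple (arcs Q) p q tuple"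
  shows "Ext1_vanishes Q n \<rho> n \<rho>"
  unfolding Ext1_vanishes_def
proof (intro allI impI)
  fix m X Y and \<epsilon> :: "(('v, 'a) path \<Rightarrow> 'k) \<Rightarrow> 'k mat"
  assume "is_module Q m \<epsilon> \<and> short_exact Q n \<rho> m \<epsilon> n \<rho> X Y"
  then have mod\<epsilon>: "is_module Q m \<epsilon>" and hX: "is_module_hom Q n \<rho> m \<epsilon> X" and hY: "is_module_hom Q m \<epsilon> n \<rho> Y"
    and ker: "(*\<^sub>v) X ` carrier_vec n = {v \<in> carrier_vec m. Y *\<^sub>v v = 0\<^sub>v n}"
    and surj: "(*\<^sub>v) Y ` carrier_vec m = carrier_vec n" by (auto simp: short_exact_def)
  have X: "X \<in> carrier_mat m n" and Y: "Y \<in> carrier_mat n m" using hX hY by (auto simp: is_module_hom_def)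
  note M = short_exact_matrices[OF X Y ker surj]
  obtain S0 where S0: "S0 \<in> carrier_mat m n" "Y * S0 = 1\<^sub>m n" using M(2) by (elim bexE)
  define es et ea where "es = \<epsilon> (path_elem (s, [], s))" and "et = \<epsilon> (path_elem (t, [], t))"
    and "ea e = \<epsilon> (path_elem (s, [e], t))" for e
  define ps pt pa where "ps = \<rho> (path_elem (s, [], s))" and "pt = \<rho> (path_elem (t, [], t))"
    and "pa e = \<rho> (path_elem (s, [e], t))" for e
  have d: "dim_row X = m" "dim_col X = n" "dim_row Y = n" "dim_col Y = m" "dim_row S0 = m" "dim_col S0 = n"
    "dim_row es = m" "dim_col es = m" "dim_row et = m" "dim_col et = m"
    "dim_row ps = n" "dim_col ps = n" "dim_row pt = n" "dim_col pt = n"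
    using X Y S0 is_moduleD(1)[OF mod\<epsilon> gens(1)] is_moduleD(1)[OF mod\<epsilon> gens(2)] dims_rho[OF gens(1)] dims_rho[OF gens(2)]
    by (auto simp: es_def et_def ps_def pt_def)
  have da: "dim_row (ea e) = m" "dim_col (ea e) = m" "dim_row (pa e) = n" "dim_col (pa e) = n" if "e \<in> arcs Q" for e
    using is_moduleD(1)[OF mod\<epsilon> gens(3)[OF that]] dims_rho[OF gens(3)[OF that]] by (auto simp: ea_def pa_def)
  note re = module_relations[OF mod\<epsilon>, folded es_def et_def ea_def]
  note rp = module_relations[OF mod, folded ps_def pt_def pa_def]
  have hX': "X * \<rho> f = \<epsilon> f * X" and hY': "Y * \<epsilon> f = \<rho> f * Y" if "f \<in> carrier (path_algebra Q)" for f
    using hX hY that by (simp_all add: is_module_hom_def)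
  have hYs: "Y * es = ps * Y" "Y * et = pt * Y" "X * ps = es * X" "X * pt = et * X"
    unfolding es_def et_def ps_def pt_def
    by (rule hY'[OF gens(1)], rule hY'[OF gens(2)], rule hX'[OF gens(1)], rule hX'[OF gens(2)])
  have hYa: "Y * ea e = pa e * Y" "X * pa e = ea e * X" if "e \<in> arcs Q" for e
    unfolding ea_def pa_def by (rule hY'[OF gens(3)[OF that]], rule hX'[OF gens(3)[OF that]])
  define S1 where "S1 = es * (S0 * ps) + et * (S0 * pt)"
  have dS1: "dim_row S1 = m" "dim_col S1 = n" by (simp_all add: S1_def d)
  have S1s: "es * S1 = es * (S0 * ps)" "S1 * ps = es * (S0 * ps)"
    and S1t: "et * S1 = et * (S0 * pt)" "S1 * pt = et * (S0 * pt)"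
    using re rp by (simp_all add: S1_def d mat_add_distrib mat_assoc mat_dim_simps)
      (simp_all add: d mat_assoc[symmetric] mat_dim_simps)
  have YS1: "Y * S1 = 1\<^sub>m n"
  proof -
    have "Y * S1 = (Y * es) * (S0 * ps) + (Y * et) * (S0 * pt)"
      by (simp add: S1_def d mat_add_distrib mat_assoc)
    also have "\<dots> = ps * ((Y * S0) * ps) + pt * ((Y * S0) * pt)" unfolding hYs by (simp add: d mat_assoc)
    also have "\<dots> = 1\<^sub>m n" unfolding S0(2) using rp by (simp add: d mat_dim_simps)
    finally show ?thesis .
  qed
  define D where "D e = ea e * S1 - S1 * pa e" for e
  have D_eq: "D e = ea e * (S0 * ps) - et * (S0 * pa e)" if e: "e \<in> arcs Q" for e
  proof -
    have "ea e * S1 = ea e * (S0 * ps)"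
      using re(7,9)[OF e] by (simp add: S1_def d da[OF e] mat_add_distrib mat_assoc[symmetric] mat_dim_simps)
    moreover have "S1 * pa e = et * (S0 * pa e)"
      using rp(6,8)[OF e] by (simp add: S1_def d da[OF e] mat_add_distrib mat_assoc mat_dim_simps)
    ultimately show ?thesis by (simp add: D_def)
  qed
  have dD: "dim_row (D e) = m" "dim_col (D e) = n" if "e \<in> arcs Q" for e by (simp_all add: D_def dS1 da[OF that])
  have "Y * D e = 0\<^sub>m n n" if e: "e \<in> arcs Q" for e
  proof -
    have "Y * D e = (Y * ea e) * S1 - (Y * S1) * pa e"
      by (simp add: D_def d dS1 da[OF e] mat_minus_distrib mat_assoc)
    also have "\<dots> = pa e * (Y * S1) - (Y * S1) * pa e"
      unfolding hYa[OF e] by (simp add: d dS1 da[OF e] mat_assoc)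
    also have "\<dots> = 0\<^sub>m n n" unfolding YS1 using da[OF e] by (auto simp: mat_dim_simps intro!: eq_matI)
    finally show ?thesis .
  qed
  then have exC: "\<exists>C. C \<in> carrier_mat n n \<and> D e = X * C" if e: "e \<in> arcs Q" for e
    using M(3)[of "D e" n, OF carrier_matI[OF dD[OF e]]] e by auto
  define C where "C e = (SOME C. C \<in> carrier_mat n n \<and> D e = X * C)" for e
  have C: "C e \<in> carrier_mat n n" "D e = X * C e" if "e \<in> arcs Q" for e
    using someI_ex[OF exC[OF that]] by (auto simp: C_def)
  have dC: "dim_row (C e) = n" "dim_col (C e) = n" if "e \<in> arcs Q" for e using C(1)[OF that] by auto
  have "is_tuple (arcs Q) p q (\<lambda>e. V' * (C e * U))"
    unfolding is_tuple_def using dC by (auto intro!: carrier_matI)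
  from rigid[unfolded rigid_tuple_def, rule_format, OF this]
  obtain x y where xy: "x \<in> carrier_mat p p" "y \<in> carrier_mat q q"
    "\<forall>e\<in>arcs Q. V' * (C e * U) = tuple e * x - y * tuple e" by (elim bexE)
  have dxy: "dim_row x = p" "dim_col x = p" "dim_row y = q" "dim_col y = q" using xy by auto
  define T where "T = U * (x * V) + U' * (y * V')"
  have dT: "dim_row T = n" "dim_col T = n" by (simp_all add: T_def)
  have Tst: "ps * T = T * ps" "pt * T = T * pt"
    by (simp_all add: ps_def pt_def idem_s idem_t T_def dxy mat_add_distrib mat_assoc cancel mat_dim_simps)
  have key: "X * (pa e * T - T * pa e) = D e" if e: "e \<in> arcs Q" for e
  proof -
    have "pa e * T - T * pa e = U' * (tuple e * (x * V)) - U' * (y * (tuple e * V))"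
      by (simp add: pa_def rho_arrow[OF e] T_def dxy mat_add_distrib mat_assoc cancel mat_dim_simps)
    also have "\<dots> = U' * ((tuple e * x - y * tuple e) * V)"
      by (simp add: dxy mat_minus_distrib mat_assoc)
    also have "\<dots> = pt * (C e * ps)"
      unfolding xy(3)[rule_format, OF e, symmetric] by (simp add: pt_def ps_def idem_s idem_t dC[OF e] mat_assoc)
    finally have "X * (pa e * T - T * pa e) = (X * pt) * (C e * ps)" by (simp add: d dC[OF e] mat_assoc)
    also have "\<dots> = et * (D e * ps)" unfolding hYs C(2)[OF e] by (simp add: d dC[OF e] mat_assoc)
    also have "\<dots> = D e"
    proof -
      have "et * (D e * ps) = (et * ea e) * (S0 * (ps * ps)) - (et * et) * (S0 * (pa e * ps))"
        unfolding D_eq[OF e] by (simp add: d da[OF e] mat_minus_distrib mat_assoc)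
      then show ?thesis unfolding re(6)[OF e] rp(1) re(2) rp(7)[OF e] D_eq[OF e] .
    qed
    finally show ?thesis .
  qed
  define S where "S = S1 - X * T"
  have dS: "dim_row S = m" "dim_col S = n" by (simp_all add: S_def d dT)
  have Xs: "es * (X * Z) = X * (ps * Z)" "et * (X * Z) = X * (pt * Z)" if "dim_row Z = n" for Z
    using that by (simp_all add: mat_assoc[symmetric] d hYs)
  have "is_module_hom Q n \<rho> m \<epsilon> S"
  proof (rule is_module_homI[OF mod mod\<epsilon>])
    show "S \<in> carrier_mat m n" using dS by (intro carrier_matI)
    show "S * \<rho> (path_elem (s, [], s)) = \<epsilon> (path_elem (s, [], s)) * S"
      unfolding es_def[symmetric] ps_def[symmetric] S_def
      by (simp add: d dT dS1 mat_minus_distrib mat_assoc S1s Xs Tst)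
    show "S * \<rho> (path_elem (t, [], t)) = \<epsilon> (path_elem (t, [], t)) * S"
      unfolding et_def[symmetric] pt_def[symmetric] S_def
      by (simp add: d dT dS1 mat_minus_distrib mat_assoc S1t Xs Tst)
    fix e assume e: "e \<in> arcs Q"
    have "ea e * S1 - S1 * pa e = X * (pa e * T) - X * (T * pa e)"
      using key[OF e] by (simp add: D_def d dT da[OF e] mat_minus_distrib)
    then have "ea e * S1 - X * (pa e * T) = S1 * pa e - X * (T * pa e)"
      by (rule minus_mat_exchange[of _ m n, rotated 4]) (auto simp: d dT dS1 da[OF e] intro!: carrier_matI)
    moreover have "X * (pa e * T) = ea e * (X * T)"
      using hYa(2)[OF e] by (simp add: mat_assoc[symmetric] d dT da[OF e])
    ultimately show "S * \<rho> (path_elem (s, [e], t)) = \<epsilon> (path_elem (s, [e], t)) * S"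
      unfolding ea_def[symmetric] pa_def[symmetric] S_def
      by (simp add: d dT dS1 da[OF e] mat_minus_distrib mat_assoc)
  qed
  moreover have "Y * S = 1\<^sub>m n"
  proof -
    have "Y * S = Y * S1 - (Y * X) * T" by (simp add: S_def d dT dS1 mat_minus_distrib mat_assoc)
    then show ?thesis unfolding YS1 M(1) using dT by (auto simp: mat_dim_simps intro!: eq_matI)
  qed
  ultimately show "\<exists>S. is_module_hom Q n \<rho> m \<epsilon> S \<and> Y * S = 1\<^sub>m n" by (intro exI conjI)
qed

definition combination :: "('a \<Rightarrow> 'k mat) \<Rightarrow> (('v, 'a) path \<Rightarrow> 'k) \<Rightarrow> 'k mat" where
  "combination C f = mat q p (\<lambda>(i, j). \<Sum>e\<in>arcs Q. f (s, [e], t) * C e $$ (i, j))"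

lemma dims_combination [simp]: "dim_row (combination C f) = q" "dim_col (combination C f) = p"
  by (simp_all add: combination_def)

text \<open>
  A tuple \<open>C\<close> gives the extension on \<open>M \<oplus> M\<close> in which an arrow \<open>e\<close> also acts by \<open>C\<^sub>e\<close> from the
  quotient to the submodule. In the matrices, \<open>L\<close> and \<open>R\<close> are the linear splittings of the inclusion
  \<open>X\<close> and the projection \<open>Y\<close>. The component \<open>T = L S\<close> of a module splitting \<open>S\<close> satisfies
  \<open>T \<rho>(e) - \<rho>(e) T = U' C\<^sub>e V\<close>, and its diagonal blocks solve \<open>C\<^sub>e = A\<^sub>e X - Y A\<^sub>e\<close>.
\<close>

lemma rigid_if_Ext1_vanishes:
  assumes ext: "Ext1_vanishes Q n \<rho> n \<rho>"
  shows "rigid_tuple (arcs Q) p q tuple"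
  unfolding rigid_tuple_def
proof (intro allI impI)
  fix C :: "'a \<Rightarrow> 'k mat" assume Ct: "is_tuple (arcs Q) p q C"
  define D where "D f = U' * (combination C f * V)" for f
  have dD: "D f \<in> carrier_mat n n" for f by (auto simp: D_def intro!: carrier_matI)
  define \<epsilon> where "\<epsilon> f = four_block_mat (\<rho> f) (D f) (0\<^sub>m n n) (\<rho> f)" for f
  have c\<epsilon>: "\<epsilon> f \<in> carrier_mat (n + n) (n + n)" if "f \<in> carrier (path_algebra Q)" for f
    unfolding \<epsilon>_def by (rule four_block_carrier_mat) (use rho(1)[OF that] in auto)
  have comb_lin: "combination C (\<lambda>x. f x + g x) = combination C f + combination C g"
    "combination C (\<lambda>x. c * f x) = c \<cdot>\<^sub>m combination C f" for f g c
    by (auto simp: combination_def distrib_right sum.distrib sum_distrib_left mult.assoc intro!: eq_matI)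
  have mod\<epsilon>: "is_module Q (n + n) \<epsilon>"
  proof (rule is_moduleI)
    fix f g :: "('v, 'a) path \<Rightarrow> 'k"
    assume f: "f \<in> carrier (path_algebra Q)" and g: "g \<in> carrier (path_algebra Q)"
    note fc = rho(1)[OF f] and gc = rho(1)[OF g]
    have "combination C (f \<otimes>\<^bsub>path_algebra Q\<^esub> g) = f (t, [], t) \<cdot>\<^sub>m combination C g + g (s, [], s) \<cdot>\<^sub>m combination C f"
      by (auto simp: combination_def mult_path_algebra distrib_left distrib_right sum.distrib sum_distrib_left mult_ac intro!: eq_matI)
    then have "D (f \<otimes>\<^bsub>path_algebra Q\<^esub> g) = f (t, [], t) \<cdot>\<^sub>m D g + g (s, [], s) \<cdot>\<^sub>m D f"
      by (simp add: D_def mat_add_distrib mat_smult_mult)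
    also have "f (t, [], t) \<cdot>\<^sub>m D g = \<rho> f * D g"
      using dims_rho[OF f] by (simp add: D_def mat_assoc[symmetric] rho_U'[OF f] mat_smult_mult)
    also have "g (s, [], s) \<cdot>\<^sub>m D f = D f * \<rho> g"
      using dims_rho[OF g] by (simp add: D_def mat_assoc V_rho[OF g] mat_smult_mult)
    finally have Dfg: "D (f \<otimes>\<^bsub>path_algebra Q\<^esub> g) = \<rho> f * D g + D f * \<rho> g" .
    have "\<epsilon> f * \<epsilon> g = four_block_mat (\<rho> f * \<rho> g + D f * 0\<^sub>m n n) (\<rho> f * D g + D f * \<rho> g)
        (0\<^sub>m n n * \<rho> g + \<rho> f * 0\<^sub>m n n) (0\<^sub>m n n * D g + \<rho> f * \<rho> g)"
      unfolding \<epsilon>_def by (rule mult_four_block_mat[OF fc dD zero_carrier_mat fc gc dD zero_carrier_mat gc])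
    also have "\<dots> = \<epsilon> (f \<otimes>\<^bsub>path_algebra Q\<^esub> g)"
      unfolding \<epsilon>_def Dfg rho(2)[OF f g] using dims_rho[OF f] dims_rho[OF g] carrier_matD[OF dD]
      by (simp add: mat_dim_simps)
    finally show "\<epsilon> (f \<otimes>\<^bsub>path_algebra Q\<^esub> g) = \<epsilon> f * \<epsilon> g" ..
    have "D (\<lambda>x. f x + g x) = D f + D g"
      by (simp add: D_def comb_lin mat_add_distrib)
    then show "\<epsilon> (\<lambda>x. f x + g x) = \<epsilon> f + \<epsilon> g"
      unfolding \<epsilon>_def rho(3)[OF f g] add_four_block_mat[OF fc dD zero_carrier_mat fc gc dD zero_carrier_mat gc]
      by simp
  next
    fix f :: "('v, 'a) path \<Rightarrow> 'k" and c :: 'k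
    assume f: "f \<in> carrier (path_algebra Q)"
    show "\<epsilon> f \<in> carrier_mat (n + n) (n + n)" by (rule c\<epsilon>[OF f])
    have "D (\<lambda>x. c * f x) = c \<cdot>\<^sub>m D f" by (simp add: D_def comb_lin mat_smult_mult)
    then show "\<epsilon> (\<lambda>x. c * f x) = c \<cdot>\<^sub>m \<epsilon> f"
      unfolding \<epsilon>_def rho(5)[OF f] smult_four_block_mat[OF rho(1)[OF f] dD zero_carrier_mat rho(1)[OF f]]
      by simp
  next
    have "combination C \<one>\<^bsub>path_algebra Q\<^esub> = 0\<^sub>m q p"
      by (auto simp: combination_def one_path_algebra path_elem_values intro!: eq_matI)
    then have "D \<one>\<^bsub>path_algebra Q\<^esub> = 0\<^sub>m n n" by (simp add: D_def mat_dim_simps)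
    then show "\<epsilon> \<one>\<^bsub>path_algebra Q\<^esub> = 1\<^sub>m (n + n)" unfolding \<epsilon>_def rho(4) by simp
  qed
  define X R where "X = four_block_mat (1\<^sub>m n) (0\<^sub>m n 0) (0\<^sub>m n n) (0\<^sub>m n 0 :: 'k mat)"
    and "R = four_block_mat (0\<^sub>m n n) (0\<^sub>m n 0) (1\<^sub>m n) (0\<^sub>m n 0 :: 'k mat)"
  define L Y where "L = four_block_mat (1\<^sub>m n) (0\<^sub>m n n) (0\<^sub>m 0 n) (0\<^sub>m 0 n :: 'k mat)"
    and "Y = four_block_mat (0\<^sub>m n n) (1\<^sub>m n) (0\<^sub>m 0 n) (0\<^sub>m 0 n :: 'k mat)"
  note z = zero_carrier_mat and o = one_carrier_mat
  have pad: "four_block_mat A (0\<^sub>m n 0) (0\<^sub>m 0 n) (0\<^sub>m 0 0) = A" if "A \<in> carrier_mat n n" for A :: "'k mat"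
    using that by (auto intro!: eq_matI)
  have eqs: "L * X = 1\<^sub>m n" "Y * R = 1\<^sub>m n" "Y * X = 0\<^sub>m n n" "X * L + R * Y = 1\<^sub>m (n + n)"
    unfolding L_def X_def Y_def R_def
      mult_four_block_mat[OF o z z z o z z z] mult_four_block_mat[OF z o z z z z o z]
      mult_four_block_mat[OF z o z z o z z z] mult_four_block_mat[OF z z o z z o z z]
    by (auto intro!: eq_matI)
  have cs: "X \<in> carrier_mat (n + n) n" "R \<in> carrier_mat (n + n) n" "L \<in> carrier_mat n (n + n)" "Y \<in> carrier_mat n (n + n)"
    by (auto simp: X_def R_def L_def Y_def)
  have hX: "is_module_hom Q n \<rho> (n + n) \<epsilon> X"
    unfolding is_module_hom_def
  proof (intro conjI ballI cs)
    fix f :: "('v, 'a) path \<Rightarrow> 'k" assume f: "f \<in> carrier (path_algebra Q)"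
    note fc = rho(1)[OF f]
    have "X * four_block_mat (\<rho> f) (0\<^sub>m n 0) (0\<^sub>m 0 n) (0\<^sub>m 0 0) = \<epsilon> f * X"
      unfolding X_def \<epsilon>_def mult_four_block_mat[OF o z z z fc z z z]
        mult_four_block_mat[OF fc dD z fc o z z z]
      by (intro cong_four_block_mat) (use dims_rho[OF f] carrier_matD[OF dD] in \<open>auto simp: mat_dim_simps intro!: eq_matI\<close>)
    then show "X * \<rho> f = \<epsilon> f * X" unfolding pad[OF fc] .
  qed
  have hY: "is_module_hom Q (n + n) \<epsilon> n \<rho> Y"
    unfolding is_module_hom_def
  proof (intro conjI ballI cs)
    fix f :: "('v, 'a) path \<Rightarrow> 'k" assume f: "f \<in> carrier (path_algebra Q)"
    note fc = rho(1)[OF f]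
    have "Y * \<epsilon> f = four_block_mat (\<rho> f) (0\<^sub>m n 0) (0\<^sub>m 0 n) (0\<^sub>m 0 0) * Y"
      unfolding Y_def \<epsilon>_def mult_four_block_mat[OF z o z z fc dD z fc]
        mult_four_block_mat[OF fc z z z z o z z]
      by (intro cong_four_block_mat) (use dims_rho[OF f] carrier_matD[OF dD] in \<open>auto simp: mat_dim_simps intro!: eq_matI\<close>)
    then show "Y * \<epsilon> f = \<rho> f * Y" unfolding pad[OF fc] .
  qed
  from ext[unfolded Ext1_vanishes_def, rule_format, OF conjI[OF mod\<epsilon> short_exact_if_split[OF hX hY cs(3,2) eqs]]]
  obtain S where S: "is_module_hom Q n \<rho> (n + n) \<epsilon> S" "Y * S = 1\<^sub>m n" by (elim exE conjE)
  have dS: "dim_row S = n + n" "dim_col S = n" using S by (auto simp: is_module_hom_def)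
  define T where "T = L * S"
  have dT: "dim_row T = n" "dim_col T = n" using cs dS by (auto simp: T_def)
  have split: "T * \<rho> f = \<rho> f * T + D f" if f: "f \<in> carrier (path_algebra Q)" for f
  proof -
    note fc = rho(1)[OF f]
    have L\<epsilon>: "L * \<epsilon> f = \<rho> f * L + D f * Y"
    proof -
      have "L * \<epsilon> f = four_block_mat (\<rho> f) (D f) (0\<^sub>m 0 n) (0\<^sub>m 0 n)"
        unfolding L_def \<epsilon>_def mult_four_block_mat[OF o z z z fc dD z fc]
        by (intro cong_four_block_mat) (use dims_rho[OF f] carrier_matD[OF dD] in \<open>auto simp: mat_dim_simps\<close>)
      moreover have "\<rho> f * L = four_block_mat (\<rho> f) (0\<^sub>m n n) (0\<^sub>m 0 n) (0\<^sub>m 0 n)"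
      proof -
        have "four_block_mat (\<rho> f) (0\<^sub>m n 0) (0\<^sub>m 0 n) (0\<^sub>m 0 0) * L = four_block_mat (\<rho> f) (0\<^sub>m n n) (0\<^sub>m 0 n) (0\<^sub>m 0 n)"
          unfolding L_def mult_four_block_mat[OF fc z z z o z z z]
          by (intro cong_four_block_mat) (use dims_rho[OF f] in \<open>auto simp: mat_dim_simps\<close>)
        then show ?thesis unfolding pad[OF fc] .
      qed
      moreover have "D f * Y = four_block_mat (0\<^sub>m n n) (D f) (0\<^sub>m 0 n) (0\<^sub>m 0 n)"
      proof -
        have "four_block_mat (D f) (0\<^sub>m n 0) (0\<^sub>m 0 n) (0\<^sub>m 0 0) * Y = four_block_mat (0\<^sub>m n n) (D f) (0\<^sub>m 0 n) (0\<^sub>m 0 n)"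
          unfolding Y_def mult_four_block_mat[OF dD z z z z o z z]
          by (intro cong_four_block_mat) (use carrier_matD[OF dD] in \<open>auto simp: mat_dim_simps\<close>)
        then show ?thesis unfolding pad[OF dD] .
      qed
      ultimately show ?thesis
        using add_four_block_mat[OF fc z z z z dD z z] fc dD[of f] by (simp add: mat_dim_simps)
    qed
    have "T * \<rho> f = L * (S * \<rho> f)" using cs dS dims_rho[OF f] by (simp add: T_def mat_assoc)
    also have "S * \<rho> f = \<epsilon> f * S" using S(1) f by (simp add: is_module_hom_def)
    also have "L * (\<epsilon> f * S) = (L * \<epsilon> f) * S" using cs dS c\<epsilon>[OF f] by (simp add: mat_assoc)
    also have "\<dots> = \<rho> f * T + D f * (Y * S)"
      unfolding L\<epsilon> using cs dS dims_rho[OF f] carrier_matD[OF dD] by (simp add: T_def mat_assoc mat_add_distrib)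
    also have "\<dots> = \<rho> f * T + D f" unfolding S(2) using carrier_matD[OF dD] by (simp add: mat_dim_simps)
    finally show ?thesis .
  qed
  show "\<exists>X\<in>carrier_mat p p. \<exists>Y\<in>carrier_mat q q. \<forall>e\<in>arcs Q. C e = tuple e * X - Y * tuple e"
  proof (intro bexI ballI)
    fix e assume e: "e \<in> arcs Q"
    have Ce: "C e \<in> carrier_mat q p" using Ct e by (simp add: is_tuple_def)
    have "combination C (path_elem (s, [e], t)) = C e"
      using Ce e by (auto simp: combination_def path_elem_values if_distrib[of "\<lambda>x. x * _"] cong: if_cong intro!: eq_matI)
    then have "T * (U' * (tuple e * V)) = U' * (tuple e * V) * T + U' * (C e * V)"
      using split[OF gens(3)[OF e]] unfolding rho_arrow[OF e] D_def by simp
    then have "V' * (T * (U' * (tuple e * V)) * U) = V' * ((U' * (tuple e * V) * T + U' * (C e * V)) * U)" by simp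
    then have eq: "V' * (T * U') * tuple e = tuple e * (V * (T * U)) + C e"
      using Ce dT by (simp add: mat_assoc mat_add_distrib cancel mat_dim_simps)
    show "C e = tuple e * ((- 1) \<cdot>\<^sub>m (V * (T * U))) - ((- 1) \<cdot>\<^sub>m (V' * (T * U'))) * tuple e"
    proof (rule eq_matI)
      fix i j assume "i < dim_row (tuple e * ((- 1) \<cdot>\<^sub>m (V * (T * U))) - ((- 1) \<cdot>\<^sub>m (V' * (T * U'))) * tuple e)"
        "j < dim_col (tuple e * ((- 1) \<cdot>\<^sub>m (V * (T * U))) - ((- 1) \<cdot>\<^sub>m (V' * (T * U'))) * tuple e)"
      then have ij: "i < q" "j < p" by auto
      have "(V' * (T * U') * tuple e) $$ (i, j) = (tuple e * (V * (T * U)) + C e) $$ (i, j)" unfolding eq ..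
      then have "(V' * (T * U') * tuple e) $$ (i, j) = (tuple e * (V * (T * U))) $$ (i, j) + C e $$ (i, j)"
        using ij Ce by (simp del: index_mult_mat add: index_mult_mat(2,3))
      then show "C e $$ (i, j) = (tuple e * ((- 1) \<cdot>\<^sub>m (V * (T * U))) - ((- 1) \<cdot>\<^sub>m (V' * (T * U'))) * tuple e) $$ (i, j)"
        using ij by (simp add: mat_smult_mult del: index_mult_mat add: index_mult_mat(2,3))
    qed (use Ce in auto)
  qed (auto intro!: carrier_matI)
qed

end


section \<open>The module of a tuple\<close>

context kronecker_quiver
begin

definition tuple_module :: "nat \<Rightarrow> nat \<Rightarrow> ('a \<Rightarrow> 'k::field mat) \<Rightarrow> (('v, 'a) path \<Rightarrow> 'k) \<Rightarrow> 'k mat" where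
  "tuple_module p q A f = four_block_mat (f (s, [], s) \<cdot>\<^sub>m 1\<^sub>m p) (0\<^sub>m p q)
     (mat q p (\<lambda>(i, j). \<Sum>e\<in>arcs Q. f (s, [e], t) * A e $$ (i, j))) (f (t, [], t) \<cdot>\<^sub>m 1\<^sub>m q)"

lemma tuple_module_is_module:
  fixes A :: "'a \<Rightarrow> 'k::field mat"
  shows "is_module Q (p + q) (tuple_module p q A)"
proof (rule is_moduleI)
  define M where "M f = mat q p (\<lambda>(i, j). \<Sum>e\<in>arcs Q. f (s, [e], t) * A e $$ (i, j))" for f :: "('v, 'a) path \<Rightarrow> 'k"
  have M: "M f \<in> carrier_mat q p" for f by (simp add: M_def)
  note tm = tuple_module_def[of p q A, folded M_def]
  have one: "c \<cdot>\<^sub>m 1\<^sub>m m \<in> carrier_mat m m" for c :: 'k and m by simp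
  {
    fix f :: "('v, 'a) path \<Rightarrow> 'k"
    show "tuple_module p q A f \<in> carrier_mat (p + q) (p + q)"
      unfolding tm by (rule four_block_carrier_mat[OF one one])
    fix c :: 'k
    have "M (\<lambda>x. c * f x) = c \<cdot>\<^sub>m M f"
      by (auto simp: M_def sum_distrib_left mult.assoc intro!: eq_matI)
    then show "tuple_module p q A (\<lambda>x. c * f x) = c \<cdot>\<^sub>m tuple_module p q A f"
      unfolding tm smult_four_block_mat[OF one zero_carrier_mat M one]
      by (intro cong_four_block_mat) (auto intro!: eq_matI)
  next
    fix f g :: "('v, 'a) path \<Rightarrow> 'k"
    have "M (\<lambda>x. f x + g x) = M f + M g"
      by (auto simp: M_def sum.distrib distrib_right intro!: eq_matI)
    then show "tuple_module p q A (\<lambda>x. f x + g x) = tuple_module p q A f + tuple_module p q A g"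
      unfolding tm add_four_block_mat[OF one zero_carrier_mat M one one zero_carrier_mat M one]
      by (intro cong_four_block_mat) (auto simp: distrib_right intro!: eq_matI)
    have MM: "M (f \<otimes>\<^bsub>path_algebra Q\<^esub> g) = g (s, [], s) \<cdot>\<^sub>m M f + f (t, [], t) \<cdot>\<^sub>m M g"
      by (auto simp: M_def mult_path_algebra distrib_left distrib_right sum.distrib sum_distrib_left mult_ac intro!: eq_matI)
    have dM: "dim_row (M f) = q" "dim_col (M f) = p" for f by (simp_all add: M_def)
    show "tuple_module p q A (f \<otimes>\<^bsub>path_algebra Q\<^esub> g) = tuple_module p q A f * tuple_module p q A g"
      unfolding tm mult_four_block_mat[OF one zero_carrier_mat M one one zero_carrier_mat M one]
        mult_path_algebra(1,2) MM
      by (intro cong_four_block_mat)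
        (simp_all add: mat_smult_mult dM mat_dim_simps, auto intro!: eq_matI)
  }
  have "M \<one>\<^bsub>path_algebra Q\<^esub> = 0\<^sub>m q p"
    by (auto simp: M_def one_path_algebra path_elem_values intro!: eq_matI)
  moreover have "1 \<cdot>\<^sub>m 1\<^sub>m m = (1\<^sub>m m :: 'k mat)" for m by (auto intro!: eq_matI)
  ultimately show "tuple_module p q A \<one>\<^bsub>path_algebra Q\<^esub> = 1\<^sub>m (p + q)"
    unfolding tm by (simp add: one_path_algebra path_elem_values)
qed

lemma tuple_module_framed:
  fixes A :: "'a \<Rightarrow> 'k::field mat"
  assumes A: "is_tuple (arcs Q) p q A"
  obtains U V U' V' where "framed_module Q s t (p + q) p q (tuple_module p q A) U V U' V'"
    "\<And>e. e \<in> arcs Q \<Longrightarrow> V' * (tuple_module p q A (path_elem (s, [e], t)) * U) = A e"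
proof -
  define U V where "U = four_block_mat (1\<^sub>m p) (0\<^sub>m p 0) (0\<^sub>m q p) (0\<^sub>m q 0 :: 'k mat)"
    and "V = four_block_mat (1\<^sub>m p) (0\<^sub>m p q) (0\<^sub>m 0 p) (0\<^sub>m 0 q :: 'k mat)"
  define U' V' where "U' = four_block_mat (0\<^sub>m p q) (0\<^sub>m p 0) (1\<^sub>m q) (0\<^sub>m q 0 :: 'k mat)"
    and "V' = four_block_mat (0\<^sub>m q p) (1\<^sub>m q) (0\<^sub>m 0 p) (0\<^sub>m 0 q :: 'k mat)"
  note z = zero_carrier_mat and o = one_carrier_mat
  have one: "1 \<cdot>\<^sub>m 1\<^sub>m m = (1\<^sub>m m :: 'k mat)" "0 \<cdot>\<^sub>m 1\<^sub>m m = (0\<^sub>m m m :: 'k mat)" for m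
    by (auto intro!: eq_matI)
  have "mat q p (\<lambda>(i, j). \<Sum>e\<in>arcs Q. 0 * A e $$ (i, j)) = 0\<^sub>m q p" by (auto intro!: eq_matI)
  then have tm: "tuple_module p q A (path_elem (s, [], s)) = four_block_mat (1\<^sub>m p) (0\<^sub>m p q) (0\<^sub>m q p) (0\<^sub>m q q)"
    "tuple_module p q A (path_elem (t, [], t)) = four_block_mat (0\<^sub>m p p) (0\<^sub>m p q) (0\<^sub>m q p) (1\<^sub>m q)"
    by (simp_all add: tuple_module_def path_elem_values one)
  have "framed_module Q s t (p + q) p q (tuple_module p q A) U V U' V'"
  proof unfold_locales
    show "is_module Q (p + q) (tuple_module p q A)" by (rule tuple_module_is_module)
    show "U \<in> carrier_mat (p + q) p" "V \<in> carrier_mat p (p + q)"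
      "U' \<in> carrier_mat (p + q) q" "V' \<in> carrier_mat q (p + q)"
      by (auto simp: U_def V_def U'_def V'_def)
    show "tuple_module p q A (path_elem (s, [], s)) = U * V"
      unfolding tm U_def V_def mult_four_block_mat[OF o z z z o z z z]
      by (intro cong_four_block_mat) (auto simp: mat_dim_simps intro!: eq_matI)
    show "tuple_module p q A (path_elem (t, [], t)) = U' * V'"
      unfolding tm U'_def V'_def mult_four_block_mat[OF z z o z z o z z]
      by (intro cong_four_block_mat) (auto simp: mat_dim_simps intro!: eq_matI)
    show "V * U = 1\<^sub>m p" unfolding U_def V_def mult_four_block_mat[OF o z z z o z z z]
      by (auto simp: mat_dim_simps intro!: eq_matI)
    show "V' * U' = 1\<^sub>m q" unfolding U'_def V'_def mult_four_block_mat[OF z o z z z z o z]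
      by (auto simp: mat_dim_simps intro!: eq_matI)
  qed
  moreover have "V' * (tuple_module p q A (path_elem (s, [e], t)) * U) = A e" if e: "e \<in> arcs Q" for e
  proof -
    have Ae: "A e \<in> carrier_mat q p" using A e by (simp add: is_tuple_def)
    have "mat q p (\<lambda>(i, j). \<Sum>e'\<in>arcs Q. path_elem (s, [e], t) (s, [e'], t) * A e' $$ (i, j)) = A e"
      using Ae e by (auto simp: path_elem_values if_distrib[of "\<lambda>x. x * _"] cong: if_cong intro!: eq_matI)
    then have "tuple_module p q A (path_elem (s, [e], t)) = four_block_mat (0\<^sub>m p p) (0\<^sub>m p q) (A e) (0\<^sub>m q q)"
      unfolding tuple_module_def by (simp only: path_elem_values(7,8) one)
    then have "tuple_module p q A (path_elem (s, [e], t)) * U = four_block_mat (0\<^sub>m p p) (0\<^sub>m p 0) (A e) (0\<^sub>m q 0)"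
      unfolding U_def by (simp only: mult_four_block_mat[OF z z Ae z o z z z])
        (use Ae in \<open>auto simp: mat_dim_simps intro!: cong_four_block_mat\<close>)
    then show ?thesis
      unfolding V'_def by (simp only: mult_four_block_mat[OF z o z z z z Ae z])
        (use Ae in \<open>auto simp: mat_dim_simps intro!: eq_matI\<close>)
  qed
  ultimately show ?thesis using that by blast
qed

section \<open>Real Schur roots are the positive real roots\<close>

lemma brick_cong:
  assumes "\<And>e. e \<in> E \<Longrightarrow> A e = B e"
  shows "brick E p q A \<longleftrightarrow> brick E p q B"
  using assms by (simp add: brick_def is_tuple_def endo_def)

text \<open>
  The tuple of a rigid indecomposable module is indecomposable with a positive form, hence a real
  root. Conversely a brick whose dimension vector is a real root is rigid.
\<close>

lemma real_schur_roots_eq: "real_schur_roots TYPE('k::alg_closed_field) Q = positive_roots"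
proof (intro subset_antisym subsetI)
  fix b assume "b \<in> real_schur_roots TYPE('k) Q"
  then obtain n and \<rho> :: "(('v, 'a) path \<Rightarrow> 'k) \<Rightarrow> 'k mat" where mod: "is_module Q n \<rho>"
    and ind: "indecomposable Q n \<rho>" and ext: "Ext1_vanishes Q n \<rho> n \<rho>" and b: "b = dimension_vector Q n \<rho>"
    unfolding real_schur_roots_def mem_Collect_eq by (elim exE conjE)
  obtain p q U V U' V' where "framed_module Q s t n p q \<rho> U V U' V'"
    by (rule frame_exists[OF mod])
  then interpret framed_module Q s t n p q \<rho> U V U' V' .
  have it: "indecomposable_tuple (arcs Q) p q tuple" by (rule indecomposable_tuple_if_indecomposable[OF ind])
  then have "tits (card (arcs Q)) p q > 0"
    by (intro rigid_tuple_tits[OF finite_arcs tuple_is_tuple rigid_if_Ext1_vanishes[OF ext]])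
      (simp add: indecomposable_tuple_def)
  then have "tits (card (arcs Q)) p q = 1" by (rule indecomposable_tits[OF finite_arcs it])
  then show "b \<in> positive_roots"
    using s_neq_t by (auto simp: b dimension_vector_eq positive_roots_def tits_def)
next
  fix b assume b: "b \<in> positive_roots"
  define p q where "p = nat (b s)" and "q = nat (b t)"
  have pq: "int p = b s" "int q = b t" using b by (auto simp: p_def q_def positive_roots_def)
  have tits: "tits (card (arcs Q)) p q = 1" using b by (simp add: tits_def pq positive_roots_def)
  obtain A :: "'a \<Rightarrow> 'k mat" where A: "brick (arcs Q) p q A"
    using brick_exists[OF finite_arcs tits] by (elim exE)
  then have "is_tuple (arcs Q) p q A" by (simp add: brick_def)
  then obtain U V U' V' where fr: "framed_module Q s t (p + q) p q (tuple_module p q A) U V U' V'"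
    and tup: "\<And>e. e \<in> arcs Q \<Longrightarrow> V' * (tuple_module p q A (path_elem (s, [e], t)) * U) = A e"
    by (rule tuple_module_framed) blast
  interpret framed_module Q s t "p + q" p q "tuple_module p q A" U V U' V' by (rule fr)
  have bt: "brick (arcs Q) p q tuple"
    using A brick_cong[of "arcs Q" tuple A] tup by (simp add: tuple_def)
  have "indecomposable Q (p + q) (tuple_module p q A)"
    "Ext1_vanishes Q (p + q) (tuple_module p q A) (p + q) (tuple_module p q A)"
    by (rule indecomposable_if_brick[OF bt], rule Ext1_vanishes_if_rigid[OF brick_rigid[OF finite_arcs bt tits]])
  moreover have "b = dimension_vector Q (p + q) (tuple_module p q A)"
    using b by (auto simp: dimension_vector_eq pq positive_roots_def fun_eq_iff)
  ultimately show "b \<in> real_schur_roots TYPE('k) Q"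
    unfolding real_schur_roots_def mem_Collect_eq 
    by (intro exI[of _ "p + q"] exI[of _ "tuple_module p q A"] conjI tuple_module_is_module)
qed

end

lemma kronecker_quiver_if:
  fixes Q :: "(nat, 'a) pre_digraph"
  assumes fin: "fin_digraph Q" and verts: "verts Q = {1, 2}"
    and conn: "Digraph_Component.connected Q" and acyc: "acyclic (arcs_ends Q)"
  obtains s t where "kronecker_quiver Q s t" "{s, t} = {1, 2}"
proof -
  interpret fin_digraph Q by (rule fin)
  have ends: "(tail Q a, head Q a) \<in> arcs_ends Q" if "a \<in> arcs Q" for a
    using that by (auto simp: arcs_ends_def arc_to_ends_def)
  have vs: "tail Q a \<in> {1, 2}" "head Q a \<in> {1, 2}" if "a \<in> arcs Q" for a
    using tail_in_verts[OF that] head_in_verts[OF that] unfolding verts .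
  have ne: "tail Q a \<noteq> head Q a" if "a \<in> arcs Q" for a
    using ends[OF that] acyc by (metis acyclic_def trancl.r_into_trancl)
  have "arcs Q \<noteq> {}"
  proof
    assume e: "arcs Q = {}"
    have "1 \<rightarrow>\<^sup>*\<^bsub>mk_symmetric Q\<^esub> 2"
      using conn verts by (auto simp: connected_def strongly_connected_def)
    moreover have "arcs_ends (mk_symmetric Q) = {}"
      using e by (simp add: arcs_ends_conv parcs_mk_symmetric)
    ultimately show False unfolding reachable_def by (cases rule: rtrancl_on.cases) auto
  qed
  then obtain a where a: "a \<in> arcs Q" by blast
  define s t where "s = tail Q a" and "t = head Q a"
  have st: "{s, t} = {1, 2}" "s \<noteq> t" using vs[OF a] ne[OF a] by (auto simp: s_def t_def)
  have "tail Q b = s \<and> head Q b = t" if b: "b \<in> arcs Q" for b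
  proof (rule ccontr)
    assume "\<not> ?thesis"
    then have "tail Q b = t" "head Q b = s" using vs[OF b] ne[OF b] st by auto
    then have "(s, s) \<in> (arcs_ends Q)\<^sup>+"
      using ends[OF a] ends[OF b] by (auto simp: s_def t_def)
    then show False using acyc by (auto simp: acyclic_def)
  qed
  then have "kronecker_quiver Q s t"
    using st verts \<open>arcs Q \<noteq> {}\<close> by unfold_locales auto
  then show ?thesis using that st by blast
qed

theorem mainTheorem4:
  fixes Q :: "(nat, 'a) pre_digraph"
  assumes "fin_digraph Q"
    and "verts Q = {1, 2}"
    and "Digraph_Component.connected Q"
    and "acyclic (arcs_ends Q)"
  shows "{curve_root Q \<sigma> \<eta> | \<sigma> \<eta>. \<sigma> \<in> P_perms Q \<and> \<eta> \<in> Gamma_curves Q \<sigma>} =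
    real_schur_roots TYPE('k::alg_closed_field) Q"
proof -
  obtain s t where "kronecker_quiver Q s t" and st: "{s, t} = {1, 2}"
    by (rule kronecker_quiver_if[OF assms])
  then interpret kronecker_quiver Q s t by simp
  have card: "card (verts Q) = 2" by (simp add: assms(2))
  define \<sigma> where "\<sigma> = (if s = 1 then id else Transposition.transpose 1 (2::nat))"
  have perm: "\<sigma> permutes {1, 2}"
    unfolding \<sigma>_def by (simp add: permutes_swap_id permutes_id)
  have "\<sigma> 1 = s" "\<sigma> 2 = t"
  proof -
    have "s = 1 \<and> t = 2 \<or> s = 2 \<and> t = 1" using st unfolding doubleton_eq_iff .
    then show "\<sigma> 1 = s" "\<sigma> 2 = t" by (auto simp: \<sigma>_def)
  qed
  moreover have "(t, s) \<notin> arcs_ends Q"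
    using arcs_Q s_neq_t by (auto simp: arcs_ends_def arc_to_ends_def)
  ultimately have \<sigma>: "\<sigma> \<in> P_perms Q"
    using perm by (auto simp: P_perms_def assms(2))
  have "{curve_root Q \<sigma> \<eta> | \<sigma> \<eta>. \<sigma> \<in> P_perms Q \<and> \<eta> \<in> Gamma_curves Q \<sigma>} = positive_roots"
  proof (intro subset_antisym subsetI)
    fix b assume "b \<in> {curve_root Q \<sigma> \<eta> | \<sigma> \<eta>. \<sigma> \<in> P_perms Q \<and> \<eta> \<in> Gamma_curves Q \<sigma>}"
    then obtain \<sigma> \<eta> where b: "b = curve_root Q \<sigma> \<eta>" and \<eta>: "admissible Q \<sigma> \<eta>"
      by (auto simp: Gamma_curves_def)
    \<comment> \<open>No topology is needed here: every reflection has a positive real root.\<close>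
    have "word_product Q (crossing_word (card (verts Q)) \<sigma> \<eta>) \<in> reflections Q"
      using \<eta> by (simp add: admissible_def reflection_words_def Let_def)
    then show "b \<in> positive_roots"
      unfolding b curve_root_def by (rule root_of_reflection_positive)
  next
    fix b assume "b \<in> positive_roots"
    then obtain i j m where ij: "{i, j} = {s, t}"
      and word: "alternating i j (2 * m + 1) \<in> reflection_words Q"
      and root: "root_of_reflection Q (word_product Q (alternating i j (2 * m + 1))) = b"
      by (rule positive_root_of_alternating_word)
    have "{i, j} = {1, 2}" using ij st by simp
    from spiral_curve_exists[OF perm this, of m] obtain \<eta> where
      "pathin (surface 2) \<eta>" "\<forall>x \<in> {0..1}. \<eta> x \<in> marked_points 2 \<longleftrightarrow> x \<in> {0, 1}"
      "\<exists>\<epsilon>>0. \<eta> ` {0..\<epsilon>} \<subseteq> segment_L 2 1 \<and> \<eta> ` {1 - \<epsilon>..1} \<subseteq> segment_L 2 2"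
      "\<forall>x \<in> {0..1}. \<eta> x \<in> arcs_T 2 \<sigma> - marked_points 2 \<longrightarrow>
         transversal_at (surface 2) (arcs_T 2 \<sigma>) \<eta> x"
      "finite (crossing_times 2 \<sigma> \<eta>)"
      and cw: "crossing_word 2 \<sigma> \<eta> = alternating i j (2 * m + 1)"
      and simple: "simple_curve \<eta>" .
    then have "admissible Q \<sigma> \<eta>"
      unfolding admissible_def Let_def card cw by (intro conjI word)
    then have "\<eta> \<in> Gamma_curves Q \<sigma>" using simple by (simp add: Gamma_curves_def)
    moreover have "curve_root Q \<sigma> \<eta> = b" unfolding curve_root_def card cw by (rule root)
    ultimately show "b \<in> {curve_root Q \<sigma> \<eta> | \<sigma> \<eta>. \<sigma> \<in> P_perms Q \<and> \<eta> \<in> Gamma_curves Q \<sigma>}"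
      using \<sigma> by blast
  qed
  then show ?thesis by (simp only: real_schur_roots_eq)
qed

end
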